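(* Let $G=(V,E,w)$ be a $k$-connected vertex-weighted graph with $w:V\to\mathbb{N}$, let $w_1,\dots,w_k\in\mathbb{N}$ with $\sum_{i=1}^k w_i=w(G)$ and $\min_{i\in[k]}w_i\ge\max_{v\in V}w(v)$, and let $r:=\frac{\max_{i\in[k]}w_i}{\min_{j\in[k]}w_j}$. Then a connected $k$-partition $T_1,\dots,T_k$ of $V$ such that $\frac13 w_i\le w(T_i)\le\max\{r,3\}\,w_i$ for every $i\in[k]$ can be found in time $\mathcal{O}(k|V|^2|E|)$.
   Context: $\mathbb{N}$ denotes the positive integers. For $U\subseteq V$, $w(U)=\sum_{u\in U}w(u)$ and $w(G)=w(V)$. A connected $k$-partition of $V$ is a partition $T_1,\dots,T_k$ of $V$ such that each induced subgraph $G[T_i]$ is connected. *)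

theory Defs
  imports Complex_Main "HOL-Library.Disjoint_Sets"
begin

section \<open>Graphs\<close>

definition simple_graph :: "'a set \<Rightarrow> 'a set set \<Rightarrow> bool" where
  "simple_graph V E \<longleftrightarrow> finite V \<and> (\<forall>e\<in>E. e \<subseteq> V \<and> card e = 2)"

definition induced_edges :: "'a set set \<Rightarrow> 'a set \<Rightarrow> 'a set set" where
  "induced_edges E U = {e \<in> E. e \<subseteq> U}"

definition connected_graph :: "'a set \<Rightarrow> 'a set set \<Rightarrow> bool" where
  "connected_graph V E \<longleftrightarrow>
     V \<noteq> {} \<and> (\<forall>u\<in>V. \<forall>v\<in>V. (u, v) \<in> {(x, y). {x, y} \<in> E}\<^sup>*)"

definition k_connected :: "nat \<Rightarrow> 'a set \<Rightarrow> 'a set set \<Rightarrow> bool" where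
  "k_connected k V E \<longleftrightarrow>
     k < card V \<and>
     (\<forall>X \<subseteq> V. card X < k \<longrightarrow> connected_graph (V - X) (induced_edges E (V - X)))"

text \<open>Parts are indexed by \<open>0, \<dots>, k - 1\<close>; they are nonempty because connected
  graphs are.\<close>

definition connected_partition ::
  "'a set \<Rightarrow> 'a set set \<Rightarrow> nat \<Rightarrow> (nat \<Rightarrow> 'a set) \<Rightarrow> bool" where
  "connected_partition V E k T \<longleftrightarrow>
     (\<Union>i<k. T i) = V \<and> disjoint_family_on T {..<k} \<and>
     (\<forall>i<k. connected_graph (T i) (induced_edges E (T i)))"

section \<open>Model of computation\<close>

text \<open>A structured random access machine with the uniform cost measure. A state maps an
  array name and an index to a natural number; a scalar is a cell with a constant index.
  A program mentions only finitely many arrays. Addition and (truncated) subtraction are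
  the only arithmetic operations: with multiplication at unit cost the uniform measure
  would no longer be polynomially related to Turing machine time.\<close>

type_synonym state = "nat \<Rightarrow> nat \<Rightarrow> nat"

datatype aexp = Const nat | Cell nat aexp | Plus aexp aexp | Minus aexp aexp

datatype bexp = Less aexp aexp | Neg bexp | Conj bexp bexp

datatype com =
    Skip
  | Assign nat aexp aexp  \<comment> \<open>array, index, value\<close>
  | Seq com com
  | Cond bexp com com
  | While bexp com

fun aval :: "aexp \<Rightarrow> state \<Rightarrow> nat" where
  "aval (Const n) s = n"
| "aval (Cell a e) s = s a (aval e s)"
| "aval (Plus e1 e2) s = aval e1 s + aval e2 s"
| "aval (Minus e1 e2) s = aval e1 s - aval e2 s"

fun bval :: "bexp \<Rightarrow> state \<Rightarrow> bool" where
  "bval (Less e1 e2) s \<longleftrightarrow> aval e1 s < aval e2 s"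
| "bval (Neg b) s \<longleftrightarrow> \<not> bval b s"
| "bval (Conj b1 b2) s \<longleftrightarrow> bval b1 s \<and> bval b2 s"

fun acost :: "aexp \<Rightarrow> nat" where
  "acost (Const n) = 1"
| "acost (Cell a e) = 1 + acost e"
| "acost (Plus e1 e2) = 1 + acost e1 + acost e2"
| "acost (Minus e1 e2) = 1 + acost e1 + acost e2"

fun bcost :: "bexp \<Rightarrow> nat" where
  "bcost (Less e1 e2) = 1 + acost e1 + acost e2"
| "bcost (Neg b) = 1 + bcost b"
| "bcost (Conj b1 b2) = 1 + bcost b1 + bcost b2"

text \<open>\<open>exec c s t s'\<close>: started in \<open>s\<close>, the program \<open>c\<close> halts after \<open>t\<close> steps in \<open>s'\<close>.\<close>

inductive exec :: "com \<Rightarrow> state \<Rightarrow> nat \<Rightarrow> state \<Rightarrow> bool" where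
  Skip: "exec Skip s 1 s"
| Assign: "exec (Assign a i e) s (1 + acost i + acost e)
             (s(a := (s a)(aval i s := aval e s)))"
| Seq: "exec c1 s t1 s1 \<Longrightarrow> exec c2 s1 t2 s2 \<Longrightarrow> exec (Seq c1 c2) s (t1 + t2) s2"
| CondTrue: "bval b s \<Longrightarrow> exec c1 s t s' \<Longrightarrow> exec (Cond b c1 c2) s (1 + bcost b + t) s'"
| CondFalse: "\<not> bval b s \<Longrightarrow> exec c2 s t s' \<Longrightarrow> exec (Cond b c1 c2) s (1 + bcost b + t) s'"
| WhileFalse: "\<not> bval b s \<Longrightarrow> exec (While b c) s (1 + bcost b) s"
| WhileTrue: "bval b s \<Longrightarrow> exec c s t1 s1 \<Longrightarrow> exec (While b c) s1 t2 s2 \<Longrightarrow>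
    exec (While b c) s (1 + bcost b + t1 + t2) s2"

inductive_cases exec_SkipE: "exec Skip s t s'"
inductive_cases exec_AssignE: "exec (Assign a i e) s t s'"
inductive_cases exec_SeqE: "exec (Seq c1 c2) s t s'"
inductive_cases exec_CondE: "exec (Cond b c1 c2) s t s'"
inductive_cases exec_WhileE: "exec (While b c) s t s'"

lemma exec_deterministic:
  "exec c s t s' \<Longrightarrow> exec c s u s'' \<Longrightarrow> u = t \<and> s'' = s'"
proof (induction arbitrary: u s'' rule: exec.induct)
  case (Skip s)
  then show ?case by (rule exec_SkipE) simp
next
  case (Assign a i e s)
  then show ?case by (rule exec_AssignE) simp
next
  case (Seq c1 s t1 s1 c2 t2 s2)
  from Seq.prems show ?case by (rule exec_SeqE) (metis Seq.IH)
next
  case (CondTrue b s c1 t s' c2)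
  from CondTrue.prems show ?case by (rule exec_CondE) (auto simp: CondTrue.hyps(1) dest!: CondTrue.IH)
next
  case (CondFalse b s c2 t s' c1)
  from CondFalse.prems show ?case by (rule exec_CondE) (auto simp: CondFalse.hyps(1) dest!: CondFalse.IH)
next
  case (WhileFalse b s c)
  from WhileFalse.prems show ?case by (rule exec_WhileE) (auto simp: WhileFalse.hyps)
next
  case (WhileTrue b s c t1 s1 t2 s2)
  from WhileTrue.prems show ?case by (rule exec_WhileE) (auto simp: WhileTrue.hyps(1) dest!: WhileTrue.IH)
qed

section \<open>Encoding of instances and solutions\<close>

text \<open>The vertices and the edges may be listed in any order, and each edge may be
  oriented either way; an edge is a pair of positions in the vertex list.\<close>

definition lists_graph ::
  "'a list \<Rightarrow> (nat \<times> nat) list \<Rightarrow> 'a set \<Rightarrow> 'a set set \<Rightarrow> bool" where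
  "lists_graph vs es V E \<longleftrightarrow>
     distinct vs \<and> set vs = V \<and>
     (\<forall>(a, b)\<in>set es. a < length vs \<and> b < length vs) \<and>
     distinct (map (\<lambda>(a, b). {vs ! a, vs ! b}) es) \<and>
     set (map (\<lambda>(a, b). {vs ! a, vs ! b}) es) = E"

definition cells :: "nat list \<Rightarrow> nat \<Rightarrow> nat" where
  "cells xs i = (if i < length xs then xs ! i else 0)"

definition input_state ::
  "'a list \<Rightarrow> (nat \<times> nat) list \<Rightarrow> ('a \<Rightarrow> nat) \<Rightarrow> nat \<Rightarrow> (nat \<Rightarrow> nat) \<Rightarrow> state" where
  "input_state vs es w k W =
     (\<lambda>_ _. 0)
       (0 := cells [length vs, length es, k],
        1 := cells (map w vs),
        2 := cells (map W [0..<k]),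
        3 := cells (map fst es),
        4 := cells (map snd es))"

text \<open>On halting, array 5 holds at index \<open>j\<close> the number of the part of the \<open>j\<close>th
  vertex.\<close>

definition output_part :: "'a list \<Rightarrow> state \<Rightarrow> nat \<Rightarrow> 'a set" where
  "output_part vs s i = {vs ! j | j. j < length vs \<and> s 5 j = i}"

end

theory Submission
  imports Defs
begin

text \<open>
  All weights are tripled. A phase has thresholds \<open>a\<^sub>i\<close> and capacities \<open>c\<^sub>i \<ge> 3 a\<^sub>i\<close>. It keeps
  disjoint connected parts \<open>T\<^sub>i\<close> of weight at most \<open>c\<^sub>i\<close> and a set \<open>D\<close> of finished indices, whose
  parts reach their thresholds and whose thresholds are the largest. Let \<open>p \<notin> D\<close> have the largest
  threshold. In a spanning tree of a finished part, a lowest vertex whose subtree has weight at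
  least \<open>a\<^sub>i\<close> either splits the part into two sets of weight at least \<open>a\<^sub>i\<close>, one of which (trimmed)
  becomes \<open>T\<^sub>p\<close>, or it is a centre: its removal leaves pieces of weight less than \<open>a\<^sub>i\<close>. In the
  latter case for all \<open>i \<in> D\<close>, there are fewer than \<open>k\<close> centres, so by \<open>k\<close>-connectedness a set \<open>U\<close>
  that starts with an uncovered vertex can be extended by vertices and pieces until it
  reaches a part with spare capacity, which absorbs it, or its weight reaches \<open>a\<^sub>p\<close> and it becomes
  \<open>T\<^sub>p\<close>. While \<open>U\<close> is lighter than \<open>a\<^sub>p\<close>, a finished part \<open>T\<^sub>i\<close> is entered only if the weights of
  \<open>U\<close> and the rest of \<open>T\<^sub>i\<close> exceed \<open>3 a\<^sub>i\<close>, so that part keeps weight at least \<open>a\<^sub>i\<close>. Each round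
  enlarges \<open>D\<close> or the covered set, so there are \<open>O(k n)\<close> rounds, each of \<open>n\<close> scans of the edge list.
\<close>

section \<open>Programs with counting loops\<close>

text \<open>The inequality \<open>cap \<ge> 3 a\<close> is the source of both constants 3: in the
  first phase the capacity is the target and the threshold a third of it, in the second the
  threshold is the target and the capacity at least three times it. Each phase ends by counting
  weight. In the first, unfinished parts are empty, so covering all vertices before every index is
  finished would leave the covered weight below the total. In the second, once all indices are
  finished, the parts alone weigh the total, so nothing is uncovered. The obstacle of the second
  phase is that unfinished parts must keep the third they have. When the growing set overflows such
  a part \<open>q\<close>, the new part \<open>p\<close> is cut from their union, and (if
  \<open>q\<close> is not \<open>p\<close>) the old part \<open>p\<close>, still too light, takes
  over the index \<open>q\<close>. This needs capacities that are at least every threshold, which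
  brings the ratio \<open>r\<close> into the upper bound; it respects the lower bounds because they
  grow with the thresholds. The program is a fixed nest of counting loops, so its time bound is a
  static polynomial and correctness is purely a matter of loop invariants.\<close>

datatype prog =
    Nop
  | Set nat aexp aexp
  | Then prog prog
  | If bexp prog prog
  | For nat nat prog  \<comment> \<open>counter, cell holding the number of rounds, body\<close>

primrec compile :: "prog \<Rightarrow> com" where
  "compile Nop = Skip"
| "compile (Set a i e) = Assign a i e"
| "compile (Then p q) = Seq (compile p) (compile q)"
| "compile (If b p q) = Cond b (compile p) (compile q)"
| "compile (For x a p) =
     Seq (Assign x (Const 0) (Const 0))
       (While (Less (Cell x (Const 0)) (Cell a (Const 0)))
         (Seq (compile p) (Assign x (Const 0) (Plus (Cell x (Const 0)) (Const 1)))))"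

text \<open>Kept as a constant with two rewrite rules of its own, so that a read from another array
  is resolved by the array name alone.\<close>

definition upd :: "state \<Rightarrow> nat \<Rightarrow> nat \<Rightarrow> nat \<Rightarrow> state" where
  "upd s a i v = s(a := (s a)(i := v))"

lemma upd_other [simp]: "b \<noteq> a \<Longrightarrow> upd s a i v b = s b"
  by (simp add: upd_def)

lemma upd_same [simp]: "upd s a i v a = (s a)(i := v)"
  by (simp add: upd_def)

primrec run :: "prog \<Rightarrow> state \<Rightarrow> state" where
  "run Nop s = s"
| "run (Set a i e) s = upd s a (aval i s) (aval e s)"
| "run (Then p q) s = run q (run p s)"
| "run (If b p q) s = (if bval b s then run p s else run q s)"
| "run (For x a p) s =
     ((\<lambda>s. upd (run p s) x 0 (Suc (run p s x 0))) ^^ s a 0) (upd s x 0 0)"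

primrec mods :: "prog \<Rightarrow> nat set" where
  "mods Nop = {}"
| "mods (Set a i e) = {a}"
| "mods (Then p q) = mods p \<union> mods q"
| "mods (If b p q) = mods p \<union> mods q"
| "mods (For x a p) = insert x (mods p)"

primrec bounds :: "prog \<Rightarrow> nat set" where
  "bounds Nop = {}"
| "bounds (Set a i e) = {}"
| "bounds (Then p q) = bounds p \<union> bounds q"
| "bounds (If b p q) = bounds p \<union> bounds q"
| "bounds (For x a p) = insert a (bounds p)"

primrec counters_ok :: "prog \<Rightarrow> bool" where
  "counters_ok Nop = True"
| "counters_ok (Set a i e) = True"
| "counters_ok (Then p q) = (counters_ok p \<and> counters_ok q)"
| "counters_ok (If b p q) = (counters_ok p \<and> counters_ok q)"
| "counters_ok (For x a p) = (x \<notin> mods p \<and> counters_ok p)"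

text \<open>\<open>N\<close> gives the values of the loop bounds. A conditional pays for both
  branches, which keeps the bound a polynomial without maxima. In a loop, 3 pays for clearing the
  counter and 6 for the failing test; the 12 of a round are 6 for the test and 6 for the
  increment.\<close>

primrec cost :: "(nat \<Rightarrow> nat) \<Rightarrow> prog \<Rightarrow> nat" where
  "cost N Nop = 1"
| "cost N (Set a i e) = 1 + acost i + acost e"
| "cost N (Then p q) = cost N p + cost N q"
| "cost N (If b p q) = 1 + bcost b + (cost N p + cost N q)"
| "cost N (For x a p) = 9 + N a * (12 + cost N p)"

lemma run_frame: "a \<notin> mods p \<Longrightarrow> run p s a = s a"
proof (induction p arbitrary: s)
  case (For x b p)
  have "((\<lambda>s. upd (run p s) x 0 (Suc (run p s x 0))) ^^ m) s' a = s' a" for m s'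
    by (induction m) (use For in auto)
  then show ?case using For by simp
qed auto

text \<open>The step case also receives the value of the counter and the agreement with the initial
  state outside \<open>mods\<close>, so an invariant need only speak of arrays that the body
  writes.\<close>

lemma run_For:
  assumes x: "x \<notin> mods p"
    and init: "I 0 (upd s x 0 0)"
    and step: "\<And>j s'. \<lbrakk>j < s a 0; I j s'; s' x 0 = j;
        \<And>b. b \<notin> insert x (mods p) \<Longrightarrow> s' b = s b\<rbrakk> \<Longrightarrow> I (Suc j) (upd (run p s') x 0 (Suc j))"
  shows "I (s a 0) (run (For x a p) s)"
proof -
  define f where "f = (\<lambda>s. upd (run p s) x 0 (Suc (run p s x 0)))"
  have "m \<le> s a 0 \<Longrightarrow> I m ((f ^^ m) (upd s x 0 0)) \<and> (f ^^ m) (upd s x 0 0) x 0 = m \<and>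
      (\<forall>b. b \<notin> insert x (mods p) \<longrightarrow> (f ^^ m) (upd s x 0 0) b = s b)" for m
  proof (induction m)
    case 0
    then show ?case using init by simp
  next
    case (Suc m)
    let ?s = "(f ^^ m) (upd s x 0 0)"
    have IH: "I m ?s" "?s x 0 = m" "\<And>b. b \<notin> insert x (mods p) \<Longrightarrow> ?s b = s b"
      using Suc by auto
    have "run p ?s x = ?s x"
      using x by (rule run_frame)
    then have f: "f ?s = upd (run p ?s) x 0 (Suc m)"
      using IH(2) by (simp add: f_def)
    have "I (Suc m) (f ?s)"
      unfolding f by (rule step) (use IH Suc in auto)
    then show ?case
      using IH(3) by (simp add: f run_frame)
  qed
  from this[of "s a 0"] show ?thesis by (simp add: f_def)
qed

text \<open>The set \<open>M\<close> stays fixed in the induction while the subprograms shrink: no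
  loop bound is ever written, so every subprogram still sees the values \<open>N\<close> and its
  static cost applies.\<close>

lemma exec_compile:
  assumes "counters_ok p" "mods p \<subseteq> M" "bounds p \<inter> M = {}" "\<And>a. a \<in> bounds p \<Longrightarrow> s a 0 = N a"
  shows "\<exists>t. exec (compile p) s t (run p s) \<and> t \<le> cost N p"
  using assms
proof (induction p arbitrary: s)
  case Nop
  then show ?case using exec.Skip by auto
next
  case (Set a i e)
  have "exec (compile (Set a i e)) s (1 + acost i + acost e) (run (Set a i e) s)"
    using exec.Assign[of a i e s] by (simp only: compile.simps run.simps upd_def)
  then show ?case by auto
next
  case (Then p q)
  have "run p s a = s a" if "a \<in> bounds q" for a
    using that Then.prems by (intro run_frame) auto
  then have "\<exists>t. exec (compile q) (run p s) t (run q (run p s)) \<and> t \<le> cost N q"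
    using Then.prems by (intro Then.IH) auto
  moreover have "\<exists>t. exec (compile p) s t (run p s) \<and> t \<le> cost N p"
    using Then.prems by (intro Then.IH) auto
  ultimately show ?case
    by (fastforce intro: exec.Seq)
next
  case (If b p q)
  have "\<exists>t. exec (compile p) s t (run p s) \<and> t \<le> cost N p"
    "\<exists>t. exec (compile q) s t (run q s) \<and> t \<le> cost N q"
    using If.prems by (intro If.IH; auto)+
  then show ?case
    by (cases "bval b s") (fastforce intro: exec.CondTrue exec.CondFalse)+
next
  case (For x a p)
  define f where "f = (\<lambda>s. upd (run p s) x 0 (Suc (run p s x 0)))"
  define W where "W = While (Less (Cell x (Const 0)) (Cell a (Const 0)))
         (Seq (compile p) (Assign x (Const 0) (Plus (Cell x (Const 0)) (Const 1))))"
  have loop: "\<exists>t. exec W s t ((f ^^ m) s) \<and> t \<le> 6 + m * (12 + cost N p)"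
    if "s x 0 + m = N a" "\<And>b. b \<in> bounds (For x a p) \<Longrightarrow> s b 0 = N b" for s m
    using that
  proof (induction m arbitrary: s)
    case 0
    have "\<not> bval (Less (Cell x (Const 0)) (Cell a (Const 0))) s"
      using 0 by simp
    from exec.WhileFalse[OF this] have "exec W s 6 s" unfolding W_def by (simp add: numeral_eq_Suc)
    then show ?case by auto
  next
    case (Suc m)
    obtain t1 where t1: "exec (compile p) s t1 (run p s)" "t1 \<le> cost N p"
      using For.IH[of s] For.prems Suc.prems(2) by auto
    have asg: "exec (Assign x (Const 0) (Plus (Cell x (Const 0)) (Const 1))) (run p s) 6 (f s)"
      using exec.Assign[of x "Const 0" "Plus (Cell x (Const 0)) (Const 1)" "run p s"]
      by (simp add: f_def upd_def numeral_eq_Suc)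
    have fs: "f s b 0 = N b" if "b \<in> bounds (For x a p)" for b
    proof -
      have "b \<noteq> x" "b \<notin> mods p" using that For.prems by auto
      then show ?thesis using that Suc.prems by (simp add: f_def run_frame)
    qed
    have fx: "f s x 0 = Suc (s x 0)"
      using For.prems by (simp add: f_def run_frame)
    obtain t2 where t2: "exec W (f s) t2 ((f ^^ m) (f s))" "t2 \<le> 6 + m * (12 + cost N p)"
      using Suc.IH[of "f s"] fs fx Suc.prems by auto
    have b: "bval (Less (Cell x (Const 0)) (Cell a (Const 0))) s"
      using Suc.prems(1) Suc.prems(2)[of a] by simp
    have "exec W s (1 + bcost (Less (Cell x (Const 0)) (Cell a (Const 0))) + (t1 + 6) + t2)
        ((f ^^ m) (f s))"
      unfolding W_def by (rule exec.WhileTrue[OF b exec.Seq[OF t1(1) asg] t2(1)[unfolded W_def]])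
    then show ?case
      using t1 t2 by (intro exI conjI) (assumption | simp add: funpow_swap1 numeral_eq_Suc)+
  qed
  have "upd s x 0 0 b 0 = N b" if "b \<in> bounds (For x a p)" for b
  proof -
    have "b \<noteq> x" using that For.prems by auto
    then show ?thesis using that For.prems by simp
  qed
  then obtain t where t: "exec W (upd s x 0 0) t ((f ^^ N a) (upd s x 0 0))" "t \<le> 6 + N a * (12 + cost N p)"
    using loop[of "upd s x 0 0" "N a"] by auto
  have "exec (Assign x (Const 0) (Const 0)) s 3 (upd s x 0 0)"
    using exec.Assign[of x "Const 0" "Const 0" s] by (simp add: upd_def numeral_eq_Suc)
  from exec.Seq[OF this t(1)] have "exec (compile (For x a p)) s (3 + t) ((f ^^ N a) (upd s x 0 0))"
    by (simp add: W_def)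
  moreover have "(f ^^ N a) (upd s x 0 0) = run (For x a p) s"
    using For.prems by (simp add: f_def)
  ultimately show ?case using t by (intro exI[of _ "3 + t"]) auto
qed

definition Eq :: "aexp \<Rightarrow> aexp \<Rightarrow> bexp" where
  "Eq e1 e2 = Conj (Neg (Less e1 e2)) (Neg (Less e2 e1))"

lemma bval_Eq [simp]: "bval (Eq e1 e2) s \<longleftrightarrow> aval e1 s = aval e2 s"
  by (auto simp: Eq_def)

primrec block :: "prog list \<Rightarrow> prog" where
  "block [] = Nop"
| "block (p # ps) = Then p (block ps)"

abbreviation Var :: "nat \<Rightarrow> aexp" where "Var a \<equiv> Cell a (Const 0)"
abbreviation Let :: "nat \<Rightarrow> aexp \<Rightarrow> prog" where "Let a e \<equiv> Set a (Const 0) e"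
abbreviation When :: "bexp \<Rightarrow> prog \<Rightarrow> prog" where "When b p \<equiv> If b p Nop"

section \<open>Connectedness by cuts\<close>

text \<open>Cuts are preferred to paths because the algorithm only ever asks for an edge that leaves
  a given set: in the search, in the growth and in the trimming.\<close>

definition conn :: "('a \<Rightarrow> 'a \<Rightarrow> bool) \<Rightarrow> 'a set \<Rightarrow> bool" where
  "conn R S \<longleftrightarrow> S \<noteq> {} \<and> (\<forall>U. U \<subseteq> S \<and> U \<noteq> {} \<and> U \<noteq> S \<longrightarrow> (\<exists>x\<in>U. \<exists>y\<in>S - U. R x y))"

lemma conn_cut:
  "\<lbrakk>conn R S; U \<inter> S \<noteq> {}; \<not> S \<subseteq> U\<rbrakk> \<Longrightarrow> \<exists>x\<in>S \<inter> U. \<exists>y\<in>S - U. R x y"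
  unfolding conn_def by (elim conjE allE[of _ "S \<inter> U"]) blast

lemma connI:
  assumes "S \<noteq> {}" "\<And>U. \<lbrakk>U \<subseteq> S; U \<noteq> {}; U \<noteq> S\<rbrakk> \<Longrightarrow> \<exists>x\<in>U. \<exists>y\<in>S - U. R x y"
  shows "conn R S"
  using assms unfolding conn_def by blast

lemma conn_singleton: "conn R {x}"
  unfolding conn_def by blast

lemma conn_nonempty: "conn R S \<Longrightarrow> S \<noteq> {}"
  unfolding conn_def by blast

text \<open>A cut either separates one of the two sets, or it has one of them on each side and the
  joining edge crosses it; its direction is unknown, hence the symmetry.\<close>

lemma conn_Un:
  assumes R: "symp R" and AB: "conn R A" "conn R B" and "x \<in> A" "y \<in> B" "R x y"
  shows "conn R (A \<union> B)"
proof (rule connI)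
  fix U assume U: "U \<subseteq> A \<union> B" "U \<noteq> {}" "U \<noteq> A \<union> B"
  have yx: "R y x" using R \<open>R x y\<close> by (rule sympD)
  consider "U \<inter> A \<noteq> {}" "\<not> A \<subseteq> U" | "U \<inter> B \<noteq> {}" "\<not> B \<subseteq> U"
    | "A \<subseteq> U" "U \<inter> B = {}" | "B \<subseteq> U" "U \<inter> A = {}"
    using U by blast
  then show "\<exists>x\<in>U. \<exists>y\<in>A \<union> B - U. R x y"
  proof cases
    case 1 then show ?thesis using conn_cut[OF AB(1)] by blast
  next
    case 2 then show ?thesis using conn_cut[OF AB(2)] by blast
  next
    case 3 then show ?thesis using assms by blast
  next
    case 4 then show ?thesis using assms yx by blast
  qed
qed (use AB conn_nonempty in blast)

text \<open>A cut separates \<open>c\<close> from some \<open>v\<close>. Either it splits the group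
  of \<open>v\<close>, or that group and \<open>c\<close> lie on different sides and the edge to
  \<open>c\<close> crosses. Used with a centre for \<open>c\<close> and pieces as groups.\<close>

lemma conn_star:
  assumes R: "symp R" and c: "c \<in> S"
    and g: "\<And>v. \<lbrakk>v \<in> S; v \<noteq> c\<rbrakk> \<Longrightarrow> \<exists>g\<subseteq>S. v \<in> g \<and> conn R g \<and> (\<exists>x\<in>g. R x c)"
  shows "conn R S"
proof (rule connI)
  fix U assume U: "U \<subseteq> S" "U \<noteq> {}" "U \<noteq> S"
  obtain v where v: "v \<in> S" "v \<noteq> c" "v \<in> U \<longleftrightarrow> c \<notin> U"
    using U c by blast
  then obtain h x where h: "h \<subseteq> S" "v \<in> h" "conn R h" "x \<in> h" "R x c"
    using g by blast
  show "\<exists>x\<in>U. \<exists>y\<in>S - U. R x y"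
  proof (cases "U \<inter> h = {} \<or> h \<subseteq> U")
    case True
    then show ?thesis using h v c sympD[OF R \<open>R x c\<close>] by blast
  next
    case False
    then show ?thesis using conn_cut[of R h U] h by blast
  qed
qed (use c in blast)

section \<open>One round of the algorithm\<close>

text \<open>Vertices are \<open>0, \<dots>, n - 1\<close>, the \<open>m\<close> arcs are listed by their ends \<open>F\<close> and \<open>T\<close>
  in both directions. A labelling \<open>L\<close> maps every vertex to its part; label \<open>k\<close> means
  not yet covered. The thresholds are \<open>a\<close>, the capacities \<open>cap\<close>; \<open>lo\<close> is a lower
  bound that was already achieved. The flag \<open>big\<close> tells whether every capacity exceeds every
  threshold; as long as it does not, unfinished parts are empty.\<close>

locale thresholds =
  fixes n k m :: nat and wt F T a cap b lo :: "nat \<Rightarrow> nat" and big :: bool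
  assumes arc_bound: "e < m \<Longrightarrow> F e < n \<and> T e < n"
    and arc_sym: "e < m \<Longrightarrow> \<exists>e'<m. F e' = T e \<and> T e' = F e"
    and kconn: "\<lbrakk>X \<subseteq> {..<n}; card X < k\<rbrakk> \<Longrightarrow>
      conn (\<lambda>x y. \<exists>e<m. F e = x \<and> T e = y) ({..<n} - X)"
    and k_less: "k < n"
    and a_pos: "i < k \<Longrightarrow> 1 \<le> a i"
    and a_k: "a k = 0" and cap_k: "cap k = 0"
    and cap_a: "i < k \<Longrightarrow> 3 * a i \<le> cap i"
    and wt_pos: "v < n \<Longrightarrow> 1 \<le> wt v"
    and wt_b: "\<lbrakk>v < n; i < k\<rbrakk> \<Longrightarrow> wt v \<le> b i"
    and a_b: "i < k \<Longrightarrow> a i \<le> b i"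
    and b_cap: "i < k \<Longrightarrow> b i \<le> cap i"
    and total: "(\<Sum>v<n. wt v) = (\<Sum>i<k. b i)"
    and lo_a: "i < k \<Longrightarrow> lo i \<le> a i"
    and lo_mono: "\<lbrakk>i < k; j < k; a i \<le> a j\<rbrakk> \<Longrightarrow> lo i \<le> lo j"
    and big: "\<lbrakk>big; i < k; j < k\<rbrakk> \<Longrightarrow> a j \<le> cap i"
begin

definition adj :: "nat \<Rightarrow> nat \<Rightarrow> bool" where
  "adj x y \<longleftrightarrow> (\<exists>e<m. F e = x \<and> T e = y)"

definition part :: "(nat \<Rightarrow> nat) \<Rightarrow> nat \<Rightarrow> nat set" where
  "part L i = {v. v < n \<and> L v = i}"

abbreviation weight :: "nat set \<Rightarrow> nat" where
  "weight S \<equiv> sum wt S"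

abbreviation connected :: "nat set \<Rightarrow> bool" where
  "connected \<equiv> conn adj"

lemma symp_adj: "symp adj"
  unfolding symp_def adj_def using arc_sym by metis

lemma adj_bound: "adj x y \<Longrightarrow> x < n \<and> y < n"
  unfolding adj_def using arc_bound by auto

lemma part_bound: "part L i \<subseteq> {..<n}"
  by (auto simp: part_def)

lemma finite_part [simp]: "finite (part L i)"
  by (rule finite_subset[OF part_bound]) simp

lemma weight_mono: "\<lbrakk>A \<subseteq> B; B \<subseteq> {..<n}\<rbrakk> \<Longrightarrow> weight A \<le> weight B"
  by (rule sum_mono2) (auto dest: finite_subset)

lemma weight_pos:
  assumes "A \<subseteq> {..<n}" "A \<noteq> {}"
  shows "1 \<le> weight A"
proof -
  obtain x where "x \<in> A" using assms by blast
  then have "1 \<le> wt x" "wt x \<le> weight A"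
    using assms wt_pos member_le_sum[of x A wt] by (auto intro: finite_subset)
  then show ?thesis by simp
qed

lemma weight_Un_le: "\<lbrakk>A \<subseteq> {..<n}; B \<subseteq> {..<n}\<rbrakk> \<Longrightarrow> weight (A \<union> B) \<le> weight A + weight B"
  by (metis finite_lessThan finite_subset le_add1 sum.union_inter)

text \<open>That finished indices carry the largest thresholds gives \<open>a p \<le> a j\<close>
  for the next index \<open>p\<close> and every finished \<open>j\<close>; this is what compares the
  growing set, lighter than \<open>a p\<close>, with the parts from which it takes vertices.\<close>

definition Inv :: "(nat \<Rightarrow> nat) \<Rightarrow> nat set \<Rightarrow> bool" where
  "Inv L D \<longleftrightarrow> D \<subseteq> {..<k} \<and> (\<forall>v<n. L v \<le> k) \<and>
     (\<forall>i\<in>D. a i \<le> weight (part L i)) \<and>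
     (\<forall>i\<in>D. \<forall>j<k. j \<notin> D \<longrightarrow> a j \<le> a i) \<and>
     (\<forall>i<k. part L i \<noteq> {} \<longrightarrow> connected (part L i)) \<and>
     (\<forall>i<k. lo i \<le> weight (part L i) \<and> weight (part L i) \<le> cap i) \<and>
     (\<forall>i<k. i \<notin> D \<longrightarrow> part L i = {} \<or> big)"

lemma Inv_D:
  assumes Inv: "Inv L D" and j: "j \<in> D"
  shows "j < k" "a j \<le> weight (part L j)" "part L j \<noteq> {}" "connected (part L j)"
proof -
  show "j < k" using Inv j by (auto simp: Inv_def)
  show w: "a j \<le> weight (part L j)" using Inv j by (auto simp: Inv_def)
  then show "part L j \<noteq> {}" using a_pos[OF \<open>j < k\<close>] by fastforce
  then show "connected (part L j)" using Inv \<open>j < k\<close> by (auto simp: Inv_def)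
qed

text \<open>The condition under which \<open>X\<close> may be taken out of all finished parts at
  once; the first conjuncts record that \<open>p\<close> is the next index to be served.\<close>

definition rest_of :: "(nat \<Rightarrow> nat) \<Rightarrow> nat set \<Rightarrow> nat \<Rightarrow> nat set \<Rightarrow> bool" where
  "rest_of L D p X \<longleftrightarrow> p < k \<and> p \<notin> D \<and> (\<forall>j<k. j \<notin> D \<longrightarrow> a j \<le> a p) \<and> X \<subseteq> {..<n} \<and> connected X \<and>
     (\<forall>j\<in>D. connected (part L j - X) \<and> a j \<le> weight (part L j - X))"

text \<open>\<open>q\<close> is the label that the old part of \<open>p\<close> receives. For
  \<open>q = k\<close> that part is given up and its vertices become uncovered; for
  \<open>q < k\<close> the set \<open>X\<close> has swallowed part \<open>q\<close>, so the index is
  free.\<close>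

definition event :: "(nat \<Rightarrow> nat) \<Rightarrow> nat set \<Rightarrow> nat \<Rightarrow> nat set \<Rightarrow> nat \<Rightarrow> bool" where
  "event L D p X q \<longleftrightarrow> rest_of L D p X \<and> a p \<le> weight X \<and> q \<notin> D \<and> weight (part L p) < a p \<and>
     (\<forall>j<k. j \<notin> D \<longrightarrow> j \<noteq> q \<longrightarrow> part L j \<inter> X = {}) \<and>
     (q = k \<or> q < k \<and> part L q \<subseteq> X \<and> big)"

text \<open>The critical index is \<open>q\<close> when it inherits the old part of
  \<open>p\<close>. That part fits because it is lighter than \<open>a p\<close>, and
  \<open>big\<close> puts every capacity at or above \<open>a p\<close>; it reaches
  \<open>lo q\<close> because \<open>a q \<le> a p\<close> and \<open>lo\<close> is monotone in the
  thresholds.\<close>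

lemma event_step:
  assumes Inv: "Inv L D" and ev: "event L D p X q"
    and Y: "Y \<subseteq> X" "connected Y" "a p \<le> weight Y" "weight Y \<le> cap p"
  defines "L' \<equiv> \<lambda>v. if v \<in> Y then p else if v \<in> X then k else if L v = p then q else L v"
  shows "Inv L' (insert p D)"
proof -
  have p: "p < k" "p \<notin> D" and amax: "\<And>j. \<lbrakk>j < k; j \<notin> D\<rbrakk> \<Longrightarrow> a j \<le> a p" and Xn: "X \<subseteq> {..<n}"
    and inD: "\<And>j. j \<in> D \<Longrightarrow> connected (part L j - X) \<and> a j \<le> weight (part L j - X)"
    and qD: "q \<notin> D" and nd: "\<And>j. \<lbrakk>j < k; j \<notin> D; j \<noteq> q\<rbrakk> \<Longrightarrow> part L j \<inter> X = {}"
    and q: "q = k \<or> q < k \<and> part L q \<subseteq> X \<and> big" and wp: "weight (part L p) < a p"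
    using ev by (auto simp: event_def rest_of_def)
  have DI: "D \<subseteq> {..<k}" "\<And>v. v < n \<Longrightarrow> L v \<le> k" "\<And>i j. \<lbrakk>i \<in> D; j < k; j \<notin> D\<rbrakk> \<Longrightarrow> a j \<le> a i"
    "\<And>i. \<lbrakk>i < k; part L i \<noteq> {}\<rbrakk> \<Longrightarrow> connected (part L i)"
    "\<And>i. i < k \<Longrightarrow> lo i \<le> weight (part L i) \<and> weight (part L i) \<le> cap i"
    "\<And>i. \<lbrakk>i < k; i \<notin> D\<rbrakk> \<Longrightarrow> part L i = {} \<or> big"
    using Inv unfolding Inv_def by auto
  have pp: "part L' p = Y"
    using Y Xn q p by (auto simp: L'_def part_def split: if_splits)
  have pD: "part L' j = part L j - X" if "j \<in> D" for j
    using that p DI(1) qD Y by (auto simp: L'_def part_def)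
  have pq: "part L' q = part L p" if "q < k" "q \<noteq> p"
    using that nd[OF p] p q Y by (auto simp: L'_def part_def split: if_splits)
  have po: "part L' j = part L j" if "j < k" "j \<notin> D" "j \<noteq> p" "j \<noteq> q" for j
    using that nd[OF that(1,2,4)] Y by (auto simp: L'_def part_def split: if_splits)
  \<comment> \<open>The four fates of an index: finished ones lose \<open>X\<close>,
    \<open>p\<close> gets \<open>Y\<close>, \<open>q\<close> inherits the old part of
    \<open>p\<close>, all others are untouched.\<close>
  have cases: "part L' j = part L j - X \<and> j \<in> D \<or> j = p \<or>
      part L' j = part L p \<and> j = q \<and> q < k \<and> big \<and> j \<noteq> p \<or> part L' j = part L j \<and> j \<notin> D" if "j < k" for j
    using pD[of j] pq po[of j] q that by (cases "j \<in> D"; cases "j = p"; cases "j = q") auto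
  have wD: "weight (part L j - X) \<le> cap j" if "j < k" for j
    using weight_mono[OF _ part_bound, of "part L j - X" L j] DI(5)[OF that] by auto
  show ?thesis
    unfolding Inv_def
  proof (intro conjI ballI allI impI)
    show "insert p D \<subseteq> {..<k}" using DI p by auto
    show "L' v \<le> k" if "v < n" for v using that DI(2) p q by (auto simp: L'_def)
    show "a j \<le> weight (part L' j)" if "j \<in> insert p D" for j
      using inD pD pp that Y by auto
    show "a j \<le> a i" if "i \<in> insert p D" "j < k" "j \<notin> insert p D" for i j
      using that DI(3) amax by auto
    show "connected (part L' j)" if "j < k" "part L' j \<noteq> {}" for j
      using cases[OF that(1)] that DI(4) inD pp Y(2) p by metis
    show "lo j \<le> weight (part L' j)" if "j < k" for j
    proof -
      have "lo p \<le> weight Y" using lo_a[OF p(1)] Y by simp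
      moreover have "lo j \<le> weight (part L j - X)" if "j \<in> D"
        using inD[OF that] lo_a[OF \<open>j < k\<close>] by simp
      moreover have "lo j \<le> weight (part L p)" if "j = q"
        using lo_mono[of j p] amax[of j] DI(5)[OF p(1)] p \<open>j < k\<close> that qD by auto
      ultimately show ?thesis using cases[OF that] DI(5)[OF that] pp by metis
    qed
    show "weight (part L' j) \<le> cap j" if "j < k" for j
    proof -
      have "weight (part L p) \<le> cap j" if big
        using wp big[OF that \<open>j < k\<close> p(1)] by simp
      then show ?thesis using cases[OF that] DI(5)[OF that] pp Y wD[OF that] by metis
    qed
    show "part L' j = {} \<or> big" if "j < k" "j \<notin> insert p D" for j
      using cases[OF that(1)] that DI(6) by auto
  qed
qed

subsection \<open>Pieces and the growth of a transferable set\<close>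

definition piece :: "(nat \<Rightarrow> nat) \<Rightarrow> nat \<Rightarrow> nat set" where
  "piece pc v = {u. u < n \<and> pc u = pc v}"

text \<open>Outside the finished parts every vertex counts as a piece of its own, so that growth
  always adds a whole piece.\<close>

definition pieces :: "(nat \<Rightarrow> nat) \<Rightarrow> nat set \<Rightarrow> (nat \<Rightarrow> nat) \<Rightarrow> (nat \<Rightarrow> nat) \<Rightarrow> bool" where
  "pieces L D cen pc \<longleftrightarrow>
     (\<forall>j\<in>D. cen j \<in> part L j \<and> (\<forall>v\<in>part L j - {cen j}.
        piece pc v \<subseteq> part L j - {cen j} \<and> connected (piece pc v) \<and> weight (piece pc v) < a j \<and>
        (\<exists>x\<in>piece pc v. adj x (cen j)))) \<and>
     (\<forall>v<n. L v \<notin> D \<longrightarrow> piece pc v = {v})"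

text \<open>Closure under pieces keeps the rest of a finished part a star around its centre. The
  uncovered vertex ensures that an absorption enlarges the covered set. The bound
  \<open>2 * a j\<close> is what an overflow above \<open>3 * a j\<close> leaves to the rest when
  \<open>U\<close> is lighter than \<open>a j\<close>.\<close>

definition growing :: "(nat \<Rightarrow> nat) \<Rightarrow> nat set \<Rightarrow> (nat \<Rightarrow> nat) \<Rightarrow> (nat \<Rightarrow> nat) \<Rightarrow> nat \<Rightarrow> nat set \<Rightarrow> bool" where
  "growing L D cen pc p U \<longleftrightarrow> U \<subseteq> {..<n} \<and> connected U \<and> weight U < a p \<and> (\<exists>u\<in>U. L u = k) \<and>
     (\<forall>j\<in>D. cen j \<notin> U \<and> (part L j \<inter> U = {} \<or> 2 * a j < weight (part L j - U))) \<and>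
     (\<forall>v\<in>U. piece pc v \<subseteq> U) \<and> (\<forall>j<k. j \<notin> D \<longrightarrow> part L j \<inter> U = {})"

context
  fixes L D cen pc p
  assumes Inv: "Inv L D" and pcs: "pieces L D cen pc"
    and p: "p < k" "p \<notin> D" "\<And>j. \<lbrakk>j < k; j \<notin> D\<rbrakk> \<Longrightarrow> a j \<le> a p" "weight (part L p) < a p"
begin

text \<open>A piece that meets \<open>U\<close> lies inside \<open>U\<close>, so the remainder
  consists of the centre and whole pieces, each attached to the centre.\<close>

lemma connected_remainder:
  assumes j: "j \<in> D" and U: "cen j \<notin> U" "\<And>v. v \<in> U \<Longrightarrow> piece pc v \<subseteq> U"
  shows "connected (part L j - U)"
proof (rule conn_star[OF symp_adj, of "cen j"])
  show "cen j \<in> part L j - U" using pcs j U by (auto simp: pieces_def)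
  fix v assume v: "v \<in> part L j - U" "v \<noteq> cen j"
  have "piece pc v \<inter> U = {}"
  proof (rule ccontr)
    assume "piece pc v \<inter> U \<noteq> {}"
    then obtain u where "u \<in> U" "u < n" "pc u = pc v" by (auto simp: piece_def)
    then have "v \<in> U" using U(2)[of u] v by (auto simp: piece_def part_def)
    then show False using v by simp
  qed
  moreover have "piece pc v \<subseteq> part L j \<and> connected (piece pc v) \<and> (\<exists>x\<in>piece pc v. adj x (cen j))"
    using pcs j v by (auto simp: pieces_def)
  moreover have "v \<in> piece pc v" using v by (auto simp: piece_def part_def)
  ultimately show "\<exists>g\<subseteq>part L j - U. v \<in> g \<and> connected g \<and> (\<exists>x\<in>g. adj x (cen j))" by blast
qed

lemma growing_rest_of: "growing L D cen pc p U \<Longrightarrow> rest_of L D p U"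
  unfolding rest_of_def
proof (intro conjI ballI)
  assume g: "growing L D cen pc p U"
  show "connected (part L j - U)" if "j \<in> D" for j
    by (rule connected_remainder) (use g that in \<open>auto simp: growing_def\<close>)
  show "a j \<le> weight (part L j - U)" if "j \<in> D" for j
  proof (cases "part L j \<inter> U = {}")
    case True
    then have "part L j - U = part L j" by auto
    then show ?thesis using Inv that by (simp add: Inv_def)
  next
    case False
    then have "2 * a j < weight (part L j - U)" using g that by (auto simp: growing_def)
    then show ?thesis by simp
  qed
qed (use p in \<open>auto simp: growing_def\<close>)

text \<open>Since \<open>p\<close> is unfinished there are fewer than \<open>k\<close> centres, so
  the graph without them is connected. It is not exhausted by \<open>U\<close>: with the targets
  \<open>b\<close>, the set \<open>U\<close> weighs less than \<open>b p\<close> and each centre at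
  most \<open>b j\<close>, together less than the total. This is where the hypothesis that no vertex
  outweighs a target enters.\<close>

lemma growing_extends:
  assumes g: "growing L D cen pc p U"
  shows "\<exists>x\<in>U. \<exists>y. y < n \<and> y \<notin> U \<and> y \<notin> cen ` D \<and> adj x y"
proof -
  have Dk: "D \<subseteq> {..<k}" using Inv by (simp add: Inv_def)
  then have fin: "finite D" by (rule finite_subset) simp
  have U: "U \<subseteq> {..<n}" "connected U" "weight U < a p" "\<And>j. j \<in> D \<Longrightarrow> cen j \<notin> U"
    using g by (auto simp: growing_def)
  have cen: "cen ` D \<subseteq> {..<n}" using pcs by (auto simp: pieces_def part_def)
  have "card (cen ` D) \<le> card D" by (rule card_image_le[OF fin])
  also have "\<dots> < k"
    using psubset_card_mono[of "{..<k}" D] Dk p by auto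
  finally have "connected ({..<n} - cen ` D)"
    using kconn[OF cen] unfolding adj_def by simp
  moreover have "U \<inter> ({..<n} - cen ` D) \<noteq> {}"
    using conn_nonempty[OF U(2)] U by blast
  moreover have "\<not> {..<n} - cen ` D \<subseteq> U"
  proof
    assume "{..<n} - cen ` D \<subseteq> U"
    then have "{..<n} \<subseteq> U \<union> cen ` D" by auto
    then have "weight {..<n} \<le> weight (U \<union> cen ` D)"
      by (rule weight_mono) (use U cen in auto)
    also have "\<dots> \<le> weight U + weight (cen ` D)" by (rule weight_Un_le) (use U cen in auto)
    also have "weight (cen ` D) \<le> (\<Sum>j\<in>D. wt (cen j))" using sum_image_le[OF fin, of wt cen] by (simp add: o_def)
    also have "\<dots> \<le> (\<Sum>j\<in>D. b j)" by (rule sum_mono) (use wt_b cen Dk in auto)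
    finally have "weight {..<n} < b p + (\<Sum>j\<in>D. b j)" using U(3) a_b[OF p(1)] by linarith
    also have "\<dots> = (\<Sum>j\<in>insert p D. b j)" using p fin by simp
    also have "\<dots> \<le> (\<Sum>j<k. b j)" by (rule sum_mono2) (use Dk p in auto)
    finally show False using total by simp
  qed
  ultimately have "\<exists>x\<in>({..<n} - cen ` D) \<inter> U. \<exists>y\<in>{..<n} - cen ` D - U. adj x y"
    by (rule conn_cut)
  then show ?thesis by blast
qed

text \<open>If \<open>y\<close> lies in a finished part \<open>j\<close>, that part overflows with
  \<open>U\<close>, so its rest weighs more than \<open>3 * a j - weight U\<close>, hence more than
  \<open>2 * a j\<close>. A piece takes less than \<open>a j\<close>, so the part stays above its
  threshold even when the enlarged set reaches \<open>a p\<close>.\<close>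

lemma growing_piece:
  assumes g: "growing L D cen pc p U" and xy: "x \<in> U" "y < n" "y \<notin> U" "y \<notin> cen ` D" "adj x y"
    and y: "L y = k \<or> L y \<in> D \<and> cap (L y) < weight (part L (L y) - U) + weight U"
  shows "weight (U \<union> piece pc y) < a p \<Longrightarrow> growing L D cen pc p (U \<union> piece pc y)"
    and "a p \<le> weight (U \<union> piece pc y) \<Longrightarrow> event L D p (U \<union> piece pc y) k"
    and "piece pc y \<inter> U = {}"
proof -
  let ?U = "U \<union> piece pc y"
  have Dk: "D \<subseteq> {..<k}" using Inv by (simp add: Inv_def)
  have U: "U \<subseteq> {..<n}" "connected U" "weight U < a p" "\<And>j. j \<in> D \<Longrightarrow> cen j \<notin> U"
    "\<And>v. v \<in> U \<Longrightarrow> piece pc v \<subseteq> U" "\<exists>u\<in>U. L u = k"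
    "\<And>j. \<lbrakk>j < k; j \<notin> D\<rbrakk> \<Longrightarrow> part L j \<inter> U = {}"
    "\<And>j. j \<in> D \<Longrightarrow> part L j \<inter> U = {} \<or> 2 * a j < weight (part L j - U)"
    using g by (auto simp: growing_def)
  have yp: "y \<in> piece pc y" using xy by (simp add: piece_def)
  show disj: "piece pc y \<inter> U = {}"
  proof (rule ccontr)
    assume "piece pc y \<inter> U \<noteq> {}"
    then obtain u where "u \<in> U" "pc u = pc y" by (auto simp: piece_def)
    then show False using U(5)[of u] xy by (auto simp: piece_def)
  qed
  have pn: "piece pc y \<subseteq> {..<n}" by (auto simp: piece_def)
  have pD: "piece pc y \<subseteq> part L (L y) - {cen (L y)}" "connected (piece pc y)"
    "weight (piece pc y) < a (L y)" if "L y \<in> D"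
    using pcs that xy unfolding pieces_def part_def by blast+
  have pk: "piece pc y = {y}" if "L y = k"
    using pcs that xy Dk unfolding pieces_def by blast
  have sub: "piece pc y \<subseteq> part L (L y)" using pk pD y xy by (auto simp: part_def)
  have conn: "connected ?U"
    using conn_Un[OF symp_adj U(2) _ xy(1) yp xy(5)] pD pk y conn_singleton by metis
  have cen: "cen j \<notin> ?U" if "j \<in> D" for j
  proof
    assume "cen j \<in> ?U"
    then have *: "cen j \<in> piece pc y" using U(4)[OF that] by simp
    moreover have "L (cen j) = j" using pcs that by (auto simp: pieces_def part_def)
    ultimately have "L y = j" using sub by (auto simp: part_def)
    then show False using pD * that by auto
  qed
  have closed: "piece pc v \<subseteq> ?U" if "v \<in> ?U" for v
    using that U(5) by (auto simp: piece_def)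
  have nd: "part L j \<inter> ?U = {}" if "j < k" "j \<notin> D" for j
    using U(7)[OF that] y sub that by (auto simp: part_def)
  have wU: "weight ?U = weight U + weight (piece pc y)"
    by (rule sum.union_disjoint) (use U pn disj in \<open>auto intro: finite_subset\<close>)
  have same: "part L j - ?U = part L j - U" "part L j \<inter> ?U = part L j \<inter> U" if "j \<noteq> L y" for j
    using that sub by (auto simp: part_def)
  have rem: "weight (part L (L y) - U) = weight (part L (L y) - ?U) + weight (piece pc y)" if "L y \<in> D"
  proof -
    have "part L (L y) - U = (part L (L y) - ?U) \<union> piece pc y" using sub disj by auto
    then show ?thesis
      by (simp only:) (rule sum.union_disjoint, use pn in \<open>auto intro: finite_subset\<close>)
  qed
  \<comment> \<open>The piece moves from the rest of the part to the set, which leaves the sum of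
    both weights unchanged.\<close>
  have capy: "3 * a (L y) < weight (part L (L y) - ?U) + weight ?U" if "L y \<in> D"
  proof -
    have "L y < k" "L y \<noteq> k" using that Dk by auto
    then show ?thesis using y cap_a[of "L y"] rem[OF that] wU by linarith
  qed
  have ap: "a p \<le> a (L y)" if "L y \<in> D"
    using Inv that p by (auto simp: Inv_def)
  show "growing L D cen pc p ?U" if w: "weight ?U < a p"
    unfolding growing_def
  proof (intro conjI ballI allI impI)
    show "part L j \<inter> ?U = {} \<or> 2 * a j < weight (part L j - ?U)" if "j \<in> D" for j
    proof (cases "j = L y")
      case True
      then show ?thesis using capy ap w that by auto
    next
      case False
      then show ?thesis using U(8)[OF that] same by simp
    qed
  qed (use w U pn conn cen closed nd in auto)
  show "event L D p ?U k" if w: "a p \<le> weight ?U"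
    unfolding event_def rest_of_def
  proof (intro conjI ballI allI impI)
    show "connected (part L j - ?U)" if "j \<in> D" for j
      by (rule connected_remainder) (use that cen closed in blast)+
    show "a j \<le> weight (part L j - ?U)" if "j \<in> D" for j
    proof (cases "j = L y")
      case True
      \<comment> \<open>Only the old \<open>U\<close> is known to be light here, so the bound is
        taken before the piece is removed.\<close>
      have "2 * a j < weight (part L j - U)"
        using capy rem wU U(3) ap that True by auto
      then show ?thesis using rem pD(3) that True by auto
    next
      case False
      then show ?thesis
        using growing_rest_of[OF g] same that by (auto simp: rest_of_def)
    qed
    show "k \<notin> D" using Dk by auto
  qed (use w U pn conn nd p in auto)
qed

text \<open>An unfinished part without room is taken as a whole. The union outweighs the capacity of
  \<open>L y\<close>, and this capacity is at least \<open>a p\<close>, because a nonempty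
  unfinished part exists only under \<open>big\<close>.\<close>

lemma growing_swap:
  assumes g: "growing L D cen pc p U" and xy: "x \<in> U" "y < n" "adj x y"
    and y: "L y < k" "L y \<notin> D" "cap (L y) < weight (part L (L y) - U) + weight U"
  shows "event L D p (U \<union> part L (L y)) (L y)"
proof -
  let ?i = "L y"
  have rU: "rest_of L D p U" by (rule growing_rest_of[OF g])
  have yi: "y \<in> part L ?i" using xy by (simp add: part_def)
  have ndU: "\<And>j. \<lbrakk>j < k; j \<notin> D\<rbrakk> \<Longrightarrow> part L j \<inter> U = {}" using g by (auto simp: growing_def)
  have Un: "U \<subseteq> {..<n}" using g by (simp add: growing_def)
  have b: big using Inv y yi by (auto simp: Inv_def)
  have "connected (part L ?i)" using Inv y yi by (auto simp: Inv_def)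
  then have c: "connected (U \<union> part L ?i)"
    using conn_Un[OF symp_adj _ _ xy(1) yi xy(3)] rU by (simp add: rest_of_def)
  have w: "weight (U \<union> part L ?i) = weight (part L ?i - U) + weight U"
    using sum.union_disjoint[of U "part L ?i - U" wt] Un by (simp add: finite_subset)
  have diff: "part L j - (U \<union> part L ?i) = part L j - U" if "j \<in> D" for j
    using that y by (auto simp: part_def)
  show ?thesis
    unfolding event_def rest_of_def
  proof (intro conjI ballI allI impI)
    show "a p \<le> weight (U \<union> part L ?i)" using w y(3) big[OF b y(1) p(1)] by simp
    show "U \<union> part L ?i \<subseteq> {..<n}" using Un part_bound by auto
    show "part L j \<inter> (U \<union> part L (L y)) = {}" if "j < k" "j \<notin> D" "j \<noteq> L y" for j
      using ndU[OF that(1,2)] that by (auto simp: part_def)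
    show "?i = k \<or> ?i < k \<and> part L ?i \<subseteq> U \<union> part L ?i \<and> big" using y b by auto
  qed (use p y c diff rU in \<open>auto simp: rest_of_def\<close>)
qed

text \<open>Covers finished and unfinished \<open>i\<close> alike. \<open>U\<close> may already
  contain vertices of part \<open>i\<close>, hence the weight is counted over the rest of the part.
  Other finished parts lose vertices but keep their thresholds by \<open>rest_of\<close>, and the
  uncovered vertex of \<open>U\<close> gives the strict progress.\<close>

lemma growing_absorb:
  assumes g: "growing L D cen pc p U" and xy: "x \<in> U" "y < n" "adj x y"
    and y: "L y < k" "weight (part L (L y) - U) + weight U \<le> cap (L y)"
  defines "i \<equiv> L y"
  defines "L' \<equiv> \<lambda>v. if v \<in> U then i else L v"
  shows "Inv L' D" "card (part L' k) < card (part L k)"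
proof -
  note U = growing_rest_of[OF g]
  have R: "\<exists>u\<in>U. L u = k" and nd: "\<And>j. \<lbrakk>j < k; j \<notin> D\<rbrakk> \<Longrightarrow> part L j \<inter> U = {}"
    using g by (auto simp: growing_def)
  have Un: "U \<subseteq> {..<n}" using U by (simp add: rest_of_def)
  have "weight (part L i \<union> U) = weight (part L i - U) + weight U"
    using sum.union_disjoint[of U "part L i - U" wt] Un by (simp add: finite_subset Un_commute)
  then have i: "i < k" "y \<in> part L i" "x \<in> U" "adj x y" "weight (part L i \<union> U) \<le> cap i"
    using xy y by (simp_all add: i_def part_def)
  have pi: "part L' i = part L i \<union> U"
    using Un by (auto simp: L'_def part_def)
  have pj: "part L' j = part L j - U" if "j \<noteq> i" for j
    using that by (auto simp: L'_def part_def)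
  have ci: "connected (part L' i)"
  proof -
    have "connected (U \<union> part L i)"
      using conn_Un[OF symp_adj] U Inv i unfolding rest_of_def Inv_def
      by (metis emptyE)
    then show ?thesis by (simp add: pi Un_commute)
  qed
  have wi: "weight (part L i) \<le> weight (part L' i)"
    unfolding pi by (rule weight_mono) (use Un part_bound in auto)
  have other: "part L' j = part L j" if "j < k" "j \<notin> D" "j \<noteq> i" for j
    using nd[OF that(1,2)] pj[OF that(3)] by auto
  have inD: "connected (part L' j) \<and> a j \<le> weight (part L' j) \<and> weight (part L' j) \<le> weight (part L j)"
    if "j \<in> D" "j \<noteq> i" for j
    using that U pj[OF that(2)] weight_mono[OF _ part_bound, of "part L j - U" L j]
    unfolding rest_of_def by auto
  show "Inv L' D"
    unfolding Inv_def
  proof (intro conjI ballI allI impI)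
    show "D \<subseteq> {..<k}" using Inv by (simp add: Inv_def)
    show "L' v \<le> k" if "v < n" for v using that Inv i by (auto simp: Inv_def L'_def)
    show "a j \<le> weight (part L' j)" if "j \<in> D" for j
      using inD[OF that] wi Inv that by (cases "j = i") (auto simp: Inv_def)
    show "a j \<le> a i" if "i \<in> D" "j < k" "j \<notin> D" for i j using that Inv by (auto simp: Inv_def)
    show "connected (part L' j)" if "j < k" "part L' j \<noteq> {}" for j
      using inD[of j] other[of j] ci that Inv by (cases "j = i"; cases "j \<in> D") (auto simp: Inv_def)
    show "lo j \<le> weight (part L' j)" if "j < k" for j
    proof (cases "j = i")
      case True then show ?thesis using wi i(1) Inv by (auto simp: Inv_def intro: order_trans)
    next
      case False then show ?thesis using inD[of j] other[of j] lo_a[OF that] that Inv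
        by (cases "j \<in> D") (auto simp: Inv_def)
    qed
    show "weight (part L' j) \<le> cap j" if "j < k" for j
    proof (cases "j = i")
      case True then show ?thesis using i pi by auto
    next
      case False then show ?thesis using inD[of j] other[of j] that Inv
        by (cases "j \<in> D") (auto simp: Inv_def intro: order_trans)
    qed
    show "part L' j = {} \<or> big" if "j < k" "j \<notin> D" for j
      using other[of j] that Inv i by (cases "j = i") (auto simp: Inv_def)
  qed
  have "part L' k \<subset> part L k"
    using pj[of k] i(1) R Un by (auto simp: part_def)
  then show "card (part L' k) < card (part L k)"
    by (rule psubset_card_mono[rotated]) simp
qed

text \<open>Both alternatives occur: in the first phase a single vertex may weigh up to three times
  the threshold.\<close>

lemma growing_start:
  assumes u: "u < n" "L u = k"
  shows "wt u < a p \<Longrightarrow> growing L D cen pc p {u}" "a p \<le> wt u \<Longrightarrow> event L D p {u} k"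
proof -
  have Dk: "D \<subseteq> {..<k}" using Inv by (simp add: Inv_def)
  have pu: "piece pc u = {u}" using pcs u Dk by (auto simp: pieces_def)
  have disj: "part L j - {u} = part L j" "part L j \<inter> {u} = {}" if "j < k" for j
    using that u by (auto simp: part_def)
  have cen: "cen j \<noteq> u" if "j \<in> D" for j
    using pcs that Dk u by (auto simp: pieces_def part_def)
  show "growing L D cen pc p {u}" if "wt u < a p"
    unfolding growing_def using that u pu disj cen Dk conn_singleton by auto
  note Dc = Inv_D(4,2)[OF Inv]
  show "event L D p {u} k" if "a p \<le> wt u"
    unfolding event_def rest_of_def
    by (intro conjI ballI allI impI)
      (use that u Dk p conn_singleton disj Dc in \<open>auto simp: subset_iff\<close>)
qed

end

text \<open>The half that stays keeps its part finished; the other half reaches \<open>a p\<close>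
  because finished thresholds are the largest.\<close>

lemma split_event:
  assumes Inv: "Inv L D"
    and p: "p < k" "p \<notin> D" "\<And>j. \<lbrakk>j < k; j \<notin> D\<rbrakk> \<Longrightarrow> a j \<le> a p" "weight (part L p) < a p"
    and i: "i \<in> D" "S \<subseteq> part L i" "connected S" "a i \<le> weight S"
      "connected (part L i - S)" "a i \<le> weight (part L i - S)"
  shows "event L D p S k"
proof -
  have Dk: "D \<subseteq> {..<k}" using Inv by (simp add: Inv_def)
  have disj: "part L j - S = part L j" "part L j \<inter> S = {}" if "j \<noteq> i" for j
    using that i by (auto simp: part_def)
  note Dc = Inv_D(4,2)[OF Inv]
  have D: "connected (part L j - S) \<and> a j \<le> weight (part L j - S)" if "j \<in> D" for j
    using disj[of j] Dc that i by (cases "j = i") auto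
  have "a p \<le> a i" using Inv i p by (auto simp: Inv_def)
  then show ?thesis
    unfolding event_def rest_of_def
    by (intro conjI ballI allI impI) (use p i D disj Dk part_bound in \<open>auto simp: subset_iff part_def\<close>)
qed

end

section \<open>The program\<close>

text \<open>Arrays 6 to 14 are fixed during a phase. The cells with index \<open>k\<close> of \<open>thr\<close>, \<open>capa\<close> and
  \<open>finished\<close> stay 0, so an uncovered vertex, whose label is \<open>k\<close>, never passes for a vertex of a
  finished part or of a part with spare capacity.\<close>

abbreviation (input) "label \<equiv> 5 :: nat"
abbreviation (input) "numV \<equiv> 6 :: nat"
abbreviation (input) "numK \<equiv> 7 :: nat"
abbreviation (input) "numE \<equiv> 8 :: nat"
abbreviation (input) "rounds \<equiv> 9 :: nat"
abbreviation (input) "wgt \<equiv> 10 :: nat"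
abbreviation (input) "src \<equiv> 11 :: nat"
abbreviation (input) "dst \<equiv> 12 :: nat"
abbreviation (input) "thr \<equiv> 13 :: nat"
abbreviation (input) "capa \<equiv> 14 :: nat"
abbreviation (input) "finished \<equiv> 15 :: nat"
abbreviation (input) "cur \<equiv> 16 :: nat"
abbreviation (input) "pwgt \<equiv> 17 :: nat"
abbreviation (input) "ctrP \<equiv> 20 :: nat"
abbreviation (input) "ctrI \<equiv> 21 :: nat"
abbreviation (input) "ctrV \<equiv> 22 :: nat"
abbreviation (input) "ctrR \<equiv> 23 :: nat"
abbreviation (input) "ctrE \<equiv> 24 :: nat"
abbreviation (input) "ctrU \<equiv> 25 :: nat"
abbreviation (input) "found \<equiv> 30 :: nat"
abbreviation (input) "foundX \<equiv> 31 :: nat"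
abbreviation (input) "foundY \<equiv> 32 :: nat"
abbreviation (input) "seen \<equiv> 40 :: nat"
abbreviation (input) "parent \<equiv> 41 :: nat"
abbreviation (input) "order \<equiv> 42 :: nat"
abbreviation (input) "numO \<equiv> 43 :: nat"
abbreviation (input) "rooted \<equiv> 44 :: nat"
abbreviation (input) root :: nat where "root \<equiv> 45"
abbreviation (input) top :: nat where "top \<equiv> 46"
abbreviation (input) "pid \<equiv> 47 :: nat"
abbreviation (input) "clw \<equiv> 48 :: nat"
abbreviation (input) "centred \<equiv> 49 :: nat"
abbreviation (input) "centre \<equiv> 50 :: nat"
abbreviation (input) "curV \<equiv> 51 :: nat"
abbreviation (input) "curY \<equiv> 52 :: nat"
abbreviation (input) "inX \<equiv> 60 :: nat"
abbreviation (input) "wX \<equiv> 61 :: nat"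
abbreviation (input) "stop \<equiv> 62 :: nat"
abbreviation (input) "evt \<equiv> 63 :: nat"
abbreviation (input) "newlab \<equiv> 64 :: nat"
abbreviation (input) "sel \<equiv> 65 :: nat"
abbreviation (input) "selW \<equiv> 66 :: nat"

abbreviation (input) Pos :: "aexp \<Rightarrow> bexp" where "Pos e \<equiv> Less (Const 0) e"

abbreviation (input) At :: "nat \<Rightarrow> nat \<Rightarrow> aexp" (infixl "$" 90) where "a $ x \<equiv> Cell a (Var x)"
abbreviation (input) "scanned \<equiv> {ctrE, found, foundX, foundY}"

text \<open>There is no early exit: the last match survives, and the number of rounds stays fixed
  for the static cost.\<close>

definition Scan :: "bexp \<Rightarrow> prog" where
  "Scan c = Then (Let found (Const 0))
     (For ctrE numE (When c (block [Let found (Const 1),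
        Let foundX (src $ ctrE), Let foundY (dst $ ctrE)])))"

text \<open>Index \<open>k\<close> collects the weight of the uncovered vertices;
  \<open>step_cond\<close> tests it to see whether any are left.\<close>

definition Weigh :: prog where
  "Weigh = block
    [For ctrI numK (Set pwgt (Var ctrI) (Const 0)),
     Set pwgt (Var numK) (Const 0),
     For ctrV numV (Set pwgt (label $ ctrV)
       (Plus (Cell pwgt (label $ ctrV)) (wgt $ ctrV)))]"

abbreviation (input) pick_body where
  "pick_body \<equiv> When (Conj (Neg (Pos (finished $ ctrI)))
     (Less (thr $ cur) (thr $ ctrI))) (Let cur (Var ctrI))"

definition Pick :: prog where
  "Pick = block [Let cur (Var numK), For ctrI numK pick_body]"

abbreviation (input) roots_body where
  "roots_body \<equiv> When (Conj (Pos (Cell finished (label $ ctrV)))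
     (Neg (Pos (Cell rooted (label $ ctrV)))))
     (block
     [Set rooted (label $ ctrV) (Const 1),
      Set root (label $ ctrV) (Var ctrV),
      Set seen (Var ctrV) (Const 1),
      Set order (Var numO) (Var ctrV),
      Let numO (Plus (Var numO) (Const 1))])"

definition Roots :: prog where
  "Roots = block
    [For ctrI numK (Set rooted (Var ctrI) (Const 0)),
     For ctrV numV (Set seen (Var ctrV) (Const 0)),
     Let numO (Const 0),
     For ctrV numV roots_body]"

abbreviation (input) search_cond where
  "search_cond \<equiv> Conj (Pos (Cell seen (src $ ctrE)))
     (Conj (Neg (Pos (Cell seen (dst $ ctrE))))
     (Eq (Cell label (src $ ctrE)) (Cell label (dst $ ctrE))))"

abbreviation (input) search_add where
  "search_add \<equiv> block
     [Set seen (Var foundY) (Const 1),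
      Set parent (Var foundY) (Var foundX),
      Set order (Var numO) (Var foundY),
      Let numO (Plus (Var numO) (Const 1))]"

abbreviation (input) search_body where
  "search_body \<equiv> block [Scan search_cond, When (Pos (Var found)) search_add]"

text \<open>All finished parts are searched together, since only arcs inside a part are followed;
  the whole forest thus costs \<open>n\<close> scans instead of \<open>n\<close> scans per
  part.\<close>

definition Search :: prog where
  "Search = For ctrR numV search_body"

definition fin :: "nat \<Rightarrow> (nat \<Rightarrow> nat) \<Rightarrow> nat set" where
  "fin k d = {i. i < k \<and> 0 < d i}"

lemma fin_iff: "\<lbrakk>l \<le> k; d k = 0\<rbrakk> \<Longrightarrow> l \<in> fin k d \<longleftrightarrow> 0 < d l"
  by (cases "l = k") (auto simp: fin_def)

context thresholds
begin

definition base :: "state \<Rightarrow> bool" where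
  "base s \<longleftrightarrow> s numV 0 = n \<and> s numK 0 = k \<and> s numE 0 = m \<and> s wgt = wt \<and> s src = F \<and> s dst = T \<and>
     s thr = a \<and> s capa = cap"

lemma base_agree:
  "\<lbrakk>base s; \<And>b. b \<in> {numV, numK, numE, wgt, src, dst, thr, capa} \<Longrightarrow> s' b = s b\<rbrakk> \<Longrightarrow> base s'"
  unfolding base_def by simp

lemma base_run:
  assumes "base s" "mods p \<inter> {numV, numK, numE, wgt, src, dst, thr, capa} = {}"
  shows "base (run p s)"
  by (rule base_agree[OF assms(1)], rule run_frame, use assms(2) in blast)

text \<open>\<open>Q\<close> is the test as a relation between the ends of an arc. The premise
  demands it in every state that differs from \<open>s\<close> only in the variables of the scan,
  that is, in each of its rounds.\<close>

lemma run_Scan: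
  assumes s: "s numE 0 = m" "s src = F" "s dst = T"
    and Q: "\<forall>s'. (\<forall>l. l \<notin> scanned \<longrightarrow> s' l = s l) \<longrightarrow>
      bval c s' = Q (F (s' ctrE 0)) (T (s' ctrE 0))"
  shows "0 < run (Scan c) s found 0 \<Longrightarrow> adj (run (Scan c) s foundX 0) (run (Scan c) s foundY 0) \<and>
      Q (run (Scan c) s foundX 0) (run (Scan c) s foundY 0)"
    and "run (Scan c) s found 0 = 0 \<Longrightarrow> adj x y \<Longrightarrow> \<not> Q x y"
proof -
  define I where "I = (\<lambda>j (s'::state). (0 < s' found 0 \<longrightarrow> (\<exists>e<m. F e = s' foundX 0 \<and> T e = s' foundY 0 \<and> Q (F e) (T e))) \<and>
    (s' found 0 = 0 \<longrightarrow> (\<forall>e<j. \<not> Q (F e) (T e))))"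
  let ?body = "When c (block [Let found (Const 1),
        Let foundX (src $ ctrE), Let foundY (dst $ ctrE)])"
  let ?s = "upd s found 0 0"
  have "I (?s numE 0) (run (For ctrE numE ?body) ?s)"
  proof (rule run_For, goal_cases)
    show "I 0 (upd ?s ctrE 0 0)" by (simp add: I_def)
  next
    case (3 j s')
    note j = 3(1-3) and fr = 3(4)
    have jm: "j < m" using j s by simp
    have c: "bval c s' \<longleftrightarrow> Q (F j) (T j)"
      using Q[rule_format, of s'] j(3) fr by simp
    have st: "s' src = F" "s' dst = T" using fr s by simp_all
    show ?case
      using j(2,3) jm by (auto simp: I_def c st less_Suc_eq)
  qed simp
  then have I: "I m (run (Scan c) s)"
    using s by (simp add: Scan_def)
  show "0 < run (Scan c) s found 0 \<Longrightarrow> adj (run (Scan c) s foundX 0) (run (Scan c) s foundY 0) \<and>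
      Q (run (Scan c) s foundX 0) (run (Scan c) s foundY 0)"
    and "run (Scan c) s found 0 = 0 \<Longrightarrow> adj x y \<Longrightarrow> \<not> Q x y"
    using I by (auto simp: I_def adj_def)
qed

lemma run_Weigh:
  assumes s: "base s" and L: "\<forall>v<n. s label v \<le> k"
  shows "i \<le> k \<Longrightarrow> run Weigh s pwgt i = weight (part (s label) i)"
proof -
  let ?p1 = "For ctrI numK (Set pwgt (Var ctrI) (Const 0))"
  define s1 where "s1 = run (Set pwgt (Var numK) (Const 0)) (run ?p1 s)"
  have "\<forall>i<s numK 0. run ?p1 s pwgt i = 0"
    by (rule run_For[where I = "\<lambda>j s'. \<forall>i<j. s' pwgt i = 0"]) (auto simp: less_Suc_eq)
  then have s1: "\<forall>i\<le>k. s1 pwgt i = 0" "s1 label = s label" "s1 wgt = wt" "s1 numV 0 = n"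
    using s run_frame[of _ ?p1 s] by (auto simp: s1_def base_def)
  let ?body = "Set pwgt (label $ ctrV) (Plus (Cell pwgt (label $ ctrV)) (wgt $ ctrV))"
  have "\<forall>i\<le>k. run (For ctrV numV ?body) s1 pwgt i = sum wt {v. v < s1 numV 0 \<and> s label v = i}"
  proof (rule run_For[where I = "\<lambda>j s'. \<forall>i\<le>k. s' pwgt i = sum wt {v. v < j \<and> s label v = i}"], goal_cases)
    show "\<forall>i\<le>k. upd s1 ctrV 0 0 pwgt i = sum wt {v. v < 0 \<and> s label v = i}"
      using s1 by simp
  next
    case (3 j s')
    note j = 3(1-3) and fr = 3(4)
    have set: "{v. v < Suc j \<and> s label v = i} =
        (if s label j = i then insert j {v. v < j \<and> s label v = i} else {v. v < j \<and> s label v = i})" for i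
      by (auto simp: less_Suc_eq)
    show ?case
      using j fr s1 by (auto simp: set)
  qed simp
  moreover have "run Weigh s = run (For ctrV numV ?body) s1"
    by (simp add: Weigh_def s1_def)
  ultimately show "i \<le> k \<Longrightarrow> run Weigh s pwgt i = weight (part (s label) i)"
    using s1 by (simp add: part_def)
qed

text \<open>The maximum starts at index \<open>k\<close>, whose threshold is 0. Thresholds of real
  indices are positive, so \<open>k\<close> survives only if all of them are finished.\<close>

lemma run_Pick:
  assumes s: "base s"
  defines "D \<equiv> fin k (s finished)" and "p \<equiv> run Pick s cur 0"
  shows "p \<le> k" "p < k \<Longrightarrow> p \<notin> D" "\<lbrakk>p < k; j < k; j \<notin> D\<rbrakk> \<Longrightarrow> a j \<le> a p" "p = k \<Longrightarrow> D = {..<k}"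
proof -
  let ?s = "upd s cur 0 (s numK 0)"
  define I where "I = (\<lambda>j (s'::state). s' cur 0 \<le> k \<and> (s' cur 0 < k \<longrightarrow> s' cur 0 \<notin> D) \<and>
    (\<forall>i<j. s finished i = 0 \<longrightarrow> a i \<le> a (s' cur 0)))"
  have "I (?s numK 0) (run (For ctrI numK pick_body) ?s)"
  proof (rule run_For, goal_cases)
    show "I 0 (upd ?s ctrI 0 0)" using s by (simp add: I_def base_def)
  next
    case (3 j s')
    note j = 3(1-3) and fr = 3(4)
    have e: "s' finished = s finished" "s' thr = a" "j < k"
      using fr j s by (simp_all add: base_def)
    show ?case
      using j(2) e(3) by (auto simp: I_def e(1,2) j(3) less_Suc_eq D_def fin_def)
  qed simp
  moreover have "run Pick s = run (For ctrI numK pick_body) ?s"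
    by (simp add: Pick_def)
  ultimately have I: "p \<le> k" "p < k \<longrightarrow> p \<notin> D" "\<forall>i<k. i \<notin> D \<longrightarrow> a i \<le> a p"
    using s by (auto simp: I_def p_def base_def D_def fin_def)
  then show "p \<le> k" "p < k \<Longrightarrow> p \<notin> D" "\<lbrakk>p < k; j < k; j \<notin> D\<rbrakk> \<Longrightarrow> a j \<le> a p" by auto
  show "D = {..<k}" if "p = k"
    using I(3) a_k a_pos that unfolding D_def fin_def by fastforce
qed

subsection \<open>Search forest\<close>

text \<open>\<open>H\<close> holds the labels that already have a root, so one predicate serves both
  the choice of the roots and the search. Roots and parents come before their descendants in
  \<open>ord\<close>, which makes the reverse order bottom-up.\<close>

definition forest :: "(nat \<Rightarrow> nat) \<Rightarrow> nat set \<Rightarrow> (nat \<Rightarrow> nat) \<Rightarrow> (nat \<Rightarrow> nat) \<Rightarrow> (nat \<Rightarrow> nat) \<Rightarrow> nat \<Rightarrow>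
    (nat \<Rightarrow> nat) \<Rightarrow> bool" where
  "forest L H rc par ord c rt \<longleftrightarrow> inj_on ord {..<c} \<and>
     (\<forall>j<c. ord j < n \<and> L (ord j) \<in> H \<and> (\<exists>j'\<le>j. ord j' = rt (L (ord j))) \<and>
        (ord j = rt (L (ord j)) \<or>
         (\<exists>j'<j. par (ord j) = ord j' \<and> adj (ord j') (ord j) \<and> L (ord j') = L (ord j)))) \<and>
     (\<forall>v<n. 0 < rc v \<longleftrightarrow> v \<in> ord ` {..<c}) \<and>
     (\<forall>i\<in>H. rt i \<in> part L i \<and> rt i \<in> ord ` {..<c})"

text \<open>The common core of adding a root and adding a child; \<open>rt'\<close> and
  \<open>par'\<close> may differ from the old maps only where no listed vertex notices.\<close>

lemma forest_add:
  assumes f: "forest L H rc par ord c rt" and v: "v < n" "v \<notin> ord ` {..<c}"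
    and rt': "\<forall>i\<in>H. rt' i = rt i" and par': "\<forall>u\<in>ord ` {..<c}. par' u = par u"
    and root: "rt' (L v) \<in> part L (L v)" "rt' (L v) \<in> insert v (ord ` {..<c})"
    and parent: "v = rt' (L v) \<or> (\<exists>x\<in>ord ` {..<c}. par' v = x \<and> adj x v \<and> L x = L v)"
  shows "forest L (insert (L v) H) (rc(v := 1)) par' (ord(c := v)) (Suc c) rt'"
proof -
  let ?o = "ord(c := v)"
  have im: "?o ` {..<Suc c} = insert v (ord ` {..<c})"
    by (auto simp: lessThan_Suc)
  have old: "ord j < n" "L (ord j) \<in> H" "\<exists>j'\<le>j. ord j' = rt (L (ord j))"
    "ord j = rt (L (ord j)) \<or> (\<exists>j'<j. par (ord j) = ord j' \<and> adj (ord j') (ord j) \<and> L (ord j') = L (ord j))"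
    if "j < c" for j
    using forest_def[THEN iffD1, OF f, THEN conjunct2, THEN conjunct1, rule_format, OF that] by simp_all
  have "inj_on ?o {..<Suc c}"
    using f v(2) by (auto simp: forest_def inj_on_def less_Suc_eq)
  moreover have "?o j < n \<and> L (?o j) \<in> insert (L v) H \<and> (\<exists>j'\<le>j. ?o j' = rt' (L (?o j))) \<and>
      (?o j = rt' (L (?o j)) \<or> (\<exists>j'<j. par' (?o j) = ?o j' \<and> adj (?o j') (?o j) \<and> L (?o j') = L (?o j)))"
    if "j < Suc c" for j
  proof (cases "j = c")
    case True
    have "\<exists>j'\<le>c. ?o j' = rt' (L v)" using root(2)
    proof
      assume "rt' (L v) \<in> ord ` {..<c}"
      then obtain j' where "j' < c" "rt' (L v) = ord j'" by auto
      then show ?thesis by (intro exI[of _ j']) simp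
    qed (auto intro!: exI[of _ c])
    moreover have "v = rt' (L v) \<or> (\<exists>j'<c. par' v = ?o j' \<and> adj (?o j') v \<and> L (?o j') = L v)"
      using parent
    proof
      assume "\<exists>x\<in>ord ` {..<c}. par' v = x \<and> adj x v \<and> L x = L v"
      then obtain j' where "j' < c" "par' v = ord j'" "adj (ord j') v" "L (ord j') = L v" by auto
      then show ?thesis by (intro disjI2 exI[of _ j']) simp
    qed simp
    ultimately show ?thesis using True v by simp
  next
    case False
    then have j: "j < c" using that by simp
    obtain j' where "j' \<le> j" "ord j' = rt (L (ord j))" using old(3)[OF j] by blast
    then have "\<exists>j'\<le>j. ?o j' = rt' (L (ord j))" using j rt' old(2)[OF j] by (intro exI[of _ j']) simp
    moreover have "ord j = rt' (L (ord j)) \<or>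
        (\<exists>j'<j. par' (ord j) = ?o j' \<and> adj (?o j') (ord j) \<and> L (?o j') = L (ord j))"
      using old(4)[OF j]
    proof
      assume "\<exists>j'<j. par (ord j) = ord j' \<and> adj (ord j') (ord j) \<and> L (ord j') = L (ord j)"
      then obtain j' where "j' < j" "par (ord j) = ord j'" "adj (ord j') (ord j)" "L (ord j') = L (ord j)" by blast
      then show ?thesis using j par' by (intro disjI2 exI[of _ j']) simp
    qed (use rt' old(2)[OF j] in simp)
    ultimately show ?thesis using False old(1,2)[OF j] by simp
  qed
  moreover have "\<forall>u<n. 0 < (rc(v := 1)) u \<longleftrightarrow> u \<in> ?o ` {..<Suc c}"
    unfolding im using f by (auto simp: forest_def)
  moreover have "\<forall>i\<in>insert (L v) H. rt' i \<in> part L i \<and> rt' i \<in> ?o ` {..<Suc c}"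
    unfolding im using f root rt' by (auto simp: forest_def)
  ultimately show ?thesis unfolding forest_def by blast
qed

lemma forest_add_root:
  assumes f: "forest L H rc par ord c rt" and v: "v < n" "L v \<notin> H"
  shows "forest L (insert (L v) H) (rc(v := 1)) par (ord(c := v)) (Suc c) (rt(L v := v))"
  by (rule forest_add[OF f v(1)]) (use f v in \<open>auto simp: forest_def part_def\<close>)

lemma forest_add_child:
  assumes f: "forest L H rc par ord c rt" and xy: "adj x y" "L x = L y" "0 < rc x" "rc y = 0"
  shows "forest L H (rc(y := 1)) (par(y := x)) (ord(c := y)) (Suc c) rt"
proof -
  have n: "x < n" "y < n" using adj_bound xy by auto
  have x: "x \<in> ord ` {..<c}" and y: "y \<notin> ord ` {..<c}" using f xy n by (auto simp: forest_def)
  then have H: "L y \<in> H" using f xy by (auto simp: forest_def)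
  have "forest L (insert (L y) H) (rc(y := 1)) (par(y := x)) (ord(c := y)) (Suc c) rt"
    by (rule forest_add[OF f n(2) y]) (use f x y xy H in \<open>auto simp: forest_def\<close>)
  then show ?thesis using H by (simp add: insert_absorb)
qed

lemma forest_card: "forest L H rc par ord c rt \<Longrightarrow> c \<le> n"
  using card_inj_on_le[of ord "{..<c}" "{..<n}"] by (auto simp: forest_def)

text \<open>Otherwise the seen vertices form a cut of a connected part, between its root and
  \<open>v\<close>, and the crossing arc contradicts \<open>closed\<close>.\<close>

lemma forest_complete:
  assumes f: "forest L H rc par ord c rt"
    and conn: "\<And>i. i \<in> H \<Longrightarrow> connected (part L i)"
    and closed: "\<And>x y. adj x y \<Longrightarrow> \<not> (0 < rc x \<and> rc y = 0 \<and> L x = L y)"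
    and v: "v < n" "L v \<in> H"
  shows "0 < rc v"
proof (rule ccontr)
  assume "\<not> 0 < rc v"
  moreover have "rt (L v) \<in> part L (L v)" "0 < rc (rt (L v))"
    using f v by (auto simp: forest_def part_def)
  ultimately have "{u. 0 < rc u} \<inter> part L (L v) \<noteq> {}" "\<not> part L (L v) \<subseteq> {u. 0 < rc u}"
    using v by (auto simp: part_def)
  from conn_cut[OF conn[OF v(2)] this] show False
    using closed by (fastforce simp: part_def)
qed

lemma run_Roots:
  assumes s: "base s" and L: "\<forall>v<n. s label v \<le> k" and d: "s finished k = 0"
    and ne: "\<And>i. i \<in> fin k (s finished) \<Longrightarrow> part (s label) i \<noteq> {}"
  defines "t \<equiv> run Roots s"
  shows "forest (s label) (fin k (s finished)) (t seen) (t parent) (t order) (t numO 0) (t root)"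
proof -
  define D where "D = fin k (s finished)"
  let ?p1 = "For ctrI numK (Set rooted (Var ctrI) (Const 0))"
  let ?p2 = "For ctrV numV (Set seen (Var ctrV) (Const 0))"
  define s1 where "s1 = run ?p1 s"
  define s2 where "s2 = run ?p2 s1"
  define s3 where "s3 = upd s2 numO 0 0"
  have "\<forall>i<s numK 0. s1 rooted i = 0" unfolding s1_def
    by (rule run_For[where I = "\<lambda>j s'. \<forall>i<j. s' rooted i = 0"]) (auto simp: less_Suc_eq)
  then have s1: "\<forall>i<k. s1 rooted i = 0" "\<And>b. b \<notin> {ctrI, rooted} \<Longrightarrow> s1 b = s b"
    using s run_frame[of _ ?p1 s] by (auto simp: s1_def base_def)
  have "\<forall>i<s1 numV 0. s2 seen i = 0" unfolding s2_def
    by (rule run_For[where I = "\<lambda>j s'. \<forall>i<j. s' seen i = 0"]) (auto simp: less_Suc_eq)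
  then have s2: "\<forall>i<n. s2 seen i = 0" "\<And>b. b \<notin> {ctrV, seen} \<Longrightarrow> s2 b = s1 b"
    using s s1 run_frame[of _ ?p2 s1] by (auto simp: s2_def base_def)
  have s3: "\<forall>i<k. s3 rooted i = 0" "\<forall>i<n. s3 seen i = 0" "s3 numO 0 = 0"
    "s3 label = s label" "s3 finished = s finished" "s3 numV 0 = n"
    using s1 s2 s by (simp_all add: s3_def base_def)
  define I where "I = (\<lambda>j (s'::state). forest (s label) {i\<in>D. 0 < s' rooted i} (s' seen) (s' parent) (s' order) (s' numO 0) (s' root) \<and>
    (\<forall>v<j. s label v \<in> D \<longrightarrow> 0 < s' rooted (s label v)))"
  have "I (s3 numV 0) (run (For ctrV numV roots_body) s3)"
  proof (rule run_For, goal_cases)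
    have "{i\<in>D. 0 < s3 rooted i} = {}" using s3 by (auto simp: D_def fin_def)
    then show "I 0 (upd s3 ctrV 0 0)" using s3 by (simp add: I_def forest_def)
  next
    case (3 j s')
    note j = 3(1-3) and fr = 3(4)
    have e: "s' label = s label" "s' finished = s finished" "j < n"
      using fr j s3 by simp_all
    have D: "0 < s finished (s label j) \<longleftrightarrow> s label j \<in> D"
      using L d e by (simp add: D_def fin_iff)
    show ?case
    proof (cases "s label j \<in> D \<and> s' rooted (s label j) = 0")
      case True
      let ?H = "{i\<in>D. 0 < s' rooted i}"
      have f: "forest (s label) (insert (s label j) ?H) ((s' seen)(j := 1)) (s' parent)
          ((s' order)(s' numO 0 := j)) (Suc (s' numO 0)) ((s' root)(s label j := j))"
        by (rule forest_add_root) (use j True e in \<open>auto simp: I_def\<close>)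
      define s1 where "s1 = upd (run roots_body s') ctrV 0 (Suc j)"
      have s1: "s1 rooted = (s' rooted)(s label j := 1)" "s1 seen = (s' seen)(j := 1)"
        "s1 parent = s' parent" "s1 order = (s' order)(s' numO 0 := j)" "s1 numO 0 = Suc (s' numO 0)"
        "s1 root = (s' root)(s label j := j)"
        using True by (simp_all add: s1_def e D j(3) fun_upd_def)
      have "insert (s label j) ?H = {i\<in>D. 0 < s1 rooted i}"
        using True by (auto simp: s1)
      moreover have "\<forall>v<Suc j. s label v \<in> D \<longrightarrow> 0 < s1 rooted (s label v)"
        using j(2) by (auto simp: I_def less_Suc_eq s1)
      ultimately show ?thesis
        using f unfolding I_def s1_def[symmetric] s1(2-6) by simp
    next
      case False
      then show ?thesis using j by (auto simp: I_def e D less_Suc_eq)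
    qed
  qed simp
  moreover have "t = run (For ctrV numV roots_body) s3"
    by (simp add: t_def Roots_def s1_def s2_def s3_def)
  ultimately have I: "I n t" using s3 by simp
  have "{i\<in>D. 0 < t rooted i} = D"
  proof (intro equalityI subsetI)
    fix i assume i: "i \<in> D"
    then obtain v where "v < n" "s label v = i" using ne by (auto simp: D_def part_def)
    then show "i \<in> {i\<in>D. 0 < t rooted i}" using I i unfolding I_def by blast
  qed simp
  then show ?thesis using I by (simp add: I_def D_def)
qed

lemma run_Search:
  assumes s: "base s"
    and f: "forest (s label) H (s seen) (s parent) (s order) (s numO 0) (s root)"
    and conn: "\<And>i. i \<in> H \<Longrightarrow> connected (part (s label) i)"
  defines "t \<equiv> run Search s"
  shows "forest (s label) H (t seen) (t parent) (t order) (t numO 0) (s root)"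
    and "t order ` {..<t numO 0} = {v. v < n \<and> s label v \<in> H}"
proof -
  \<comment> \<open>Every round either finds the search complete or adds a vertex; as
    \<open>numO\<close> cannot exceed \<open>n\<close>, the search is complete after
    \<open>n\<close> rounds.\<close>
  define I where "I = (\<lambda>j (s'::state). forest (s label) H (s' seen) (s' parent) (s' order) (s' numO 0) (s root) \<and>
    ((\<forall>v<n. s label v \<in> H \<longrightarrow> 0 < s' seen v) \<or> j \<le> s' numO 0))"
  have "I (s numV 0) (run (For ctrR numV search_body) s)"
  proof (rule run_For, goal_cases)
    show "ctrR \<notin> mods search_body" by (simp add: Scan_def)
    show "I 0 (upd s ctrR 0 0)" using f by (simp add: I_def)
  next
    case (3 j s')
    note j = 3(1-3) and fr = 3(4)
    have e: "s' label = s label" "s' numE 0 = m" "s' src = F" "s' dst = T"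
      using fr s by (simp_all add: Scan_def base_def)
    define s1 where "s1 = run (Scan search_cond) s'"
    define Q where "Q = (\<lambda>x y. 0 < s' seen x \<and> s' seen y = 0 \<and> s label x = s label y)"
    have Q: "\<forall>s''. (\<forall>l. l \<notin> scanned \<longrightarrow> s'' l = s' l) \<longrightarrow>
        bval search_cond s'' = Q (F (s'' ctrE 0)) (T (s'' ctrE 0))"
      by (simp add: Q_def e)
    note scan = run_Scan[where Q = Q, OF e(2-4) Q, folded s1_def]
    have s1: "s1 b = s' b" if "b \<notin> scanned" for b
      unfolding s1_def by (rule run_frame) (use that in \<open>simp add: Scan_def\<close>)
    show ?case
    proof (cases "0 < s1 found 0")
      case True
      then have xy: "adj (s1 foundX 0) (s1 foundY 0)" "Q (s1 foundX 0) (s1 foundY 0)"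
        using scan(1) by auto
      let ?y = "s1 foundY 0"
      have f1: "forest (s label) H ((s' seen)(?y := 1)) ((s' parent)(?y := s1 foundX 0))
         ((s' order)(s' numO 0 := ?y)) (Suc (s' numO 0)) (s root)"
        by (rule forest_add_child) (use j xy in \<open>auto simp: I_def Q_def\<close>)
      show ?thesis
        using True f1 j(2) s1 by (auto simp: I_def s1_def[symmetric] fun_upd_def)
    next
      case False
      have "0 < s' seen v" if "v < n" "s label v \<in> H" for v
        by (rule forest_complete[OF _ conn _ that])
          (use j(2) False scan(2) in \<open>auto simp: I_def Q_def\<close>)
      then show ?thesis
        using False j(2) s1 by (auto simp: I_def s1_def[symmetric])
    qed
  qed
  then have I: "I n t" using s by (simp add: t_def Search_def base_def)
  then show ft: "forest (s label) H (t seen) (t parent) (t order) (t numO 0) (s root)"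
    by (simp add: I_def)
  have sub: "t order ` {..<t numO 0} \<subseteq> {v. v < n \<and> s label v \<in> H}"
    using ft by (auto simp: forest_def)
  have "{v. v < n \<and> s label v \<in> H} \<subseteq> t order ` {..<t numO 0}"
  proof (cases "n \<le> t numO 0")
    case True
    have "card (t order ` {..<t numO 0}) = t numO 0"
      using ft by (simp add: forest_def card_image)
    then have "card (t order ` {..<t numO 0}) = n"
      using forest_card[OF ft] True by linarith
    moreover have "t order ` {..<t numO 0} \<subseteq> {..<n}" using sub by auto
    ultimately have "t order ` {..<t numO 0} = {..<n}"
      by (intro card_subset_eq) auto
    then show ?thesis by auto
  next
    case False
    then show ?thesis using I ft by (auto simp: I_def forest_def)
  qed
  with sub show "t order ` {..<t numO 0} = {v. v < n \<and> s label v \<in> H}" by blast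
qed

end

subsection \<open>Contracting the forest\<close>

text \<open>In reverse search order every vertex is merged into its parent, except that the first
  cluster of a part to reach the threshold stays separate: its top is the centre of the part.
  The piece number of a vertex is the top of the cluster it was in just before its last merge.\<close>

abbreviation (input) contract_init where
  "contract_init \<equiv> For ctrV numV (block
     [Set top (Var ctrV) (Var ctrV),
      Set pid (Var ctrV) (Var ctrV),
      Set clw (Var ctrV) (wgt $ ctrV)])"

abbreviation (input) contract_relabel where
  "contract_relabel \<equiv> For ctrU numV (When (Eq (top $ ctrU) (Var curV)) (block
     [Set top (Var ctrU) (Var curY),
      Set pid (Var ctrU) (Var curV)]))"

abbreviation (input) contract_mark where
  "contract_mark \<equiv> block
     [Set centred (label $ curV) (Const 1),
      Set centre (label $ curV) (Var curV)]"

abbreviation (input) contract_merge where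
  "contract_merge \<equiv> block
     [Let curY (parent $ curV), contract_relabel,
      Set clw (Var curY) (Plus (clw $ curY) (clw $ curV))]"

abbreviation (input) contract_test where
  "contract_test \<equiv> Conj (Neg (Pos (Cell centred (label $ curV))))
     (Neg (Less (clw $ curV) (Cell thr (label $ curV))))"

abbreviation (input) contract_body where
  "contract_body \<equiv> When (Less (Var ctrR) (Var numO)) (block
     [Let curV (Cell order (Minus (Var numO) (Plus (Var ctrR) (Const 1)))),
      If contract_test contract_mark (When (Neg (Eq (Cell root (label $ curV)) (Var curV))) contract_merge)])"

text \<open>After the contraction only two clusters can remain in a part, that of the centre and
  that of the root. The latter, everything outside the centre's subtree, becomes one single
  piece.\<close>

abbreviation (input) contract_pids where
  "contract_pids \<equiv> For ctrV numV (When (Conj (Pos (Cell finished (label $ ctrV)))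
     (Neg (Eq (top $ ctrV) (Cell centre (label $ ctrV)))))
     (Set pid (Var ctrV) (top $ ctrV)))"

definition Contract :: prog where
  "Contract = block
    [contract_init,
     For ctrI numK (Set centred (Var ctrI) (Const 0)),
     For ctrR numV contract_body,
     contract_pids]"

context thresholds
begin

definition cluster :: "(nat \<Rightarrow> nat) \<Rightarrow> nat \<Rightarrow> nat set" where
  "cluster tp z = {u. u < n \<and> tp u = z}"

definition group :: "(nat \<Rightarrow> nat) \<Rightarrow> (nat \<Rightarrow> nat) \<Rightarrow> nat \<Rightarrow> nat set" where
  "group tp pc u = {u'. u' < n \<and> tp u' = tp u \<and> pc u' = pc u}"

lemma finite_cluster [simp]: "finite (cluster tp z)"
  by (simp add: cluster_def)

text \<open>The state in which the first \<open>r\<close> vertices of \<open>ord\<close> are still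
  to be processed; \<open>tp\<close>, \<open>pc\<close>, \<open>sw\<close>, \<open>hc\<close>,
  \<open>cen\<close> stand for \<open>top\<close>, \<open>pid\<close>, \<open>clw\<close>,
  \<open>centred\<close>, \<open>centre\<close>. A \<open>group\<close> is a former cluster merged
  into its present top. Light groups are claimed only while a part has no centre, or at the centre
  itself: merges after the choice of the centre may be heavy.\<close>

definition contracted :: "(nat \<Rightarrow> nat) \<Rightarrow> nat set \<Rightarrow> (nat \<Rightarrow> nat) \<Rightarrow> (nat \<Rightarrow> nat) \<Rightarrow> nat \<Rightarrow>
    (nat \<Rightarrow> nat) \<Rightarrow> (nat \<Rightarrow> nat) \<Rightarrow> (nat \<Rightarrow> nat) \<Rightarrow> (nat \<Rightarrow> nat) \<Rightarrow> (nat \<Rightarrow> nat) \<Rightarrow> bool" where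
  "contracted L D ord rt r tp pc sw hc cen \<longleftrightarrow>
     (\<forall>v<n. L v \<notin> D \<longrightarrow> tp v = v \<and> pc v = v) \<and>
     (\<forall>v<n. L v \<in> D \<longrightarrow> tp v < n \<and> L (tp v) = L v \<and> tp (tp v) = tp v \<and> pc (tp v) = tp v \<and>
        pc v < n \<and> tp (pc v) = tp v) \<and>
     (\<forall>v<n. L v \<in> D \<longrightarrow> (tp v \<in> ord ` {..<r} \<or> tp v = rt (L v) \<or> 0 < hc (L v) \<and> tp v = cen (L v))) \<and>
     (\<forall>z\<in>ord ` {..<r}. tp z = z) \<and>
     (\<forall>z<n. L z \<in> D \<longrightarrow> tp z = z \<longrightarrow> connected (cluster tp z) \<and> sw z = weight (cluster tp z)) \<and>
     (\<forall>i\<in>D. hc i = 0 \<longrightarrow> rt i \<in> ord ` {..<r}) \<and>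
     (\<forall>i\<in>D. 0 < hc i \<longrightarrow> cen i \<in> part L i \<and> cen i \<notin> ord ` {..<r} \<and> tp (cen i) = cen i \<and> a i \<le> sw (cen i)) \<and>
     (\<forall>i\<in>D. 0 < hc i \<longrightarrow> cen i \<noteq> rt i \<longrightarrow> (\<exists>y<n. L y = i \<and> adj y (cen i) \<and> tp y \<noteq> cen i)) \<and>
     (\<forall>u<n. L u \<in> D \<longrightarrow> tp u \<noteq> u \<longrightarrow> hc (L u) = 0 \<or> tp u = cen (L u) \<longrightarrow>
        pc u \<noteq> tp u \<and> connected (group tp pc u) \<and> weight (group tp pc u) < a (L u) \<and>
        (\<exists>x\<in>group tp pc u. adj x (tp u)))"

lemmas contractedD =
  contracted_def[THEN iffD1, THEN conjunct1, rule_format]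
  contracted_def[THEN iffD1, THEN conjunct2, THEN conjunct1, rule_format]
  contracted_def[THEN iffD1, THEN conjunct2, THEN conjunct2, THEN conjunct1, rule_format]
  contracted_def[THEN iffD1, THEN conjunct2, THEN conjunct2, THEN conjunct2, THEN conjunct1, rule_format]
  contracted_def[THEN iffD1, THEN conjunct2, THEN conjunct2, THEN conjunct2, THEN conjunct2, THEN conjunct1, rule_format]
  contracted_def[THEN iffD1, THEN conjunct2, THEN conjunct2, THEN conjunct2, THEN conjunct2, THEN conjunct2, THEN conjunct1, rule_format]
  contracted_def[THEN iffD1, THEN conjunct2, THEN conjunct2, THEN conjunct2, THEN conjunct2, THEN conjunct2, THEN conjunct2, THEN conjunct1, rule_format]
  contracted_def[THEN iffD1, THEN conjunct2, THEN conjunct2, THEN conjunct2, THEN conjunct2, THEN conjunct2, THEN conjunct2, THEN conjunct2, THEN conjunct1, rule_format]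
  contracted_def[THEN iffD1, THEN conjunct2, THEN conjunct2, THEN conjunct2, THEN conjunct2, THEN conjunct2, THEN conjunct2, THEN conjunct2, THEN conjunct2, rule_format]

context
  fixes L D rc par ord c rt
  assumes f: "forest L D rc par ord c rt" and all: "ord ` {..<c} = {v. v < n \<and> L v \<in> D}"
    and heavy: "\<forall>i\<in>D. a i \<le> weight (part L i)"
begin

lemma ordD:
  assumes "r < c"
  shows "ord r < n" "L (ord r) \<in> D" "j < r \<Longrightarrow> ord j \<noteq> ord r"
    "\<exists>j'\<le>r. ord j' = rt (L (ord r))"
    "ord r \<noteq> rt (L (ord r)) \<Longrightarrow> \<exists>j'<r. par (ord r) = ord j' \<and> adj (ord j') (ord r) \<and> L (ord j') = L (ord r)"
proof -
  have inj: "inj_on ord {..<c}" using f by (simp add: forest_def)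
  have A: "ord r < n \<and> L (ord r) \<in> D \<and> (\<exists>j'\<le>r. ord j' = rt (L (ord r))) \<and>
        (ord r = rt (L (ord r)) \<or>
         (\<exists>j'<r. par (ord r) = ord j' \<and> adj (ord j') (ord r) \<and> L (ord j') = L (ord r)))"
    by (rule forest_def[THEN iffD1, THEN conjunct2, THEN conjunct1, rule_format, OF f assms])
  show "ord r < n" "L (ord r) \<in> D" "\<exists>j'\<le>r. ord j' = rt (L (ord r))" using A by simp_all
  show "ord r \<noteq> rt (L (ord r)) \<Longrightarrow> \<exists>j'<r. par (ord r) = ord j' \<and> adj (ord j') (ord r) \<and> L (ord j') = L (ord r)"
    using A by simp
  show "j < r \<Longrightarrow> ord j \<noteq> ord r" using inj_onD[OF inj, of j r] assms by auto
qed

lemma contracted_start: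
  assumes tp: "\<forall>v<n. tp v = v \<and> pc v = v \<and> sw v = wt v" and hc: "\<forall>i<k. hc i = 0" and D: "D \<subseteq> {..<k}"
  shows "contracted L D ord rt c tp pc sw hc cen"
proof -
  have cl: "cluster tp z = {z}" if "z < n" for z using tp that by (auto simp: cluster_def)
  have id: "tp v = v" "pc v = v" "sw v = wt v" if "v < n" for v using tp that by auto
  have rt: "rt i < n \<and> L (rt i) \<in> D" if "i \<in> D" for i using f that by (auto simp: forest_def part_def)
  have hc0: "hc i = 0" if "i \<in> D" for i using hc D that by auto
  have "tp z = z" if "z \<in> ord ` {..<c}" for z using that all id by auto
  then show ?thesis
    unfolding contracted_def
    by (intro conjI allI impI ballI; simp add: id cl conn_singleton hc0 all rt)
qed

text \<open>Since \<open>v\<close> was not marked, either its cluster is light and forms a valid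
  group at the parent, or its part already has a centre. In the second case \<open>y\<close> is not
  that centre, since \<open>y\<close> is still unprocessed and the centre is not, so nothing is
  claimed about the new group.\<close>

lemma contracted_merge:
  assumes inv: "contracted L D ord rt (Suc r) tp pc sw hc cen" and r: "r < c"
    and v: "v = ord r" "v \<noteq> rt (L v)" "\<not> (hc (L v) = 0 \<and> a (L v) \<le> sw v)" and y: "y = par v"
    and tp': "\<forall>u<n. tp' u = (if tp u = v then y else tp u) \<and> pc' u = (if tp u = v then v else pc u)"
    and sw': "sw' = sw(y := sw y + sw v)"
  shows "contracted L D ord rt r tp' pc' sw' hc cen"
proof -
  note o = ordD[OF r, folded v(1)]
  obtain j' where j': "j' < r" "y = ord j'" "adj y v" "L y = L v" using o(5) v(2) y by auto
  have vn: "v < n" "L v \<in> D" using o by auto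
  have yn: "y < n" "y \<noteq> v" using j' o(3) adj_bound by auto
  have yr: "y \<in> ord ` {..<r}" using j' by auto
  have im: "ord ` {..<Suc r} = insert v (ord ` {..<r})" by (auto simp: lessThan_Suc v(1))
  have vr: "v \<notin> ord ` {..<r}" using o(3) by auto
  note c1 = contractedD(1)[OF inv] and c2 = contractedD(2)[OF inv] and c2' = contractedD(3)[OF inv]
    and c3 = contractedD(4)[OF inv] and c4 = contractedD(5)[OF inv] and c5 = contractedD(6)[OF inv]
    and c6 = contractedD(7)[OF inv] and c8 = contractedD(8)[OF inv] and c7 = contractedD(9)[OF inv]
  have tv: "tp v = v" and ty: "tp y = y" using c3 yr by (auto simp: im)
  have py: "pc y = y" using c2[OF yn(1)] vn j' ty by metis
  have tpu: "tp' u = (if tp u = v then y else tp u)" "pc' u = (if tp u = v then v else pc u)" if "u < n" for u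
    using tp' that by auto
  have cly: "cluster tp' y = cluster tp y \<union> cluster tp v"
    using yn ty tpu by (auto simp: cluster_def split: if_splits)
  have clz: "cluster tp' z = cluster tp z" if "z \<noteq> y" "z \<noteq> v" for z
    using that tpu by (auto simp: cluster_def split: if_splits)
  have cv: "connected (cluster tp v)" "sw v = weight (cluster tp v)" using c4[OF vn tv] by auto
  have cy: "connected (cluster tp y)" "sw y = weight (cluster tp y)" using c4[OF yn(1) _ ty] vn j' by auto
  have mem: "v \<in> cluster tp v" "y \<in> cluster tp y" using vn yn tv ty by (auto simp: cluster_def)
  have ncen: "y \<noteq> cen (L v)" if "0 < hc (L v)"
  proof
    assume "y = cen (L v)"
    then show False using c6[OF vn(2) that] yr by (simp add: im)
  qed
  show ?thesis
    unfolding contracted_def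
  proof (intro conjI allI impI ballI)
    fix u assume u: "u < n" "L u \<notin> D"
    then show "tp' u = u" "pc' u = u" using c1[OF u] vn tpu[of u] by auto
  next
    fix u assume u: "u < n" "L u \<in> D"
    note c = c2[OF u]
    show "tp' u < n" using c yn tpu[OF u(1)] by auto
    show "L (tp' u) = L u" using c j' tpu[OF u(1)] by auto
    show "tp' (tp' u) = tp' u" using c tpu[OF u(1)] tpu[OF yn(1)] tpu[of "tp u"] ty yn by auto
    show "pc' (tp' u) = tp' u" using c tpu[OF u(1)] tpu[OF yn(1)] tpu[of "tp u"] ty yn py by auto
    show "pc' u < n" using c tpu[OF u(1)] vn by auto
    show "tp' (pc' u) = tp' u" using c tpu[OF u(1)] tpu[OF vn(1)] tpu[of "pc u"] tv by auto
  next
    fix u assume u: "u < n" "L u \<in> D"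
    show "tp' u \<in> ord ` {..<r} \<or> tp' u = rt (L u) \<or> 0 < hc (L u) \<and> tp' u = cen (L u)"
      using c2'[OF u] yr tpu[OF u(1)] by (auto simp: im)
  next
    fix z assume z: "z \<in> ord ` {..<r}"
    then have "z < n" using r f by (auto simp: forest_def)
    then show "tp' z = z" using z c3[of z] vr tpu[of z] by (auto simp: im)
  next
    fix z assume z: "z < n" "L z \<in> D" "tp' z = z"
    have zv: "tp z = z" "z \<noteq> v" using z tpu[OF z(1)] ty yn by (auto split: if_splits)
    show "connected (cluster tp' z)"
    proof (cases "z = y")
      case True
      show ?thesis unfolding True cly by (rule conn_Un[OF symp_adj cy(1) cv(1) mem(2,1) j'(3)])
    next
      case False then show ?thesis using clz c4 z zv by auto
    qed
    show "sw' z = weight (cluster tp' z)"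
    proof (cases "z = y")
      case True
      have "weight (cluster tp y \<union> cluster tp v) = weight (cluster tp y) + weight (cluster tp v)"
        by (rule sum.union_disjoint) (use yn in \<open>auto simp: cluster_def\<close>)
      then show ?thesis using True cv cy cly sw' by simp
    next
      case False then show ?thesis using clz c4 z zv sw' by auto
    qed
  next
    fix i assume i: "i \<in> D" "hc i = 0"
    have "L (rt i) = i" using f i by (auto simp: forest_def part_def)
    then show "rt i \<in> ord ` {..<r}" using c5[OF i] v(2) by (auto simp: im)
  next
    fix i assume i: "i \<in> D" "0 < hc i"
    note c = c6[OF i]
    show "cen i \<in> part L i" "cen i \<notin> ord ` {..<r}" using c by (auto simp: im)
    have "cen i \<noteq> y" "cen i \<noteq> v" using c yr by (auto simp: im)
    then show "tp' (cen i) = cen i" "a i \<le> sw' (cen i)"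
      using c tpu[of "cen i"] sw' by (auto simp: part_def)
  next
    fix i assume i: "i \<in> D" "0 < hc i" "cen i \<noteq> rt i"
    have "cen i \<noteq> y" using c6[OF i(1,2)] yr by (auto simp: im)
    then show "\<exists>y<n. L y = i \<and> adj y (cen i) \<and> tp' y \<noteq> cen i"
      using c8[OF i] tpu by metis
  next
    fix u assume u: "u < n" "L u \<in> D" "tp' u \<noteq> u" "hc (L u) = 0 \<or> tp' u = cen (L u)"
    have "pc' u \<noteq> tp' u \<and> connected (group tp' pc' u) \<and> weight (group tp' pc' u) < a (L u) \<and>
      (\<exists>x\<in>group tp' pc' u. adj x (tp' u))"
    proof (cases "tp u = v")
      case True
      then have tu: "tp' u = y" "pc' u = v" and Lu: "L u = L v" using tpu[OF u(1)] c2[OF u(1,2)] by auto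
      have hc: "hc (L v) = 0" using u(4) ncen tu Lu by auto
      have "group tp' pc' u = cluster tp v"
      proof (intro equalityI subsetI)
        fix w assume "w \<in> group tp' pc' u"
        then have w: "w < n" "tp' w = y" "pc' w = v" by (auto simp: group_def tu)
        show "w \<in> cluster tp v"
        proof (rule ccontr)
          assume "w \<notin> cluster tp v"
          then have "tp w \<noteq> v" using w by (simp add: cluster_def)
          then have "tp w = y" "pc w = v" using w tpu[OF w(1)] by auto
          \<comment> \<open>Every vertex shares its top with its piece number, so piece number
            \<open>v\<close> would force the top \<open>v\<close>.\<close>
          then show False using c1[OF w(1)] c2[OF w(1)] tv yn by (cases "L w \<in> D") auto
        qed
      next
        fix w assume "w \<in> cluster tp v"
        then show "w \<in> group tp' pc' u" using tpu[of w] by (auto simp: group_def tu cluster_def)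
      qed
      then show ?thesis
        using tu yn cv v(3) hc Lu mem sympD[OF symp_adj j'(3)] by auto
    next
      case False
      then have tu: "tp' u = tp u" "pc' u = pc u" using tpu[OF u(1)] by auto
      have "group tp' pc' u = group tp pc u"
      proof -
        have "tp' w = tp u \<and> pc' w = pc u \<longleftrightarrow> tp w = tp u \<and> pc w = pc u" if w: "w < n" for w
          using tpu[OF w] False c2[OF u(1,2)] tv ty yn by auto
        then show ?thesis by (auto simp: group_def tu)
      qed
      then show ?thesis using c7[OF u(1,2)] u(3,4) tu by auto
    qed
    then show "pc' u \<noteq> tp' u" "connected (group tp' pc' u)" "weight (group tp' pc' u) < a (L u)"
      "\<exists>x\<in>group tp' pc' u. adj x (tp' u)" by auto
  qed
qed

text \<open>The groups already merged into \<open>v\<close> are light, which makes \<open>v\<close>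
  a lowest heavy vertex. Unless \<open>v\<close> is a root, its tree parent precedes it in
  \<open>ord\<close> and lies in another cluster; it is the witness that the rest of the part
  touches the centre.\<close>

lemma contracted_centre:
  assumes inv: "contracted L D ord rt (Suc r) tp pc sw hc cen" and r: "r < c"
    and v: "v = ord r" "hc (L v) = 0" "a (L v) \<le> sw v"
  shows "contracted L D ord rt r tp pc sw (hc(L v := 1)) (cen(L v := v))"
proof -
  note o = ordD[OF r, folded v(1)]
  have im: "ord ` {..<Suc r} = insert v (ord ` {..<r})" by (auto simp: lessThan_Suc v(1))
  have vr: "v \<notin> ord ` {..<r}" using o(3) by auto
  have Lrt: "L (rt i) = i" if "i \<in> D" for i using f that by (auto simp: forest_def part_def)
  have vp: "v \<in> part L (L v)" using o by (simp add: part_def)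
  have tv: "tp v = v" using inv by (auto simp: contracted_def im)
  note c1 = contractedD(1)[OF inv] and c2 = contractedD(2)[OF inv] and c2' = contractedD(3)[OF inv]
    and c3 = contractedD(4)[OF inv] and c4 = contractedD(5)[OF inv] and c5 = contractedD(6)[OF inv]
    and c6 = contractedD(7)[OF inv] and c8 = contractedD(8)[OF inv] and c7 = contractedD(9)[OF inv]
  let ?hc = "hc(L v := 1)" and ?cen = "cen(L v := v)"
  have n2: "tp u \<in> ord ` {..<r} \<or> tp u = rt (L u) \<or> 0 < ?hc (L u) \<and> tp u = ?cen (L u)"
    if "u < n" "L u \<in> D" for u
  proof (cases "tp u = v")
    case True
    then have "L u = L v" using c2[OF that] by auto
    then show ?thesis using True by simp
  next
    case False
    then have "tp u \<in> ord ` {..<r} \<or> tp u = rt (L u) \<or> 0 < hc (L u) \<and> tp u = cen (L u)"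
      using c2'[OF that] by (auto simp: im)
    then show ?thesis using v(2) by (cases "L u = L v") auto
  qed
  have n5: "rt i \<in> ord ` {..<r}" if "i \<in> D" "?hc i = 0" for i
    using c5[of i] that Lrt[of i] by (auto simp: im split: if_splits)
  have n6: "?cen i \<in> part L i \<and> ?cen i \<notin> ord ` {..<r} \<and> tp (?cen i) = ?cen i \<and> a i \<le> sw (?cen i)"
    if "i \<in> D" "0 < ?hc i" for i
    using c6[of i] that vp vr tv v(3) by (cases "i = L v") (auto simp: im)
  have n7: "hc (L u) = 0 \<or> tp u = cen (L u)" if "?hc (L u) = 0 \<or> tp u = ?cen (L u)" for u
    using that v(2) by (auto split: if_splits)
  have n8: "\<exists>y<n. L y = i \<and> adj y (?cen i) \<and> tp y \<noteq> ?cen i" if i: "i \<in> D" "0 < ?hc i" "?cen i \<noteq> rt i" for i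
  proof (cases "i = L v")
    case True
    then obtain j' where j': "j' < r" "adj (ord j') v" "L (ord j') = L v" using o(5) i(3) by auto
    then have "tp (ord j') = ord j'" "ord j' \<noteq> v" using c3 j' vr by (auto simp: im)
    then show ?thesis using True j' adj_bound[of "ord j'" v] by (intro exI[of _ "ord j'"]) auto
  next
    case False
    then show ?thesis using c8[of i] i by simp
  qed
  show ?thesis
    unfolding contracted_def
    by (intro conjI; (intro allI impI n2; assumption | intro ballI impI n5; assumption
        | intro ballI impI n6; assumption | intro ballI impI n8; assumption | intro allI impI c7 n7; assumption
        | use contractedD(1,2,4,5)[OF inv] im in simp))
qed

text \<open>An unmarked root has a centre in its part: otherwise the whole part would have been
  merged into the root, whose cluster would then be as heavy as the part and would have been
  marked.\<close>

lemma contracted_root: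
  assumes inv: "contracted L D ord rt (Suc r) tp pc sw hc cen" and r: "r < c"
    and v: "v = ord r" "v = rt (L v)" "\<not> (hc (L v) = 0 \<and> a (L v) \<le> sw v)"
  shows "contracted L D ord rt r tp pc sw hc cen"
proof -
  note o = ordD[OF r, folded v(1)]
  have im: "ord ` {..<Suc r} = insert v (ord ` {..<r})" by (auto simp: lessThan_Suc v(1))
  have Lrt: "L (rt i) = i" if "i \<in> D" for i using f that by (auto simp: forest_def part_def)
  note c2 = contractedD(2)[OF inv] and c2' = contractedD(3)[OF inv] and c5 = contractedD(6)[OF inv]
  have hc: "hc (L v) \<noteq> 0"
  proof
    assume h: "hc (L v) = 0"
    have tu: "tp u = v" if u: "u < n" "L u = L v" for u
    proof -
      have t: "L (tp u) = L v" "tp u \<in> ord ` {..<Suc r} \<or> tp u = v"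
        using c2[of u] c2'[of u] u o h v(2) by auto
      show ?thesis
      proof (rule ccontr)
        assume "tp u \<noteq> v"
        then obtain j where j: "j < r" "tp u = ord j" using t by (auto simp: im)
        \<comment> \<open>The root precedes all other entries of its part, so no unprocessed top of
          the part can be left before \<open>v\<close>.\<close>
        then obtain j' where "j' \<le> j" "ord j' = rt (L v)" using ordD(4)[of j] r t by auto
        then show False using o(3)[of j'] j v(2) by simp
      qed
    qed
    have "cluster tp v = part L (L v)"
    proof (intro equalityI subsetI)
      fix u assume u: "u \<in> cluster tp v"
      then have "L u \<in> D" using inv o by (auto simp: contracted_def cluster_def)
      then show "u \<in> part L (L v)" using c2[of u] u by (auto simp: cluster_def part_def)
    qed (use tu in \<open>auto simp: cluster_def part_def\<close>)
    moreover have "sw v = weight (cluster tp v)"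
      using inv o by (auto simp: contracted_def im)
    ultimately show False using bspec[OF heavy o(2)] v(3) h by simp
  qed
  have n5: "rt i \<in> ord ` {..<r}" if "i \<in> D" "hc i = 0" for i
  proof -
    have "rt i \<noteq> v" using hc that Lrt[of i] by auto
    then show ?thesis using c5[OF that] by (auto simp: im)
  qed
  have n2: "tp u \<in> ord ` {..<r} \<or> tp u = rt (L u) \<or> 0 < hc (L u) \<and> tp u = cen (L u)"
    if "u < n" "L u \<in> D" for u
    using c2'[OF that] c2[OF that] v(2) by (auto simp: im)
  have n25: "\<forall>u<n. L u \<in> D \<longrightarrow> tp u \<in> ord ` {..<r} \<or> tp u = rt (L u) \<or> 0 < hc (L u) \<and> tp u = cen (L u)"
    "\<forall>i\<in>D. hc i = 0 \<longrightarrow> rt i \<in> ord ` {..<r}"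
    using n2 n5 by blast+
  show ?thesis
    using inv n25 unfolding contracted_def im
    by (elim conjE, intro conjI) (assumption | blast)+
qed

context
  fixes tp pc sw hc cen
  assumes inv: "contracted L D ord rt 0 tp pc sw hc cen"
begin

text \<open>With nothing left to process, each top is the root or the centre. What lies outside the
  centre's cluster is thus empty or exactly the root's cluster; \<open>u\<close> witnesses the
  second case.\<close>

lemma centre_cluster:
  assumes i: "i \<in> D"
  shows "cen i \<in> part L i" "cluster tp (cen i) \<subseteq> part L i" "connected (cluster tp (cen i))"
    "sw (cen i) = weight (cluster tp (cen i))" "a i \<le> sw (cen i)"
    "u \<in> part L i - cluster tp (cen i) \<Longrightarrow> part L i - cluster tp (cen i) = cluster tp (tp u)"
    "u \<in> part L i - cluster tp (cen i) \<Longrightarrow> connected (cluster tp (tp u))"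
proof -
  have hc: "0 < hc i" using inv i by (auto simp: contracted_def)
  have c: "cen i \<in> part L i" "tp (cen i) = cen i" "a i \<le> sw (cen i)"
    using inv i hc by (auto simp: contracted_def)
  have ci: "cen i < n" "L (cen i) = i" using c by (auto simp: part_def)
  have c2: "tp u < n" "L (tp u) = L u" "tp (tp u) = tp u" "tp u = rt i \<or> tp u = cen i" if "u < n" "L u = i" for u
    using inv i that by (auto simp: contracted_def)
  have in_part: "L u = L z" if "u < n" "tp u = z" "L z \<in> D" for u z
    using inv that unfolding contracted_def by (cases "L u \<in> D") auto
  show "cen i \<in> part L i" "a i \<le> sw (cen i)" using c by auto
  show "connected (cluster tp (cen i))" "sw (cen i) = weight (cluster tp (cen i))"
    using inv c ci i by (auto simp: contracted_def)
  show "cluster tp (cen i) \<subseteq> part L i"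
    using in_part ci i by (auto simp: cluster_def part_def)
  assume u: "u \<in> part L i - cluster tp (cen i)"
  then have un: "u < n" "L u = i" "tp u = rt i" "rt i \<noteq> cen i"
    using c2[of u] by (auto simp: part_def cluster_def)
  have t: "tp u < n" "L (tp u) = i" "tp (tp u) = tp u" using c2[OF un(1,2)] un(2) by auto
  show "connected (cluster tp (tp u))" using inv t i unfolding contracted_def by blast
  show "part L i - cluster tp (cen i) = cluster tp (tp u)"
  proof (intro equalityI subsetI)
    fix w assume "w \<in> part L i - cluster tp (cen i)"
    then show "w \<in> cluster tp (tp u)" using c2[of w] un by (auto simp: part_def cluster_def)
  next
    fix w assume "w \<in> cluster tp (tp u)"
    then show "w \<in> part L i - cluster tp (cen i)"
      using in_part[of w "tp u"] t i un by (auto simp: part_def cluster_def)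
  qed
qed

text \<open>There are two kinds of pieces: groups below the centre, light by the choice of the
  centre, and the rest of the part, light because no split was possible and attached through the
  tree parent of the centre.\<close>

lemma contracted_pieces:
  assumes light: "\<And>i. i \<in> D \<Longrightarrow> weight (part L i - cluster tp (cen i)) < a i"
    and conn: "\<And>i. i \<in> D \<Longrightarrow> connected (part L i)"
    and pc': "\<forall>u<n. pc' u = (if L u \<in> D \<and> tp u \<noteq> cen (L u) then tp u else pc u)"
  shows "pieces L D cen pc'"
proof -
  have c2: "tp u < n" "L (tp u) = L u" "tp (tp u) = tp u" "pc (tp u) = tp u" "pc u < n" "tp (pc u) = tp u"
    if "u < n" "L u \<in> D" for u
    using inv that by (auto simp: contracted_def)
  have c1: "tp u = u" "pc u = u" if "u < n" "L u \<notin> D" for u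
    using inv that by (auto simp: contracted_def)
  \<comment> \<open>A piece number stays inside the cluster of its vertex, so a piece cannot
    straddle two clusters or two parts.\<close>
  have tpc: "tp (pc' u) = tp u \<and> pc' u < n" if "u < n" for u
    using c1[OF that] c2[OF that] that pc' by (cases "L u \<in> D") auto
  have LL: "L u = L v" if "u < n" "v < n" "tp u = tp v" for u v
  proof -
    have "L (tp u) = L u" if "u < n" for u
      using c1[OF that] c2[OF that] by (cases "L u \<in> D") simp_all
    from this[OF that(1)] this[OF that(2)] that(3) show ?thesis by simp
  qed
  have pl: "tp u = tp v" if "u \<in> piece pc' v" "v < n" for u v
    using tpc[of u] tpc[of v] that by (auto simp: piece_def)
  show ?thesis
    unfolding pieces_def
  proof (intro conjI ballI allI impI)
    fix i assume i: "i \<in> D"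
    note cc = centre_cluster[OF i]
    show "cen i \<in> part L i" by (rule cc(1))
    have tc: "tp (cen i) = cen i" "pc (cen i) = cen i"
      using inv i cc(1) c2(4)[of "cen i"] by (auto simp: contracted_def part_def)
    fix v assume v: "v \<in> part L i - {cen i}"
    then have vn: "v < n" "L v = i" "v \<noteq> cen i" by (auto simp: part_def)
    have sub: "piece pc' v \<subseteq> part L i"
    proof
      fix u assume u: "u \<in> piece pc' v"
      then have "u < n" by (simp add: piece_def)
      then show "u \<in> part L i" using LL[OF _ vn(1) pl[OF u vn(1)]] vn by (simp add: part_def)
    qed
    show "piece pc' v \<subseteq> part L i - {cen i}"
    proof -
      have "cen i \<notin> piece pc' v"
      proof
        assume *: "cen i \<in> piece pc' v"
        then have "tp v = cen i" using pl[OF * vn(1)] tc by simp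
        moreover have "pc' v = pc' (cen i)" using * by (simp add: piece_def)
        ultimately have "pc v = cen i" using pc' vn cc(1) tc by (auto simp: part_def)
        then show False using contractedD(9)[OF inv vn(1)] vn i \<open>tp v = cen i\<close> by auto
      qed
      then show ?thesis using sub by auto
    qed
    have "connected (piece pc' v) \<and> weight (piece pc' v) < a i \<and> (\<exists>x\<in>piece pc' v. adj x (cen i))"
    proof (cases "tp v = cen i")
      case True
      then have pv: "pc' v = pc v" using pc' vn by simp
      have "piece pc' v = group tp pc v"
      proof (intro equalityI subsetI)
        fix u assume u: "u \<in> piece pc' v"
        then show "u \<in> group tp pc v"
          using pl[OF u vn(1)] LL[of u v] vn True pc' pv by (auto simp: piece_def group_def)
      next
        fix u assume u: "u \<in> group tp pc v"
        then have "L u = i" using LL[of u v] vn by (auto simp: group_def)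
        then show "u \<in> piece pc' v"
          using u True pc' pv by (auto simp: piece_def group_def)
      qed
      moreover have "tp v \<noteq> v" using True vn by auto
      ultimately show ?thesis
        using contractedD(9)[OF inv vn(1)] vn i True by auto
    next
      case False
      then have pv: "pc' v = tp v" using pc' vn i by simp
      have vR: "v \<in> part L i - cluster tp (cen i)" using False v by (auto simp: cluster_def)
      have eq: "piece pc' v = cluster tp (tp v)"
      proof (intro equalityI subsetI)
        fix u assume u: "u \<in> piece pc' v"
        then show "u \<in> cluster tp (tp v)"
          using pl[OF u vn(1)] by (auto simp: piece_def cluster_def)
      next
        fix u assume u: "u \<in> cluster tp (tp v)"
        then have "L u = i" using LL[of u v] vn by (auto simp: cluster_def)
        then show "u \<in> piece pc' v"
          using u False pc' pv i by (auto simp: piece_def cluster_def)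
      qed
      let ?S = "cluster tp (cen i)"
      have hc: "0 < hc i" using inv i by (auto simp: contracted_def)
      have "tp v = rt i \<or> tp v = cen i" using inv vn i by (auto simp: contracted_def)
      then have "cen i \<noteq> rt i" using False by auto
      then obtain y where y: "y < n" "L y = i" "adj y (cen i)" "tp y \<noteq> cen i"
        using contractedD(8)[OF inv i hc] by blast
      then have "y \<in> part L i - ?S" by (auto simp: part_def cluster_def)
      then have "y \<in> piece pc' v" using eq cc(6)[OF vR] by simp
      then show ?thesis
        using eq cc(6,7)[OF vR] light[OF i] y by auto
    qed
    then show "connected (piece pc' v)" "weight (piece pc' v) < a i" "\<exists>x\<in>piece pc' v. adj x (cen i)"
      by auto
  next
    fix v assume v: "v < n" "L v \<notin> D"
    have "u = v" if u: "u \<in> piece pc' v" for u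
      using pl[OF u v(1)] LL[of u v] u v c1 by (auto simp: piece_def)
    then show "piece pc' v = {v}" using v by (auto simp: piece_def)
  qed
qed

end

end

end

section \<open>Splitting a finished part at its centre\<close>

abbreviation (input) split_test where
  "split_test \<equiv> When (Conj (Neg (Pos (Var evt))) (Conj (Pos (finished $ ctrI))
     (Neg (Less (Minus (pwgt $ ctrI) (Cell clw (centre $ ctrI))) (thr $ ctrI)))))
     (block [Let evt (Const 1), Let sel (centre $ ctrI)])"

abbreviation (input) split_mark where
  "split_mark \<equiv> If (Eq (top $ ctrV) (Var sel))
     (Set inX (Var ctrV) (Const 1)) (Set inX (Var ctrV) (Const 0))"

definition Split :: prog where
  "Split = block
    [Let evt (Const 0),
     For ctrI numK split_test,
     For ctrV numV split_mark,
     Let newlab (Var numK)]"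

context thresholds
begin

lemma Inv_cong:
  assumes "\<forall>v<n. L v = L' v"
  shows "Inv L D \<longleftrightarrow> Inv L' D"
proof -
  have "part L = part L'" using assms by (auto simp: part_def fun_eq_iff)
  then show ?thesis using assms by (simp add: Inv_def)
qed

text \<open>The obtained \<open>pc\<close> is the array \<open>pid\<close> before
  \<open>contract_pids\<close> overwrites the entries outside the centres' clusters; the invariant
  speaks of this earlier array.\<close>

lemma run_Contract:
  assumes s: "base s" and L: "\<forall>v<n. s label v \<le> k" and d: "s finished k = 0"
    and f: "forest (s label) (fin k (s finished)) rc par (s order) (s numO 0) (s root)"
    and par: "par = s parent"
    and all: "s order ` {..<s numO 0} = {v. v < n \<and> s label v \<in> fin k (s finished)}"
    and heavy: "\<forall>i\<in>fin k (s finished). a i \<le> weight (part (s label) i)"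
  defines "t \<equiv> run Contract s"
  obtains pc where "contracted (s label) (fin k (s finished)) (s order) (s root) 0 (t top) pc (t clw) (t centred) (t centre)"
    "\<forall>u<n. t pid u = (if s label u \<in> fin k (s finished) \<and> t top u \<noteq> t centre (s label u) then t top u else pc u)"
proof -
  define D where "D = fin k (s finished)"
  let ?p2 = "For ctrI numK (Set centred (Var ctrI) (Const 0))"
  let ?p3 = "For ctrR numV contract_body"
  define s1 where "s1 = run contract_init s"
  define s2 where "s2 = run ?p2 s1"
  define s3 where "s3 = run ?p3 s2"
  have t: "t = run contract_pids s3" by (simp add: t_def Contract_def s1_def s2_def s3_def)
  have "\<forall>v<s numV 0. s1 top v = v \<and> s1 pid v = v \<and> s1 clw v = s wgt v" unfolding s1_def
    by (rule run_For[where I = "\<lambda>j s'. \<forall>v<j. s' top v = v \<and> s' pid v = v \<and> s' clw v = s wgt v"])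
      (auto simp: less_Suc_eq)
  then have s1: "\<forall>v<n. s1 top v = v \<and> s1 pid v = v \<and> s1 clw v = wt v"
    "\<And>l. l \<notin> {ctrV, top, pid, clw} \<Longrightarrow> s1 l = s l"
    using s run_frame[of _ contract_init s] by (auto simp: s1_def base_def)
  have "\<forall>i<s1 numK 0. s2 centred i = 0" unfolding s2_def
    by (rule run_For[where I = "\<lambda>j s'. \<forall>i<j. s' centred i = 0"]) (auto simp: less_Suc_eq)
  then have s2: "\<forall>i<k. s2 centred i = 0" "\<And>l. l \<notin> {ctrI, centred} \<Longrightarrow> s2 l = s1 l"
    using s s1 run_frame[of _ ?p2 s1] by (auto simp: s2_def base_def)
  define c where "c = s numO 0"
  \<comment> \<open>The truncated \<open>c - j\<close> remains 0 in the idle rounds after all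
    \<open>c\<close> listed vertices are processed.\<close>
  define I where "I = (\<lambda>j (s'::state). contracted (s label) D (s order) (s root) (c - j)
    (s' top) (s' pid) (s' clw) (s' centred) (s' centre))"
  note f' = f[folded D_def, unfolded par, folded c_def] and all' = all[folded D_def, folded c_def]
    and heavy' = heavy[folded D_def]
  have "I (s2 numV 0) s3" unfolding s3_def
  proof (rule run_For, goal_cases)
    show "ctrR \<notin> mods contract_body" by simp
    have "contracted (s label) D (s order) (s root) c (s2 top) (s2 pid) (s2 clw) (s2 centred) (s2 centre)"
      by (rule contracted_start[OF f' all' heavy']) (use s1 s2 in \<open>auto simp: D_def fin_def\<close>)
    then show "I 0 (upd s2 ctrR 0 0)" by (simp add: I_def)
  next
    case (3 j s')
    note j = 3(1-3) and fr = 3(4)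
    have e: "s' label = s label" "s' order = s order" "s' numO 0 = c" "s' thr = a" "s' root = s root"
        "s' parent = s parent" "s' numV 0 = n"
      using fr s s1 s2 by (simp_all add: base_def c_def)
    show ?case
    proof (cases "j < c")
      case False
      then show ?thesis using j(2) e j(3) by (simp add: I_def)
    next
      case True
      define r where "r = c - Suc j"
      define v where "v = s order r"
      have r: "c - j = Suc r" "r < c" using True by (auto simp: r_def)
      have inv: "contracted (s label) D (s order) (s root) (Suc r) (s' top) (s' pid) (s' clw) (s' centred) (s' centre)"
        using j(2) by (simp add: I_def r)
      define s4 where "s4 = upd s' curV 0 v"
      have s4: "s4 curV 0 = v" "\<And>l. l \<noteq> curV \<Longrightarrow> s4 l = s' l" by (simp_all add: s4_def)
      have body: "run contract_body s' = run (If contract_test contract_mark (When (Neg (Eq (Cell root (label $ curV)) (Var curV))) contract_merge)) s4"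
        using True j(3) by (simp add: e s4_def v_def r_def)
      have rI: "I (Suc j) (upd s'' ctrR 0 (Suc j))"
        if "contracted (s label) D (s order) (s root) r (s'' top) (s'' pid) (s'' clw) (s'' centred) (s'' centre)" for s''
        using that by (simp add: I_def r_def)
      show ?thesis
      proof (cases "s' centred (s label v) = 0 \<and> a (s label v) \<le> s' clw v")
        case mark: True
        have "run contract_body s' = run contract_mark s4"
          unfolding body using mark by (simp add: s4 e)
        then have m: "run contract_body s' centred = (s' centred)(s label v := 1)"
          "run contract_body s' centre = (s' centre)(s label v := v)"
          "run contract_body s' top = s' top" "run contract_body s' pid = s' pid" "run contract_body s' clw = s' clw"
          by (simp_all only:) (simp_all add: s4 e fun_upd_def)
        show ?thesis
          by (rule rI, unfold m, rule contracted_centre[OF f' all' heavy' inv r(2) v_def])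
            (use mark in auto)
      next
        case nomark: False
        show ?thesis
        proof (cases "s root (s label v) = v")
          case True
          have m: "run contract_body s' = s4"
            unfolding body using nomark True by (auto simp: s4 e)
          show ?thesis
            by (rule rI, unfold m, simp add: s4)
              (rule contracted_root[OF f' all' heavy' inv r(2) v_def True[symmetric] nomark])
        next
          case False
          define y where "y = s parent v"
          define s5 where "s5 = upd s4 curY 0 y"
          have s5: "s5 curY 0 = y" "s5 curV 0 = v" "\<And>l. l \<notin> {curV, curY} \<Longrightarrow> s5 l = s' l"
            by (simp_all add: s5_def s4)
          define s6 where "s6 = run contract_relabel s5"
          have "run contract_body s' = run contract_merge s4"
            unfolding body using nomark False by (auto simp: s4 e)
          then have m: "run contract_body s' = upd s6 clw (s6 curY 0) (s6 clw (s6 curY 0) + s6 clw (s6 curV 0))"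
            by (simp add: s6_def s5_def y_def s4 e)
          have s6: "s6 l = s5 l" if "l \<notin> {ctrU, top, pid}" for l
            unfolding s6_def by (rule run_frame) (use that in simp)
          define J where "J = (\<lambda>i (s''::state). \<forall>u<n.
             s'' top u = (if u < i \<and> s' top u = v then y else s' top u) \<and>
             s'' pid u = (if u < i \<and> s' top u = v then v else s' pid u))"
          have "J (s5 numV 0) s6" unfolding s6_def
          proof (rule run_For, goal_cases)
            show "J 0 (upd s5 ctrU 0 0)" by (simp add: J_def s5)
          next
            case (3 i s'')
            note i = 3(1-3) and fr = 3(4)
            have e': "s'' curV 0 = v" "s'' curY 0 = y" "i < n" using fr s5 i e by simp_all
            then have "s'' top i = s' top i" using i(2) by (simp add: J_def)
            then show ?case
              using i(2) e' by (auto simp: J_def i(3) less_Suc_eq)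
          qed simp
          then have J: "\<forall>u<n. s6 top u = (if s' top u = v then y else s' top u) \<and>
              s6 pid u = (if s' top u = v then v else s' pid u)"
            by (simp add: J_def s5 e)
          have m2: "run contract_body s' top = s6 top" "run contract_body s' pid = s6 pid"
              "run contract_body s' clw = (s' clw)(y := s' clw y + s' clw v)"
              "run contract_body s' centred = s' centred" "run contract_body s' centre = s' centre"
            unfolding m using s6 s5 by (simp_all add: fun_upd_def)
          show ?thesis
            by (rule rI, unfold m2, rule contracted_merge[OF f' all' heavy' inv r(2) v_def _ nomark y_def])
              (use False J in auto)
        qed
      qed
    qed
  qed
  then have "I n s3" using s s1 s2 by (simp add: base_def)
  moreover have "c \<le> n" using forest_card[OF f'] .
  ultimately have inv: "contracted (s label) D (s order) (s root) 0 (s3 top) (s3 pid) (s3 clw) (s3 centred) (s3 centre)"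
    by (simp add: I_def)
  have s3: "s3 label = s label" "s3 finished = s finished" "s3 numV 0 = n"
    using s s1 s2 run_frame[of _ ?p3 s2] by (auto simp: s3_def base_def)
  define J where "J = (\<lambda>j (s'::state). \<forall>u<n. s' pid u =
    (if u < j \<and> s label u \<in> D \<and> s3 top u \<noteq> s3 centre (s label u) then s3 top u else s3 pid u))"
  have "J (s3 numV 0) t" unfolding t
  proof (rule run_For, goal_cases)
    show "J 0 (upd s3 ctrV 0 0)" by (simp add: J_def)
  next
    case (3 j s')
    note j = 3(1-3) and fr = 3(4)
    have e: "s' label = s label" "s' finished = s finished" "s' top = s3 top" "s' centre = s3 centre" "j < n"
      using fr s3 j by simp_all
    have D: "s label j \<in> D \<longleftrightarrow> 0 < s finished (s label j)"
      unfolding D_def by (rule fin_iff) (use L d e in auto)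
    show ?case
      using j(2) by (auto simp: J_def e D j(3) less_Suc_eq)
  qed simp
  moreover have "t l = s3 l" if "l \<notin> {ctrV, pid}" for l
    unfolding t by (rule run_frame) (use that in simp)
  ultimately show thesis
    using inv s3 by (intro that[of "s3 pid"]) (simp_all add: J_def D_def)
qed

lemma run_Split:
  assumes s: "base s"
  defines "t \<equiv> run Split s" and "D \<equiv> fin k (s finished)"
  shows "t newlab 0 = k"
    and "0 < t evt 0 \<Longrightarrow> \<exists>i\<in>D. a i \<le> s pwgt i - s clw (s centre i) \<and>
      (\<forall>v<n. 0 < t inX v \<longleftrightarrow> s top v = s centre i)"
    and "\<lbrakk>t evt 0 = 0; i \<in> D\<rbrakk> \<Longrightarrow> s pwgt i - s clw (s centre i) < a i"
proof -
  let ?s0 = "upd s evt 0 0"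
  define s1 where "s1 = run (For ctrI numK split_test) ?s0"
  define s2 where "s2 = run (For ctrV numV split_mark) s1"
  have t: "t = upd s2 newlab 0 (s2 numK 0)"
    by (simp add: t_def Split_def s1_def s2_def)
  have s1fr: "s1 l = s l" if "l \<notin> {ctrI, evt, sel}" for l
    using run_frame[of l "For ctrI numK split_test" ?s0] that by (simp add: s1_def)
  have s2fr: "s2 l = s1 l" if "l \<notin> {ctrV, inX}" for l
    using run_frame[of l "For ctrV numV split_mark" s1] that by (simp add: s2_def)
  define I where "I = (\<lambda>j (s'::state). (0 < s' evt 0 \<longrightarrow> (\<exists>i\<in>D. a i \<le> s pwgt i - s clw (s centre i) \<and> s' sel 0 = s centre i)) \<and>
     (s' evt 0 = 0 \<longrightarrow> (\<forall>i<j. 0 < s finished i \<longrightarrow> s pwgt i - s clw (s centre i) < a i)))"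
  have "I (?s0 numK 0) s1" unfolding s1_def
  proof (rule run_For, goal_cases)
    show "I 0 (upd ?s0 ctrI 0 0)" by (simp add: I_def)
  next
    case (3 j s')
    note j = 3(1-3) and fr = 3(4)
    have e: "s' finished = s finished" "s' pwgt = s pwgt" "s' clw = s clw" "s' centre = s centre" "s' thr = a" "j < k"
      using fr s j by (simp_all add: base_def)
    have "\<exists>i\<in>D. a i \<le> s pwgt i - s clw (s centre i) \<and> s centre j = s centre i"
      if "0 < s finished j" "\<not> s pwgt j - s clw (s centre j) < a j"
      using e that by (intro bexI[of _ j]) (auto simp: D_def fin_def)
    then show ?case
      using j(2) by (auto simp: I_def e(1-5) j(3) less_Suc_eq)
  qed simp
  then have I: "I k s1" using s by (simp add: base_def)
  define J where "J = (\<lambda>j (s'::state). \<forall>v<j. 0 < s' inX v \<longleftrightarrow> s top v = s1 sel 0)"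
  have "J (s1 numV 0) s2" unfolding s2_def
  proof (rule run_For, goal_cases)
    show "J 0 (upd s1 ctrV 0 0)" by (simp add: J_def)
  next
    case (3 j s')
    note j = 3(1-3) and fr = 3(4)
    have e: "s' top = s top" "s' sel = s1 sel"
      using fr s1fr by simp_all
    show ?case
      using j(2) by (auto simp: J_def e j(3) less_Suc_eq)
  qed simp
  then have J: "\<forall>v<n. 0 < t inX v \<longleftrightarrow> s top v = s1 sel 0"
    using s s1fr by (simp add: J_def base_def t)
  have evt: "t evt = s1 evt" using s2fr by (simp add: t)
  show "t newlab 0 = k" using s2fr s1fr s by (simp add: t base_def)
  show "0 < t evt 0 \<Longrightarrow> \<exists>i\<in>D. a i \<le> s pwgt i - s clw (s centre i) \<and>
      (\<forall>v<n. 0 < t inX v \<longleftrightarrow> s top v = s centre i)"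
    using I J unfolding I_def evt by metis
  show "\<lbrakk>t evt 0 = 0; i \<in> D\<rbrakk> \<Longrightarrow> s pwgt i - s clw (s centre i) < a i"
    using I unfolding I_def evt D_def fin_def by simp
qed

end

section \<open>Programs that grow the transferable set\<close>

abbreviation (input) add_body where
  "add_body \<equiv> When (Eq (pid $ ctrV) (Var curY)) (block
     [Set inX (Var ctrV) (Const 1),
      Let wX (Plus (Var wX) (wgt $ ctrV)),
      Set pwgt (label $ ctrV)
      (Minus (Cell pwgt (label $ ctrV)) (wgt $ ctrV))])"

definition AddPiece :: prog where
  "AddPiece = For ctrV numV add_body"

definition StopIfHeavy :: prog where
  "StopIfHeavy = When (Neg (Less (Var wX) (thr $ cur)))
     (block [Let stop (Const 1), Let evt (Const 1)])"

abbreviation (input) extend_cond where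
  "extend_cond \<equiv> Conj (Pos (Cell inX (src $ ctrE))) (Conj (Neg (Pos (Cell inX (dst $ ctrE))))
     (Neg (Conj (Pos (Cell finished (Cell label (dst $ ctrE))))
     (Eq (Cell centre (Cell label (dst $ ctrE))) (dst $ ctrE)))))"

abbreviation (input) absorb_loop where
  "absorb_loop \<equiv> For ctrV numV (When (Pos (inX $ ctrV)) (Set label (Var ctrV) (Var curY)))"

abbreviation (input) swap_loop where
  "swap_loop \<equiv> For ctrV numV (When (Eq (label $ ctrV) (Var curY)) (Set inX (Var ctrV) (Const 1)))"

text \<open>The capacity test comes first, so the later branches know that the reached part
  overflows. An uncovered vertex fails it because \<open>capa\<close> is 0 at \<open>k\<close>,
  fails the second test because \<open>k\<close> is no index, and is then added as its own
  piece.\<close>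

definition Extend :: prog where
  "Extend = block
    [Scan extend_cond,
     Let curY (label $ foundY),
     If (Neg (Less (capa $ curY) (Plus (pwgt $ curY) (Var wX))))
       (block
        [absorb_loop,
         Let stop (Const 1)])
       (If (Conj (Less (Var curY) (Var numK)) (Neg (Pos (finished $ curY))))
         (block
          [Let newlab (Var curY),
           swap_loop,
           Let stop (Const 1), Let evt (Const 1)])
         (block
          [Let curY (pid $ foundY), AddPiece, StopIfHeavy]))]"

abbreviation (input) grow_init where
  "grow_init \<equiv> block
     [Set inX (Var ctrV) (Const 0),
      When (Eq (label $ ctrV) (Var numK)) (Let sel (Var ctrV))]"

definition Grow :: prog where
  "Grow = block
    [For ctrV numV grow_init,
     Set inX (Var sel) (Const 1),
     Let wX (wgt $ sel),
     Let stop (Const 0),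
     StopIfHeavy,
     For ctrR numV (When (Neg (Pos (Var stop))) Extend)]"

section \<open>Trimming an event set to the new part\<close>

abbreviation (input) renew_relabel where
  "renew_relabel \<equiv> block
     [When (Eq (label $ ctrV) (Var cur)) (Set label (Var ctrV) (Var newlab)),
      When (Pos (inX $ ctrV)) (Set label (Var ctrV) (Var numK))]"

abbreviation (input) renew_heaviest where
  "renew_heaviest \<equiv> When (Conj (Pos (inX $ ctrV)) (Less (Var selW) (wgt $ ctrV)))
     (block [Let selW (wgt $ ctrV), Let sel (Var ctrV)])"

abbreviation (input) renew_cond where
  "renew_cond \<equiv> Conj (Eq (Cell label (src $ ctrE)) (Var cur))
     (Conj (Pos (Cell inX (dst $ ctrE))) (Neg (Eq (Cell label (dst $ ctrE)) (Var cur))))"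

abbreviation (input) renew_add where
  "renew_add \<equiv> block
     [Scan renew_cond, Set label (Var foundY) (Var cur), Let selW (Plus (Var selW) (wgt $ foundY))]"

abbreviation (input) renew_body where
  "renew_body \<equiv> When (Less (Var selW) (thr $ cur)) renew_add"

text \<open>Trimming starts at a heaviest vertex. If that vertex alone is lighter than
  \<open>a p\<close>, so is every vertex added later, and stopping on reaching \<open>a p\<close>
  keeps the weight below \<open>2 * a p\<close>. If not, it is the whole new part and fits because
  no single vertex exceeds a capacity.\<close>

definition Renew :: prog where
  "Renew = block
    [For ctrV numV renew_relabel,
     Let selW (Const 0),
     For ctrV numV renew_heaviest,
     Set label (Var sel) (Var cur),
     For ctrR numV renew_body,
     Set finished (Var cur) (Const 1)]"

context thresholds
begin

definition marked :: "(nat \<Rightarrow> nat) \<Rightarrow> nat set" where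
  "marked x = {v. v < n \<and> 0 < x v}"

text \<open>During growth \<open>pwgt\<close> no longer holds the weight of a part but that of the
  part outside the marked set, which is the quantity the capacity test needs.\<close>

lemma run_AddPiece:
  assumes s: "base s"
    and w: "s wX 0 = weight (marked (s inX))"
    and pw: "\<forall>i<k. s pwgt i = weight (part (s label) i - marked (s inX))"
    and y: "s curY 0 = s pid y" and disj: "piece (s pid) y \<inter> marked (s inX) = {}"
  defines "t \<equiv> run AddPiece s"
  shows "marked (t inX) = marked (s inX) \<union> piece (s pid) y"
    and "t wX 0 = weight (marked (t inX))"
    and "\<forall>i<k. t pwgt i = weight (part (s label) i - marked (t inX))"
proof -
  define Q where "Q = (\<lambda>j. {v. v < j \<and> s pid v = s pid y})"
  define I where "I = (\<lambda>j (s'::state). (\<forall>v<n. 0 < s' inX v \<longleftrightarrow> 0 < s inX v \<or> v \<in> Q j) \<and>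
     s' wX 0 = s wX 0 + weight (Q j) \<and>
     (\<forall>i<k. s' pwgt i = s pwgt i - weight {v \<in> Q j. s label v = i}))"
  have "I (s numV 0) t" unfolding t_def AddPiece_def
  proof (rule run_For, goal_cases)
    show "I 0 (upd s ctrV 0 0)" by (simp add: I_def Q_def)
  next
    case (3 j s')
    note j = 3(1-3) and fr = 3(4)
    have e: "s' label = s label" "s' pid = s pid" "s' wgt = wt" "s' curY = s curY" "j < n"
      using fr s j by (simp_all add: base_def)
    show ?case
    proof (cases "s pid j = s pid y")
      case True
      have Q: "Q (Suc j) = insert j (Q j)" "j \<notin> Q j" "finite (Q j)"
        using True by (auto simp: Q_def less_Suc_eq)
      have QL: "{v. (v = j \<or> v \<in> Q j) \<and> s label v = i} =
          (if s label j = i then insert j {v \<in> Q j. s label v = i} else {v \<in> Q j. s label v = i})" for i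
        by auto
      show ?thesis using j(2) Q True e(5) by (auto simp: I_def e(1-4) j(3) y QL)
    next
      case False
      then have "Q (Suc j) = Q j" by (auto simp: Q_def less_Suc_eq)
      then show ?thesis using j(2) False by (auto simp: I_def e(1-4) j(3) y)
    qed
  qed simp
  then have I: "I n t" using s by (simp add: base_def)
  have Q: "Q n = piece (s pid) y" by (auto simp: Q_def piece_def)
  show M: "marked (t inX) = marked (s inX) \<union> piece (s pid) y"
    using I by (auto simp: I_def Q marked_def) (auto simp: piece_def)
  show "t wX 0 = weight (marked (t inX))"
    unfolding M using I w disj by (subst sum.union_disjoint) (auto simp: I_def Q piece_def marked_def)
  show "\<forall>i<k. t pwgt i = weight (part (s label) i - marked (t inX))"
  proof (intro allI impI)
    fix i assume i: "i < k"
    let ?A = "{v \<in> piece (s pid) y. s label v = i}"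
    have "t pwgt i = weight (part (s label) i - marked (s inX)) - weight ?A"
      using I i pw by (simp add: I_def Q)
    also have "\<dots> = weight (part (s label) i - marked (s inX) - ?A)"
      by (rule sum_diff_nat[symmetric]) (use disj in \<open>auto simp: piece_def part_def marked_def\<close>)
    also have "part (s label) i - marked (s inX) - ?A = part (s label) i - marked (t inX)"
      unfolding M by (auto simp: part_def)
    finally show "t pwgt i = weight (part (s label) i - marked (t inX))" .
  qed
qed

context
  fixes L D p
  assumes Inv: "Inv L D"
    and p: "p < k" "p \<notin> D" "\<And>j. \<lbrakk>j < k; j \<notin> D\<rbrakk> \<Longrightarrow> a j \<le> a p" "weight (part L p) < a p"
begin

text \<open>Growth is in progress, ended in an event, or ended in an absorption. A round that does
  not stop marks a new vertex, so \<open>j < card\<close> excludes the first case after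
  \<open>n\<close> rounds.\<close>

definition grow_state :: "nat \<Rightarrow> state \<Rightarrow> bool" where
  "grow_state j s \<longleftrightarrow>
    (if s stop 0 = 0
     then s evt 0 = 0 \<and> s label = L \<and> s newlab 0 = k \<and> growing L D (s centre) (s pid) p (marked (s inX)) \<and>
       s wX 0 = weight (marked (s inX)) \<and>
       (\<forall>i<k. s pwgt i = weight (part L i - marked (s inX))) \<and> j < card (marked (s inX))
     else if 0 < s evt 0 then s label = L \<and> event L D p (marked (s inX)) (s newlab 0)
     else Inv (s label) D \<and> card (part (s label) k) < card (part L k))"

lemma run_Extend:
  assumes s: "base s" and d: "fin k (s finished) = D" "s finished k = 0" and cur: "s cur 0 = p"
    and pcs: "pieces L D (s centre) (s pid)"
    and G: "grow_state j s" and stop: "s stop 0 = 0"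
  shows "grow_state (Suc j) (run Extend s)"
proof -
  define U where "U = marked (s inX)"
  have g: "growing L D (s centre) (s pid) p U" and wU: "s wX 0 = weight U"
    and pw: "\<And>i. i < k \<Longrightarrow> s pwgt i = weight (part L i - U)" and jc: "j < card U"
    and lab: "s label = L" and evt0: "s evt 0 = 0" and nl: "s newlab 0 = k"
    using G stop by (auto simp: grow_state_def U_def)
  have b: "s numV 0 = n" "s numK 0 = k" "s numE 0 = m" "s wgt = wt" "s src = F" "s dst = T" "s thr = a" "s capa = cap"
    using s by (auto simp: base_def)
  have Lk: "L v \<le> k" if "v < n" for v using Inv that by (auto simp: Inv_def)
  have Dfin: "0 < s finished i \<longleftrightarrow> i \<in> D" if "i \<le> k" for i
    using fin_iff[of i k "s finished"] d that by simp
  define Q where "Q = (\<lambda>x y. 0 < s inX x \<and> s inX y = 0 \<and> \<not> (0 < s finished (L y) \<and> s centre (L y) = y))"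
  define s1 where "s1 = run (Scan extend_cond) s"
  have Q: "\<forall>s''. (\<forall>l. l \<notin> scanned \<longrightarrow> s'' l = s l) \<longrightarrow>
        bval extend_cond s'' = Q (F (s'' ctrE 0)) (T (s'' ctrE 0))"
    by (simp add: Q_def b lab)
  note scan = run_Scan[where Q = Q, OF b(3,5,6) Q, folded s1_def]
  have s1: "s1 l = s l" if "l \<notin> scanned" for l
    unfolding s1_def by (rule run_frame) (use that in \<open>simp add: Scan_def\<close>)
  obtain x0 y0 where xy0: "x0 \<in> U" "y0 < n" "y0 \<notin> U" "y0 \<notin> s centre ` D" "adj x0 y0"
    using growing_extends[OF Inv pcs p g] by blast
  have "s centre (L y0) \<noteq> y0" if "L y0 \<in> D" using xy0(4) that by (metis imageI)
  then have "Q x0 y0"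
    using xy0 Dfin[of "L y0"] Lk[of y0] by (auto simp: Q_def U_def marked_def)
  then have "0 < s1 found 0" using scan(2)[OF _ xy0(5)] by blast
  define x where "x = s1 foundX 0"
  define y where "y = s1 foundY 0"
  have xy: "adj x y" "Q x y" using scan(1) \<open>0 < s1 found 0\<close> by (auto simp: x_def y_def)
  have xyn: "x < n" "y < n" using adj_bound xy by auto
  have xU: "x \<in> U" "y \<notin> U" using xy xyn by (auto simp: Q_def U_def marked_def)
  have ycen: "y \<notin> s centre ` D"
  proof
    assume "y \<in> s centre ` D"
    then obtain i where i: "i \<in> D" "y = s centre i" by auto
    then have "L y = i" using pcs by (auto simp: pieces_def part_def)
    then show False using i xy(2) Dfin[of i] Lk[OF xyn(2)] by (auto simp: Q_def)
  qed
  let ?i = "L y"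
  define s2 where "s2 = upd s1 curY 0 ?i"
  have s2: "s2 curY 0 = ?i" "s2 foundY 0 = y" "\<And>l. l \<notin> {ctrE, found, foundX, foundY, curY} \<Longrightarrow> s2 l = s l"
    using s1 by (simp_all add: s2_def y_def)
  have s2e: "s2 = upd s1 curY 0 (s1 label (s1 foundY 0))" using s1 lab by (simp add: s2_def y_def)
  have R: "run Extend s = (if s2 pwgt ?i + s2 wX 0 \<le> cap ?i then upd (run absorb_loop s2) stop 0 1
     else if ?i < k \<and> s2 finished ?i = 0 then upd (upd (run swap_loop (upd s2 newlab 0 ?i)) stop 0 1) evt 0 1
     else run StopIfHeavy (run AddPiece (upd s2 curY 0 (s pid y))))"
    using s2 by (simp add: Extend_def s1_def[symmetric] s2e[symmetric] b)
  have yk: "?i \<le> k" using Lk xyn by simp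
  have Un: "U \<subseteq> {..<n}" by (auto simp: U_def marked_def)
  show ?thesis
  proof (cases "s pwgt ?i + s wX 0 \<le> cap ?i")
    case True
    have "x \<in> {..<n}" "1 \<le> wt x" using xyn wt_pos by auto
    then have "1 \<le> weight U" using weight_pos[OF Un] xU by auto
    then have ik: "?i < k" using True cap_k wU yk by (cases "?i = k") auto
    have fit: "weight (part L ?i - U) + weight U \<le> cap ?i" using True pw[OF ik] wU by simp
    define s3 where "s3 = run absorb_loop s2"
    have r: "run Extend s = upd s3 stop 0 1" using R True s2 by (simp add: s3_def)
    define I where "I = (\<lambda>j (s'::state). \<forall>v<n. s' label v = (if v < j \<and> v \<in> U then ?i else L v))"
    have "I (s2 numV 0) s3" unfolding s3_def
    proof (rule run_For, goal_cases)
      show "I 0 (upd s2 ctrV 0 0)" using s2 lab by (simp add: I_def)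
    next
      case (3 j s')
      note j = 3(1-3) and fr = 3(4)
      have e: "s' inX = s inX" "s' curY 0 = ?i" "j < n" using fr s2 j b by simp_all
      have "0 < s inX j \<longleftrightarrow> j \<in> U" using e by (simp add: U_def marked_def)
      then show ?case
        using j(2) by (auto simp: I_def e(1,2) j(3) less_Suc_eq)
    qed simp
    then have lab3: "\<forall>v<n. (if v \<in> U then ?i else L v) = s3 label v" using s2 b by (simp add: I_def)
    have "s3 evt = s evt" using run_frame[of evt absorb_loop s2] s2 by (simp add: s3_def)
    moreover have "part (s3 label) k = part (\<lambda>v. if v \<in> U then ?i else L v) k"
      unfolding part_def by (intro Collect_cong conj_cong refl) (simp add: lab3[rule_format, symmetric])
    ultimately show ?thesis
      using growing_absorb[OF Inv pcs p g xU(1) xyn(2) xy(1) ik fit] Inv_cong[OF lab3] evt0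
      by (simp add: grow_state_def r)
  next
    case nofit: False
    have nofit': "cap ?i < weight (part L ?i - U) + weight U" if "?i < k" using nofit pw[OF that] wU by simp
    show ?thesis
    proof (cases "?i < k \<and> ?i \<notin> D")
      case True
      define s3 where "s3 = run swap_loop (upd s2 newlab 0 ?i)"
      have r: "run Extend s = upd (upd s3 stop 0 1) evt 0 1"
        using R nofit s2 True Dfin[OF yk] by (simp add: s3_def)
      define I where "I = (\<lambda>j (s'::state). \<forall>v<n. 0 < s' inX v \<longleftrightarrow> v \<in> U \<or> v < j \<and> L v = ?i)"
      have "I (upd s2 newlab 0 ?i numV 0) s3" unfolding s3_def
      proof (rule run_For, goal_cases)
        show "I 0 (upd (upd s2 newlab 0 ?i) ctrV 0 0)" using s2 by (simp add: I_def U_def marked_def)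
      next
        case (3 j s')
        note j = 3(1-3) and fr = 3(4)
        have e: "s' label = L" "s' curY 0 = ?i" "j < n" using fr s2 j b lab by simp_all
        show ?case
          using j(2) by (auto simp: I_def e(1,2) j(3) less_Suc_eq)
      qed simp
      then have M: "marked (s3 inX) = U \<union> part L ?i"
        using s2 b Un by (auto simp: I_def marked_def part_def)
      have "s3 l = upd s2 newlab 0 ?i l" if "l \<notin> {ctrV, inX}" for l
        using run_frame[of l swap_loop "upd s2 newlab 0 ?i"] that by (simp add: s3_def)
      then have "s3 label = L" "s3 newlab 0 = ?i" using s2 lab by simp_all
      then show ?thesis
        using growing_swap[OF Inv pcs p g xU(1) xyn(2) xy(1) _ _ nofit'] True M
        by (simp add: grow_state_def r)
    next
      case False
      define s3 where "s3 = upd s2 curY 0 (s pid y)"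
      define s4 where "s4 = run AddPiece s3"
      have r: "run Extend s = run StopIfHeavy s4"
        using R nofit s2 False Dfin[OF yk] by (auto simp: s3_def s4_def)
      have iy: "?i = k \<or> ?i \<in> D \<and> cap ?i < weight (part L ?i - U) + weight U"
        using False yk nofit' by (cases "?i = k") auto
      note gp = growing_piece[OF Inv pcs p g xU(1) xyn(2) xU(2) ycen xy(1) iy]
      have s3: "s3 l = s l" if "l \<notin> {ctrE, found, foundX, foundY, curY}" for l
        using s2 that by (simp add: s3_def)
      have "base s3" by (rule base_agree[OF s]) (auto intro!: s3)
      moreover have "s3 wX 0 = weight (marked (s3 inX))" using s3 wU by (simp add: U_def)
      moreover have "\<forall>i<k. s3 pwgt i = weight (part (s3 label) i - marked (s3 inX))"
        using s3 pw lab by (simp add: U_def)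
      moreover have "s3 curY 0 = s3 pid y" using s3 by (simp add: s3_def s2)
      moreover have "piece (s3 pid) y \<inter> marked (s3 inX) = {}" using gp(3) s3 by (simp add: U_def)
      ultimately have A: "marked (s4 inX) = marked (s3 inX) \<union> piece (s3 pid) y"
        "s4 wX 0 = weight (marked (s4 inX))"
        "\<forall>i<k. s4 pwgt i = weight (part (s3 label) i - marked (s4 inX))"
        unfolding s4_def by (rule run_AddPiece)+
      have M: "marked (s4 inX) = U \<union> piece (s pid) y" using A(1) s3 by (simp add: U_def)
      have s4: "s4 l = s l" if "l \<notin> {ctrE, found, foundX, foundY, curY, ctrV, inX, wX, pwgt}" for l
        using run_frame[of l AddPiece s3] s3 that by (simp add: s4_def AddPiece_def)
      have "y \<in> piece (s pid) y" using xyn by (simp add: piece_def)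
      then have "U \<subset> marked (s4 inX)" using M xU by auto
      then have "card U < card (marked (s4 inX))"
        by (rule psubset_card_mono[rotated]) (simp add: marked_def)
      then have jc': "Suc j < card (marked (s4 inX))" using jc by simp
      show ?thesis
      proof (cases "s4 wX 0 < a p")
        case True
        then have "run Extend s = s4"
          unfolding r using s4 b cur by (simp add: StopIfHeavy_def)
        then show ?thesis
          using gp(1) True A(2,3) M jc' s4 s3 lab stop evt0 nl by (simp add: grow_state_def)
      next
        case False
        then have "run Extend s = upd (upd s4 stop 0 1) evt 0 1"
          unfolding r using s4 b cur by (simp add: StopIfHeavy_def)
        then show ?thesis
          using gp(2) False A(2) M s4 lab nl by (simp add: grow_state_def)
      qed
    qed
  qed
qed

lemma run_Grow:
  assumes s: "base s" and d: "fin k (s finished) = D" "s finished k = 0" and cur: "s cur 0 = p"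
    and lab: "s label = L" and evt: "s evt 0 = 0" and nl: "s newlab 0 = k"
    and pcs: "pieces L D (s centre) (s pid)"
    and pw: "\<forall>i<k. s pwgt i = weight (part L i)" and R: "part L k \<noteq> {}"
  defines "t \<equiv> run Grow s"
  shows "0 < t evt 0 \<Longrightarrow> t label = L \<and> event L D p (marked (t inX)) (t newlab 0)"
    and "t evt 0 = 0 \<Longrightarrow> Inv (t label) D \<and> card (part (t label) k) < card (part L k)"
proof -
  define s1 where "s1 = run (For ctrV numV grow_init) s"
  define u where "u = s1 sel 0"
  have b: "s numV 0 = n" "s numK 0 = k" "s wgt = wt" "s thr = a"
    using s by (auto simp: base_def)
  define I where "I = (\<lambda>j (s'::state). (\<forall>v<j. s' inX v = 0) \<and>
    ((\<exists>v<j. L v = k) \<longrightarrow> s' sel 0 < j \<and> L (s' sel 0) = k))"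
  have "I (s numV 0) s1" unfolding s1_def
  proof (rule run_For, goal_cases)
    show "I 0 (upd s ctrV 0 0)" by (simp add: I_def)
  next
    case (3 j s')
    note j = 3(1-3) and fr = 3(4)
    have e: "s' label = L" "s' numK 0 = k" using fr lab b by simp_all
    show ?case
      using j(2) by (auto simp: I_def e j(3) less_Suc_eq)
  qed simp
  then have s1: "\<forall>v<n. s1 inX v = 0" and u: "u < n" "L u = k"
    using R b by (auto simp: I_def part_def u_def)
  have s1fr: "s1 l = s l" if "l \<notin> {ctrV, inX, sel}" for l
    using run_frame[of l "For ctrV numV grow_init" s] that by (simp add: s1_def)
  define s2 where "s2 = upd (upd (upd s1 inX u 1) wX 0 (wt u)) stop 0 0"
  have s2fr: "s2 l = s l" if "l \<notin> {ctrV, inX, sel, wX, stop}" for l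
    using s1fr that by (simp add: s2_def)
  define s3 where "s3 = run StopIfHeavy s2"
  have s3: "s3 = (if wt u < a p then s2 else upd (upd s2 stop 0 1) evt 0 1)"
    using s2fr b cur by (simp add: s3_def StopIfHeavy_def s2_def)
  have t: "t = run (For ctrR numV (When (Neg (Pos (Var stop))) Extend)) s3"
  proof -
    have "s2 = run (Let stop (Const 0)) (run (Let wX (wgt $ sel)) (run (Set inX (Var sel) (Const 1)) s1))"
      using s1fr b by (simp add: s2_def u_def)
    then show ?thesis
      by (simp only: t_def Grow_def s3_def s1_def block.simps run.simps(1,3))
  qed
  have mu: "marked (s2 inX) = {u}" using s1 u by (auto simp: marked_def s2_def)
  have pk: "part L i - {u} = part L i" if "i < k" for i using that u by (auto simp: part_def)
  have G0: "grow_state 0 s3"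
  proof (cases "wt u < a p")
    case True
    then have g: "growing L D (s centre) (s pid) p {u}"
      using growing_start[OF Inv pcs p u] by simp
    show ?thesis
      using g True s2fr lab nl evt mu pw pk by (simp add: grow_state_def s3) (simp add: s2_def)
  next
    case False
    then show ?thesis
      using growing_start(2)[OF Inv pcs p u] s2fr lab nl mu by (simp add: grow_state_def s3)
  qed
  let ?body = "When (Neg (Pos (Var stop))) Extend"
  have fixed: "l \<notin> mods (For ctrV numV grow_init) \<union> {wX, stop, evt} \<Longrightarrow> s3 l = s l" for l
    using s2fr[of l] by (auto simp: s3)
  have grow_upd: "grow_state j (upd s' ctrR 0 x) = grow_state j s'" for j s' x
    by (simp add: grow_state_def)
  have "grow_state (s3 numV 0) t" unfolding t
  proof (rule run_For, goal_cases)
    show "ctrR \<notin> mods ?body"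
      by (simp add: Extend_def Scan_def AddPiece_def StopIfHeavy_def)
    show "grow_state 0 (upd s3 ctrR 0 0)" using G0 by (simp add: grow_state_def)
  next
    case (3 j s')
    note j = 3(1-3) and fr = 3(4)
    have fr': "s' l = s l" if "l \<notin> {ctrV, ctrR, ctrE, inX, sel, wX, stop, evt, newlab, label, curY, pwgt, found, foundX, foundY}" for l
      using that fr[of l] fixed[of l] by (simp add: Extend_def Scan_def AddPiece_def StopIfHeavy_def)
    have "base s'" by (rule base_agree[OF s]) (auto intro!: fr')
    moreover have "s' finished = s finished" "s' cur = s cur" "s' centre = s centre" "s' pid = s pid"
      by (simp_all add: fr')
    ultimately have "grow_state (Suc j) (run Extend s')" if "s' stop 0 = 0"
      using run_Extend[OF _ _ _ _ _ j(2) that] d cur pcs by simp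
    then have "grow_state (Suc j) (run ?body s')"
      using j(2) by (cases "s' stop 0 = 0") (simp, simp add: grow_state_def)
    then show ?case
      by (simp only: grow_upd)
  qed
  then have "grow_state n t" using fixed[of numV] b by simp
  moreover have "card (marked (t inX)) \<le> n"
    using card_mono[of "{..<n}" "marked (t inX)"] by (auto simp: marked_def)
  ultimately show "0 < t evt 0 \<Longrightarrow> t label = L \<and> event L D p (marked (t inX)) (t newlab 0)"
    and "t evt 0 = 0 \<Longrightarrow> Inv (t label) D \<and> card (part (t label) k) < card (part L k)"
    by (auto simp: grow_state_def split: if_splits)
qed

lemma run_Renew:
  assumes s: "base s" and d: "fin k (s finished) = D" "s finished k = 0" and cur: "s cur 0 = p"
    and lab: "s label = L" and ev: "event L D p (marked (s inX)) (s newlab 0)"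
  defines "t \<equiv> run Renew s"
  shows "Inv (t label) (insert p D)" "t finished = (s finished)(p := 1)"
proof -
  define X where "X = marked (s inX)"
  define q where "q = s newlab 0"
  have ev: "event L D p X q" using ev by (simp add: X_def q_def)
  have b: "s numV 0 = n" "s numK 0 = k" "s numE 0 = m" "s wgt = wt" "s src = F" "s dst = T" "s thr = a"
    using s by (auto simp: base_def)
  have Xn: "X \<subseteq> {..<n}" by (auto simp: X_def marked_def)
  have cX: "connected X" and wX: "a p \<le> weight X" using ev by (auto simp: event_def rest_of_def)
  have inX: "0 < s inX v \<longleftrightarrow> v \<in> X" if "v < n" for v using that by (simp add: X_def marked_def)
  define s1 where "s1 = run (For ctrV numV renew_relabel) s"
  define s2 where "s2 = run (For ctrV numV renew_heaviest) (upd s1 selW 0 0)"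
  define s3 where "s3 = upd s2 label (s2 sel 0) (s2 cur 0)"
  define s4 where "s4 = run (For ctrR numV renew_body) s3"
  have t: "t = upd s4 finished (s4 cur 0) 1"
  proof -
    have "upd s1 selW 0 0 = run (Let selW (Const 0)) s1" "s3 = run (Set label (Var sel) (Var cur)) s2"
      "upd s4 finished (s4 cur 0) 1 = run (Set finished (Var cur) (Const 1)) s4"
      by (simp_all add: s3_def)
    then show ?thesis
      by (simp only: t_def Renew_def s4_def s2_def s1_def block.simps run.simps(1,3))
  qed
  define L1 where "L1 = (\<lambda>v. if v \<in> X then k else if L v = p then q else L v)"
  have s1fr: "s1 l = s l" if "l \<notin> {ctrV, label}" for l
    unfolding s1_def by (rule run_frame) (use that in simp)
  define I where "I = (\<lambda>j (s'::state). \<forall>v<n. s' label v = (if v < j then L1 v else L v))"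
  have "I (s numV 0) s1" unfolding s1_def
  proof (rule run_For, goal_cases)
    show "I 0 (upd s ctrV 0 0)" by (simp add: I_def lab)
  next
    case (3 j s')
    note j = 3(1-3) and fr = 3(4)
    have e: "s' inX = s inX" "s' cur 0 = p" "s' newlab 0 = q" "s' numK 0 = k" "j < n"
      using fr b cur j by (simp_all add: q_def)
    have "s' label j = L j" using j(2) e by (simp add: I_def)
    then show ?case
      using j(2) inX[OF e(5)] e(5) by (auto simp: I_def e(1-4) j(3) less_Suc_eq L1_def)
  qed simp
  then have s1: "\<forall>v<n. s1 label v = L1 v" using b by (simp add: I_def)
  have s2fr: "s2 l = s1 l" if "l \<notin> {ctrV, selW, sel}" for l
    using run_frame[of l "For ctrV numV renew_heaviest" "upd s1 selW 0 0"] that by (simp add: s2_def)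
  define J where "J = (\<lambda>j (s'::state). (\<forall>v<j. v \<in> X \<longrightarrow> wt v \<le> s' selW 0) \<and>
    (0 < s' selW 0 \<longrightarrow> s' sel 0 \<in> X \<and> s' selW 0 = wt (s' sel 0)))"
  have "J (upd s1 selW 0 0 numV 0) s2" unfolding s2_def
  proof (rule run_For, goal_cases)
    show "J 0 (upd (upd s1 selW 0 0) ctrV 0 0)" by (simp add: J_def)
  next
    case (3 j s')
    note j = 3(1-3) and fr = 3(4)
    have e: "s' inX = s inX" "s' wgt = wt" "j < n"
      using fr b s1fr j by simp_all
    show ?case
      using j(2) inX[OF e(3)] by (auto simp: J_def e(1,2) j(3) less_Suc_eq)
  qed simp
  then have J: "J n s2" using b s1fr by simp
  define u where "u = s2 sel 0"
  obtain x0 where "x0 \<in> X" using conn_nonempty[OF cX] by auto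
  then have "0 < s2 selW 0" using J Xn wt_pos[of x0] by (fastforce simp: J_def)
  then have u: "u \<in> X" "s2 selW 0 = wt u" and umax: "\<And>v. v \<in> X \<Longrightarrow> wt v \<le> wt u"
    using J Xn by (auto simp: J_def u_def)
  have p: "p < k" using ev by (simp add: event_def rest_of_def)
  \<comment> \<open>After the relabelling the label \<open>p\<close> is free and can mark the
    trimmed set. If \<open>q = p\<close>, this holds because the old part lies inside
    \<open>X\<close> and was uncovered with it.\<close>
  have L1p: "L1 v \<noteq> p" if "v < n" for v
  proof (cases "q = p")
    case True
    then have "part L p \<subseteq> X" using ev p by (auto simp: event_def)
    then show ?thesis using that p by (auto simp: L1_def part_def)
  next
    case False
    then show ?thesis using p by (simp add: L1_def)
  qed
  \<comment> \<open>Before the threshold is reached each round adds a vertex, so the last disjunct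
    \<open>j < card Y\<close> cannot hold after \<open>n\<close> rounds.\<close>
  define G where "G = (\<lambda>j (s'::state). \<exists>Y\<subseteq>X. u \<in> Y \<and> connected Y \<and> s' selW 0 = weight Y \<and> weight Y \<le> cap p \<and>
    (\<forall>v<n. s' label v = (if v \<in> Y then p else L1 v)) \<and> (a p \<le> weight Y \<or> j < card Y))"
  have "G (s3 numV 0) s4" unfolding s4_def
  proof (rule run_For, goal_cases)
    show "ctrR \<notin> mods renew_body" by (simp add: Scan_def)
    have "wt u \<le> cap p" using wt_b[of u p] b_cap[OF p] u Xn p by (auto intro: order_trans)
    then have "G 0 s3"
      unfolding G_def using u s1 s2fr s1fr cur conn_singleton
      by (intro exI[of _ "{u}"]) (auto simp: s3_def u_def[symmetric])
    then show "G 0 (upd s3 ctrR 0 0)" by (simp add: G_def)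
  next
    case (3 j s')
    note j = 3(1-3) and fr = 3(4)
    have fr': "s' l = s l" if "l \<notin> {ctrR, ctrE, ctrV, found, foundX, foundY, label, selW, sel}" for l
      using fr[of l] that s2fr[of l] s1fr[of l] by (simp add: Scan_def s3_def)
    have e: "s' inX = s inX" "s' cur 0 = p" "s' wgt = wt" "s' thr = a" "s' numE 0 = m" "s' src = F" "s' dst = T"
      using b cur by (simp_all add: fr')
    obtain Y where Y: "Y \<subseteq> X" "u \<in> Y" "connected Y" "s' selW 0 = weight Y" "weight Y \<le> cap p"
      "\<forall>v<n. s' label v = (if v \<in> Y then p else L1 v)" "a p \<le> weight Y \<or> j < card Y"
      using j(2) by (auto simp: G_def)
    show ?case
    proof (cases "a p \<le> weight Y")
      case True
      then have "G (Suc j) s'" unfolding G_def using Y by blast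
      then show ?thesis using True Y e by (simp add: G_def)
    next
      case False
      define s5 where "s5 = run (Scan renew_cond) s'"
      define Q where "Q = (\<lambda>x y. s' label x = p \<and> 0 < s inX y \<and> s' label y \<noteq> p)"
      have Q: "\<forall>s''. (\<forall>l. l \<notin> scanned \<longrightarrow> s'' l = s' l) \<longrightarrow>
        bval renew_cond s'' = Q (F (s'' ctrE 0)) (T (s'' ctrE 0))"
        by (simp add: Q_def e)
      note scan = run_Scan[where Q = Q, OF e(5-7) Q, folded s5_def]
      have s5: "s5 l = s' l" if "l \<notin> scanned" for l
        unfolding s5_def by (rule run_frame) (use that in \<open>simp add: Scan_def\<close>)
      have Ylab: "v \<in> Y \<longleftrightarrow> s' label v = p" if "v < n" for v
        using Y(6) L1p that by auto
      have "\<not> X \<subseteq> Y" using False wX Y(1) by auto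
      moreover have "Y \<inter> X \<noteq> {}" using Y by auto
      ultimately obtain x0 y0 where "x0 \<in> Y" "y0 \<in> X - Y" "adj x0 y0"
        using conn_cut[OF cX] by blast
      then have "Q x0 y0" "adj x0 y0"
        using Ylab[of x0] Ylab[of y0] inX[of y0] adj_bound[of x0 y0] by (auto simp: Q_def)
      then have "0 < s5 found 0" using scan(2) by blast
      define x where "x = s5 foundX 0"
      define y where "y = s5 foundY 0"
      have xy: "adj x y" "Q x y" using scan(1) \<open>0 < s5 found 0\<close> by (auto simp: x_def y_def)
      have xyn: "x < n" "y < n" using adj_bound xy by auto
      have y: "x \<in> Y" "y \<in> X" "y \<notin> Y" using xy Ylab[OF xyn(1)] Ylab[OF xyn(2)] inX[OF xyn(2)] by (auto simp: Q_def)
      have "run renew_body s' = upd (upd s5 label y p) selW 0 (s5 selW 0 + wt y)"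
        using False Y(4) e s5 by (simp add: s5_def[symmetric] y_def)
      then have r: "run renew_body s' selW 0 = weight Y + wt y"
        "\<forall>v<n. run renew_body s' label v = (if v \<in> insert y Y then p else L1 v)"
        using s5 Y(4,6) by simp_all
      have fin: "finite Y" using Y(1) Xn by (auto intro: finite_subset)
      have w: "weight (insert y Y) = weight Y + wt y" using y fin by simp
      have "wt y \<le> wt u" by (rule umax[OF y(2)])
      also have "wt u \<le> weight Y" using Y(2) fin by (simp add: member_le_sum)
      finally have "weight (insert y Y) \<le> cap p"
        using False w cap_a[OF p] by simp
      moreover have "connected (insert y Y)"
        using conn_Un[OF symp_adj Y(3) conn_singleton y(1) singletonI xy(1)] by simp
      moreover have "Suc j < card (insert y Y)" using Y(7) False y fin by simp
      ultimately have "G (Suc j) (run renew_body s')"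
        unfolding G_def using Y y r w by (intro exI[of _ "insert y Y"]) auto
      then show ?thesis unfolding G_def by simp
    qed
  qed
  then have "G n s4" using s2fr s1fr b by (simp add: s3_def)
  then obtain Y where Y: "Y \<subseteq> X" "connected Y" "weight Y \<le> cap p"
      "\<forall>v<n. s4 label v = (if v \<in> Y then p else L1 v)" "a p \<le> weight Y \<or> n < card Y"
    by (auto simp: G_def)
  have "card Y \<le> n" using card_mono[of "{..<n}" Y] Y(1) Xn by auto
  then have aY: "a p \<le> weight Y" using Y(5) by simp
  have tl: "t label = s4 label" by (simp add: t)
  have "\<forall>v<n. (if v \<in> Y then p else if v \<in> X then k else if L v = p then q else L v) = t label v"
    using Y(4) by (simp add: tl L1_def)
  from Inv_cong[OF this] event_step[OF Inv ev Y(1,2) aY Y(3)]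
  show "Inv (t label) (insert p D)" by simp
  have "s4 l = s l" if "l \<notin> {ctrR, ctrE, ctrV, found, foundX, foundY, label, selW, sel}" for l
  proof -
    have "s4 l = s3 l" unfolding s4_def by (rule run_frame) (use that in \<open>simp add: Scan_def\<close>)
    then show ?thesis using s2fr[of l] s1fr[of l] that by (simp add: s3_def)
  qed
  then show "t finished = (s finished)(p := 1)" using cur by (simp add: t fun_upd_def)
qed

end

end

section \<open>One round and the bound on the number of rounds\<close>

abbreviation (input) step_cond where
  "step_cond \<equiv> Conj (Less (Var cur) (Var numK)) (Pos (pwgt $ numK))"

abbreviation (input) step_main where
  "step_main \<equiv> block [Roots, Search, Contract, Split, When (Neg (Pos (Var evt))) Grow, When (Pos (Var evt)) Renew]"

text \<open>The first branch serves the second phase, where an unfinished part may have reached its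
  threshold through absorptions or already in the first phase.\<close>

abbreviation (input) step_body where
  "step_body \<equiv> If (Neg (Less (pwgt $ cur) (thr $ cur)))
     (Set finished (Var cur) (Const 1)) step_main"

definition Step :: prog where
  "Step = block [Weigh, Pick, When step_cond step_body]"

context thresholds
begin

text \<open>A disjunction of two reasons to stop; a count of weight in each phase turns it into what
  that phase has to deliver.\<close>

definition settled :: "state \<Rightarrow> bool" where
  "settled s \<longleftrightarrow> fin k (s finished) = {..<k} \<or> part (s label) k = {}"

text \<open>A lexicographic order as a number: an event may uncover vertices, but it finishes an
  index, and this gains \<open>n + 1\<close> against a loss of at most \<open>n\<close>.\<close>

definition potential :: "state \<Rightarrow> nat" where
  "potential s = card (fin k (s finished)) * (n + 1) + (n - card (part (s label) k))"

end

definition Loop :: prog where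
  "Loop = For ctrP rounds Step"

lemmas program_defs = Loop_def Step_def Renew_def Grow_def Extend_def StopIfHeavy_def AddPiece_def Split_def
  Contract_def Search_def Roots_def Pick_def Weigh_def Scan_def

context thresholds
begin

lemma Inv_finish:
  assumes "Inv L D" "p < k" "p \<notin> D" "\<And>j. \<lbrakk>j < k; j \<notin> D\<rbrakk> \<Longrightarrow> a j \<le> a p" "a p \<le> weight (part L p)"
  shows "Inv L (insert p D)"
  using assms unfolding Inv_def by simp

lemma run_Step:
  assumes s: "base s" and Inv: "Inv (s label) (fin k (s finished))" and d: "s finished k = 0"
  defines "t \<equiv> run Step s"
  shows "base t" "Inv (t label) (fin k (t finished))" "t finished k = 0"
    "settled s \<Longrightarrow> settled t" "\<not> settled s \<Longrightarrow> potential s < potential t"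
proof -
  show "base t" unfolding t_def by (rule base_run[OF s]) (simp add: program_defs)
  define L where "L = s label"
  define D where "D = fin k (s finished)"
  note Inv = Inv[folded L_def D_def]
  have Lk: "\<forall>v<n. L v \<le> k" using Inv by (simp add: Inv_def)
  define s1 where "s1 = run Weigh s"
  define s2 where "s2 = run Pick s1"
  define p where "p = s2 cur 0"
  have s1fr: "s1 l = s l" if "l \<notin> {ctrI, ctrV, pwgt}" for l
    unfolding s1_def by (rule run_frame) (use that in \<open>simp add: program_defs\<close>)
  have s2fr: "s2 l = s1 l" if "l \<notin> {ctrI, cur}" for l
    unfolding s2_def by (rule run_frame) (use that in \<open>simp add: program_defs\<close>)
  have b1: "base s1" by (rule base_agree[OF s]) (auto intro!: s1fr)
  have b2: "base s2" by (rule base_agree[OF b1]) (auto intro!: s2fr)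
  have e2: "s2 label = L" "s2 finished = s finished" "s1 finished = s finished"
    using s1fr s2fr by (simp_all add: L_def)
  have pw: "s2 pwgt i = weight (part L i)" if "i \<le> k" for i
    using run_Weigh[OF s Lk[unfolded L_def] that] s2fr by (simp add: s1_def L_def)
  have pick: "p \<le> k" "p < k \<Longrightarrow> p \<notin> D" "\<And>j. \<lbrakk>p < k; j < k; j \<notin> D\<rbrakk> \<Longrightarrow> a j \<le> a p" "p = k \<Longrightarrow> D = {..<k}"
    using run_Pick[OF b1] e2 unfolding p_def s2_def D_def by auto
  have t: "t = run (When step_cond step_body) s2"
    by (simp add: t_def Step_def s1_def s2_def)
  have c: "bval step_cond s2 \<longleftrightarrow> \<not> settled s"
  proof -
    have "bval step_cond s2 \<longleftrightarrow> p < k \<and> 0 < weight (part L k)"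
      using b2 pw by (simp add: base_def p_def)
    also have "0 < weight (part L k) \<longleftrightarrow> part L k \<noteq> {}"
      using weight_pos[OF part_bound] by (metis One_nat_def less_eq_Suc_le sum.empty less_irrefl)
    also have "p < k \<longleftrightarrow> D \<noteq> {..<k}" using pick by (metis lessThan_iff order_less_le)
    finally show ?thesis by (simp add: settled_def L_def D_def)
  qed
  have Dk: "D \<subseteq> {..<k}" "finite D" by (auto simp: D_def fin_def)
  have potI: "potential s < potential u" if "fin k (u finished) = insert p D" "p \<notin> D" for u
    using that Dk by (simp add: potential_def D_def[symmetric])
  have goal: "Inv (t label) (fin k (t finished)) \<and> t finished k = 0 \<and>
      (settled s \<longrightarrow> settled t) \<and> (\<not> settled s \<longrightarrow> potential s < potential t)"
  proof (cases "settled s")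
    case True
    then have "\<not> bval step_cond s2" using c by blast
    then have "t = s2" unfolding t by (simp only: run.simps(1,4) if_False)
    then show ?thesis using True Inv d e2 by (simp add: settled_def L_def D_def)
  next
    case False
    then have "bval step_cond s2" using c by blast
    then have tq: "t = run step_body s2" unfolding t by (simp only: run.simps(4)[of step_cond] if_True)
    have q: "bval (Neg (Less (pwgt $ cur) (thr $ cur))) s2 \<longleftrightarrow> a p \<le> weight (part L p)"
      using pw[OF pick(1)] b2 by (auto simp: base_def p_def)
    have "p < k \<and> part L k \<noteq> {}"
      using False pick unfolding settled_def L_def[symmetric] D_def[symmetric] by (metis order_less_le)
    then have pk: "p < k" "p \<notin> D" "\<And>j. \<lbrakk>j < k; j \<notin> D\<rbrakk> \<Longrightarrow> a j \<le> a p" and R: "part L k \<noteq> {}"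
      using pick by auto
    have finp: "fin k ((s finished)(p := 1)) = insert p D" using pk by (auto simp: fin_def D_def)
    show ?thesis
    proof (cases "a p \<le> weight (part L p)")
      case True
      then have "t = run (Set finished (Var cur) (Const 1)) s2"
        unfolding tq by (simp only: run.simps(4) q if_True)
      then have tt: "t = upd s2 finished p 1" by (simp add: p_def)
      then have "t finished = (s finished)(p := 1)" "t label = L" using e2 by (simp_all add: fun_upd_def)
      then show ?thesis
        using finp Inv_finish[OF Inv pk True] potI[of t] pk d False by simp
    next
      case light: False
      then have td: "t = run step_main s2"
        unfolding tq by (simp only: run.simps(4)[of "Neg (Less (pwgt $ cur) (thr $ cur))"] q if_False)
      have wp: "weight (part L p) < a p" using light by simp
      define s3 where "s3 = run Roots s2"
      define s4 where "s4 = run Search s3"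
      define s5 where "s5 = run Contract s4"
      define s6 where "s6 = run Split s5"
      define s7 where "s7 = run (When (Neg (Pos (Var evt))) Grow) s6"
      have t7: "t = run (When (Pos (Var evt)) Renew) s7"
        by (simp only: td s3_def s4_def s5_def s6_def s7_def block.simps run.simps(1,3))
      \<comment> \<open>None of the four analysing programs writes these arrays, so all their
        results refer to the same labelling \<open>L\<close> and the same \<open>D\<close>.\<close>
      let ?K = "{numV, numK, numE, wgt, src, dst, thr, capa, label, finished, pwgt, cur}"
      have "mods Roots \<inter> ?K = {}" "mods Search \<inter> ?K = {}" "mods Contract \<inter> ?K = {}" "mods Split \<inter> ?K = {}"
        by (simp_all add: program_defs)
      moreover have "run q s' l = s' l" if "mods q \<inter> ?K = {}" "l \<in> ?K" for q s' l
        by (rule run_frame) (use that in blast)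
      ultimately have K: "s3 l = s2 l" "s4 l = s2 l" "s5 l = s2 l" "s6 l = s2 l" if "l \<in> ?K" for l
        using that unfolding s6_def s5_def s4_def s3_def by (simp_all only:)
      have b3: "base s3" and b4: "base s4" and b5: "base s5" and b6: "base s6"
        by (rule base_agree[OF b2], rule K, blast)+
      have lab: "s3 label = L" "s4 label = L" "s5 label = L" "s6 label = L"
        and fi: "s3 finished = s finished" "s4 finished = s finished" "s5 finished = s finished" "s6 finished = s finished"
        and pw5: "s5 pwgt = s2 pwgt" "s6 pwgt = s2 pwgt" and cur6: "s6 cur 0 = p"
        using e2 by (simp_all add: K p_def)
      have s6fr: "s6 l = s5 l" if "l \<notin> {ctrV, ctrI, evt, sel, inX, newlab}" for l
        unfolding s6_def by (rule run_frame) (use that in \<open>simp add: program_defs\<close>)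
      have f3: "forest L D (s3 seen) (s3 parent) (s3 order) (s3 numO 0) (s3 root)"
        unfolding s3_def
        by (rule run_Roots[OF b2, unfolded e2 D_def[symmetric]]) (use Lk d Inv_D(3)[OF Inv] in auto)
      have r4: "s4 root = s3 root"
        unfolding s4_def by (rule run_frame) (simp add: program_defs)
      have f4: "forest L D (s4 seen) (s4 parent) (s4 order) (s4 numO 0) (s4 root)"
        "s4 order ` {..<s4 numO 0} = {v. v < n \<and> L v \<in> D}"
        unfolding r4 unfolding s4_def
        by (rule run_Search[OF b3, unfolded lab, OF f3]; rule Inv_D(4)[OF Inv]; assumption)+
      have heavy: "\<forall>i\<in>D. a i \<le> weight (part L i)" using Inv_D(2)[OF Inv] by blast
      obtain pc where con: "contracted L D (s4 order) (s4 root) 0 (s5 top) pc (s5 clw) (s5 centred) (s5 centre)"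
        and pid: "\<forall>u<n. s5 pid u = (if L u \<in> D \<and> s5 top u \<noteq> s5 centre (L u) then s5 top u else pc u)"
        by (rule run_Contract[OF b4, unfolded lab fi D_def[symmetric], OF Lk d f4(1) refl f4(2) heavy])
          (simp_all add: s5_def)
      note cc = centre_cluster[OF f4(1) f4(2) heavy con]
      let ?S = "\<lambda>i. cluster (s5 top) (s5 centre i)"
      \<comment> \<open>The truncated subtraction is exact because the centre's cluster lies in its
        part.\<close>
      have diff: "s5 pwgt i - s5 clw (s5 centre i) = weight (part L i - ?S i)" if "i \<in> D" for i
        using that cc(2,4)[OF that] pw[of i] Inv_D(1)[OF Inv that] pw5
        by (simp add: sum_diff_nat)
      note split = run_Split[OF b5, unfolded fi D_def[symmetric], folded s6_def]
      have ev: "0 < s7 evt 0 \<Longrightarrow> s7 label = L \<and> event L D p (marked (s7 inX)) (s7 newlab 0)"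
        and noev: "s7 evt 0 = 0 \<Longrightarrow> Inv (s7 label) D \<and> card (part (s7 label) k) < card (part L k)"
      proof -
        have "(0 < s7 evt 0 \<longrightarrow> s7 label = L \<and> event L D p (marked (s7 inX)) (s7 newlab 0)) \<and>
          (s7 evt 0 = 0 \<longrightarrow> Inv (s7 label) D \<and> card (part (s7 label) k) < card (part L k))"
        proof (cases "0 < s6 evt 0")
          case True
          then have s7: "s7 = s6" by (simp add: s7_def)
          obtain i where i: "i \<in> D" "a i \<le> weight (part L i - ?S i)"
            and X: "\<forall>v<n. 0 < s6 inX v \<longleftrightarrow> s5 top v = s5 centre i"
            using split(2)[OF True] diff by auto
          have M: "marked (s6 inX) = ?S i" using X by (auto simp: marked_def cluster_def)
          have "part L i - ?S i \<noteq> {}" using i(2) a_pos[OF Inv_D(1)[OF Inv i(1)]] by fastforce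
          then obtain u where u: "u \<in> part L i - ?S i" by blast
          have "connected (part L i - ?S i)" using cc(6,7)[OF i(1) u] by simp
          then have "event L D p (?S i) k"
            using split_event[OF Inv pk wp i(1) cc(2)[OF i(1)] cc(3)[OF i(1)]] cc(4,5)[OF i(1)] i(2) by simp
          then show ?thesis using True s7 lab split(1) M by simp
        next
          case False
          then have s7: "s7 = run Grow s6" by (simp add: s7_def)
          have "pieces L D (s5 centre) (s5 pid)"
            by (rule contracted_pieces[OF f4(1) f4(2) heavy con _ Inv_D(4)[OF Inv] pid])
              (use split(3) diff False in auto)
          then have pcs: "pieces L D (s6 centre) (s6 pid)" using s6fr by simp
          have pw6: "\<forall>i<k. s6 pwgt i = weight (part L i)" using pw pw5 by simp
          note grow = run_Grow[OF Inv pk wp b6, unfolded fi D_def[symmetric]]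
          show ?thesis
            unfolding s7
          proof (intro conjI[OF impI impI])
            show "run Grow s6 label = L \<and> event L D p (marked (run Grow s6 inX)) (run Grow s6 newlab 0)"
              if "0 < run Grow s6 evt 0"
              by (rule grow(1)) (use that d cur6 lab split(1) pcs pw6 R False in simp_all)
            show "Inv (run Grow s6 label) D \<and> card (part (run Grow s6 label) k) < card (part L k)"
              if "run Grow s6 evt 0 = 0"
              by (rule grow(2)) (use that d cur6 lab split(1) pcs pw6 R False in simp_all)
          qed
        qed
        then show "0 < s7 evt 0 \<Longrightarrow> s7 label = L \<and> event L D p (marked (s7 inX)) (s7 newlab 0)"
          and "s7 evt 0 = 0 \<Longrightarrow> Inv (s7 label) D \<and> card (part (s7 label) k) < card (part L k)" by auto
      qed
      have s7fr: "s7 l = s6 l" if "l \<notin> {ctrV, ctrR, ctrE, inX, sel, wX, stop, evt, newlab, label, curY, pwgt, found, foundX, foundY}" for l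
        unfolding s7_def by (rule run_frame) (use that in \<open>simp add: program_defs\<close>)
      have b7: "base s7" by (rule base_agree[OF b6]) (auto intro!: s7fr)
      have f7: "s7 finished = s finished" "s7 cur 0 = p" using s7fr fi cur6 by simp_all
      show ?thesis
      proof (cases "0 < s7 evt 0")
        case True
        then have tr: "t = run Renew s7" using t7 by simp
        have "Inv (t label) (insert p D)" "t finished = (s finished)(p := 1)"
          unfolding tr by (rule run_Renew[OF Inv pk wp b7, unfolded f7 D_def[symmetric]]; use d ev[OF True] in simp)+
        then show ?thesis using finp potI[of t] pk d False by simp
      next
        case noevt: False
        then have t: "t = s7" using t7 by simp
        have "card (part (s7 label) k) < card (part L k)" "Inv (s7 label) D" using noev noevt by auto
        moreover have "card (part L k) \<le> n"
          using card_mono[OF _ part_bound[of L k]] by simp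
        ultimately show ?thesis
          using d f7 False by (simp add: t potential_def D_def[symmetric] L_def)
      qed
    qed
  qed
  then show "Inv (t label) (fin k (t finished))" "t finished k = 0"
    "settled s \<Longrightarrow> settled t" "\<not> settled s \<Longrightarrow> potential s < potential t" by auto
qed

lemma run_Loop:
  assumes s: "base s" and Inv: "Inv (s label) (fin k (s finished))" and d: "s finished k = 0"
    and r: "s rounds 0 = (k + 1) * (n + 1)"
  defines "t \<equiv> run Loop s"
  shows "base t" "Inv (t label) (fin k (t finished))" "settled t" "t finished k = 0"
proof -
  define I where "I = (\<lambda>j (s'::state). base s' \<and> Inv (s' label) (fin k (s' finished)) \<and> s' finished k = 0 \<and>
    (settled s' \<or> j \<le> potential s'))"
  have "I (s rounds 0) t" unfolding t_def Loop_def
  proof (rule run_For)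
    show "ctrP \<notin> mods Step" by (simp add: program_defs)
    show "I 0 (upd s ctrP 0 0)"
      using s Inv d by (simp add: I_def base_def)
    fix j s'
    assume j: "I j s'"
    have I_upd: "I i (upd s'' ctrP 0 x) \<longleftrightarrow> I i s''" for i s'' x
      by (simp add: I_def base_def settled_def potential_def)
    have "I (Suc j) (run Step s')"
      using run_Step[of s'] j unfolding I_def by fastforce
    then show "I (Suc j) (upd (run Step s') ctrP 0 (Suc j))" by (simp only: I_upd)
  qed
  then have I: "I ((k + 1) * (n + 1)) t" using r by simp
  have "card (fin k (t finished)) \<le> k"
    using card_mono[of "{..<k}" "fin k (t finished)"] by (auto simp: fin_def)
  then have "card (fin k (t finished)) * (n + 1) \<le> k * (n + 1)" by (rule mult_le_mono1)
  \<comment> \<open>The potential is at most \<open>k * (n + 1) + n\<close>, one below the number of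
    rounds, so the final state must be settled.\<close>
  then have "potential t < (k + 1) * (n + 1)" by (simp add: potential_def)
  then show "base t" "Inv (t label) (fin k (t finished))" "settled t" "t finished k = 0"
    using I by (auto simp: I_def)
qed

end

section \<open>Two phases\<close>

text \<open>The first phase reaches a third of every target without exceeding any of them. The second one
  covers the rest. All weights are tripled to keep the thresholds integral.\<close>

abbreviation (input) phase1_thresholds where
  "phase1_thresholds \<equiv> For ctrI numK (block
     [Set thr (Var ctrI) (2 $ ctrI),
      Set capa (Var ctrI) (Plus (2 $ ctrI) (Plus (2 $ ctrI) (2 $ ctrI))),
      Set finished (Var ctrI) (Const 0)])"

definition Phase1 :: prog where
  "Phase1 = Then phase1_thresholds Loop"

abbreviation (input) maximum_body where
  "maximum_body \<equiv> When (Less (Var selW) (2 $ ctrI)) (Let selW (2 $ ctrI))"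

definition Maximum :: prog where
  "Maximum = Then (Let selW (Const 0)) (For ctrI numK maximum_body)"

abbreviation (input) phase2_body where
  "phase2_body \<equiv> block
     [Set thr (Var ctrI) (Plus (2 $ ctrI) (Plus (2 $ ctrI) (2 $ ctrI))),
      Set capa (Var ctrI) (Plus (thr $ ctrI) (Plus (thr $ ctrI) (thr $ ctrI))),
      When (Less (capa $ ctrI) (Plus (Var selW) (Plus (Var selW) (Var selW))))
      (Set capa (Var ctrI) (Plus (Var selW) (Plus (Var selW) (Var selW)))),
      Set finished (Var ctrI) (Const 0)]"

definition Phase2 :: prog where
  "Phase2 = Then Maximum (Then (For ctrI numK phase2_body) Loop)"

lemma (in thresholds) weight_parts:
  assumes "\<forall>v<n. L v \<le> k"
  shows "(\<Sum>v<n. wt v) = (\<Sum>i<k. weight (part L i)) + weight (part L k)"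
proof -
  have "(\<Sum>i\<le>k. weight {v \<in> {..<n}. L v = i}) = (\<Sum>v<n. wt v)"
    by (rule sum.group) (use assms in auto)
  then show ?thesis by (simp add: part_def lessThan_Suc_atMost[symmetric])
qed

lemma run_two_phases:
  fixes n k m :: nat and wt F T W :: "nat \<Rightarrow> nat" and s :: state
  assumes arc_bound: "\<And>e. e < m \<Longrightarrow> F e < n \<and> T e < n"
    and arc_sym: "\<And>e. e < m \<Longrightarrow> \<exists>e'<m. F e' = T e \<and> T e' = F e"
    and kconn: "\<And>X. \<lbrakk>X \<subseteq> {..<n}; card X < k\<rbrakk> \<Longrightarrow> conn (\<lambda>x y. \<exists>e<m. F e = x \<and> T e = y) ({..<n} - X)"
    and kn: "k < n"
    and wt: "\<And>v. v < n \<Longrightarrow> 1 \<le> wt v" "\<And>v i. \<lbrakk>v < n; i < k\<rbrakk> \<Longrightarrow> wt v \<le> 3 * W i"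
    and W: "\<And>i. i < k \<Longrightarrow> 1 \<le> W i" and total: "(\<Sum>v<n. wt v) = (\<Sum>i<k. 3 * W i)"
    and s: "s numV 0 = n" "s numK 0 = k" "s numE 0 = m" "s wgt = wt" "s src = F" "s dst = T"
      "s thr k = 0" "s capa k = 0" "s finished k = 0" "\<forall>v<n. s label v = k" "\<forall>i<k. s 2 i = W i"
      "s rounds 0 = (k + 1) * (n + 1)"
  defines "t \<equiv> run (Then Phase1 Phase2) s"
  defines "A \<equiv> \<lambda>i. {v. v < n \<and> t label v = i}"
  shows "\<forall>v<n. t label v < k"
    and "i < k \<Longrightarrow> conn (\<lambda>x y. \<exists>e<m. F e = x \<and> T e = y) (A i)"
    and "i < k \<Longrightarrow> W i \<le> sum wt (A i)"
    and "i < k \<Longrightarrow> sum wt (A i) \<le> max (9 * W i) (3 * Max (W ` {..<k}))"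
proof -
  define s1 where "s1 = run phase1_thresholds s"
  define s2 where "s2 = run Loop s1"
  define s3 where "s3 = run Maximum s2"
  define s4 where "s4 = run (For ctrI numK phase2_body) s3"
  have t: "t = run Loop s4"
    by (simp only: t_def Phase1_def Phase2_def run.simps(3) s1_def s2_def s3_def s4_def)
  have s1fr: "s1 l = s l" if "l \<notin> {ctrI, thr, capa, finished}" for l
    unfolding s1_def by (rule run_frame) (use that in simp)
  have s2fr: "s2 l = s1 l" if "l \<in> {numV, numK, numE, wgt, src, dst, thr, capa, rounds, 2}" for l
  proof -
    have "mods Loop \<inter> {numV, numK, numE, wgt, src, dst, thr, capa, rounds, 2} = {}"
      by (simp add: program_defs)
    then show ?thesis unfolding s2_def using that by (intro run_frame) blast
  qed
  have s3fr: "s3 l = s2 l" if "l \<notin> {ctrI, selW}" for l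
    unfolding s3_def by (rule run_frame) (use that in \<open>simp add: Maximum_def\<close>)
  have s4fr: "s4 l = s3 l" if "l \<notin> {ctrI, thr, capa, finished}" for l
    unfolding s4_def by (rule run_frame) (use that in simp)
  define M where "M = Max (W ` {..<k})"
  have WM: "W i \<le> M" if "i < k" for i using that by (simp add: M_def)
  define I where "I = (\<lambda>j (s'::state). (\<forall>i<j. s' thr i = W i \<and> s' capa i = 3 * W i \<and> s' finished i = 0) \<and>
    s' thr k = 0 \<and> s' capa k = 0 \<and> s' finished k = 0)"
  have "I (s numK 0) s1" unfolding s1_def
    by (rule run_For) (use s in \<open>auto simp: I_def less_Suc_eq\<close>)
  then have s1: "\<forall>i<k. s1 thr i = W i \<and> s1 capa i = 3 * W i \<and> s1 finished i = 0"
    "s1 thr k = 0" "s1 capa k = 0" "s1 finished k = 0"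
    using s by (auto simp: I_def)
  \<comment> \<open>With \<open>big\<close> false the unfinished parts stay empty, so capacities
    need not exceed the targets \<open>3 * W i\<close>.\<close>
  interpret p1: thresholds n k m wt F T "s1 thr" "s1 capa" "\<lambda>i. 3 * W i" "\<lambda>_. 0" False
    by unfold_locales (use assms(1-8) s1 in auto)
  have b1: "p1.base s1" using s s1fr by (simp add: p1.base_def)
  have empty: "p1.part (s1 label) i = {}" if "i < k" for i
    using s(10) s1fr that by (auto simp: p1.part_def)
  have fin1: "fin k (s1 finished) = {}" using s1 by (auto simp: fin_def)
  have "p1.Inv (s1 label) (fin k (s1 finished))"
    using empty s(10) s1fr by (auto simp: p1.Inv_def fin1)
  from p1.run_Loop[OF b1 this s1(4)] have L1: "p1.base s2" "p1.Inv (s2 label) (fin k (s2 finished))"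
    "p1.settled s2" "s2 finished k = 0"
    using s1fr s by (simp_all add: s2_def)
  let ?D = "fin k (s2 finished)"
  have "?D = {..<k}"
  proof (rule ccontr)
    assume D: "?D \<noteq> {..<k}"
    have Dk: "?D \<subseteq> {..<k}" by (auto simp: fin_def)
    then obtain p where p: "p < k" "p \<notin> ?D" using D by blast
    have "p1.part (s2 label) k = {}" using L1(3) D by (simp add: p1.settled_def)
    then have "(\<Sum>v<n. wt v) = (\<Sum>i<k. p1.weight (p1.part (s2 label) i))"
      using p1.weight_parts[of "s2 label"] L1(2) by (simp add: p1.Inv_def)
    also have "\<dots> < (\<Sum>i<k. 3 * W i)"
    proof (rule sum_strict_mono_ex1)
      show "\<forall>i\<in>{..<k}. p1.weight (p1.part (s2 label) i) \<le> 3 * W i"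
        using L1(2) s1 by (auto simp: p1.Inv_def)
      \<comment> \<open>The last clause of the invariant with \<open>big\<close> false; the missing
        weight of this part contradicts the total.\<close>
      have "p1.part (s2 label) p = {}" using L1(2) p by (auto simp: p1.Inv_def)
      then show "\<exists>i\<in>{..<k}. p1.weight (p1.part (s2 label) i) < 3 * W i"
        using p W[of p] by (intro bexI[of _ p]) auto
    qed simp
    finally show False using total by simp
  qed
  then have half: "W i \<le> p1.weight (p1.part (s2 label) i)" "p1.weight (p1.part (s2 label) i) \<le> 3 * W i"
    if "i < k" for i
    using L1(2) that s1 by (auto simp: p1.Inv_def)
  define J where "J = (\<lambda>j (s'::state). (\<forall>i<j. W i \<le> s' selW 0) \<and> (s' selW 0 = 0 \<or> (\<exists>i<k. s' selW 0 = W i)))"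
  have "J (upd s2 selW 0 0 numK 0) (run (For ctrI numK maximum_body) (upd s2 selW 0 0))"
  proof (rule run_For, goal_cases)
    show "J 0 (upd (upd s2 selW 0 0) ctrI 0 0)" by (simp add: J_def)
  next
    case (3 j s')
    note j = 3(1-3) and fr = 3(4)
    have e: "s' 2 j = W j" "j < k" using fr j s2fr s1fr s by simp_all
    show ?case
      using j(2) e by (auto simp: J_def j(3) less_Suc_eq)
  qed simp
  then have J: "J k s3" using s2fr s1fr s by (simp add: s3_def Maximum_def)
  have k0: "k \<noteq> 0"
    using total kn wt(1) by (cases k) auto
  have "s3 selW 0 = M"
  proof (rule antisym)
    have "M \<in> W ` {..<k}" unfolding M_def by (rule Max_in) (use k0 in auto)
    then show "M \<le> s3 selW 0" using J by (auto simp: J_def)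
    show "s3 selW 0 \<le> M" using J WM by (auto simp: J_def)
  qed
  define I2 where "I2 = (\<lambda>j (s'::state).
    (\<forall>i<j. s' thr i = 3 * W i \<and> s' capa i = max (9 * W i) (3 * M) \<and> s' finished i = 0) \<and>
    s' thr k = 0 \<and> s' capa k = 0 \<and> s' finished k = 0)"
  have "I2 (s3 numK 0) s4" unfolding s4_def
  proof (rule run_For, goal_cases)
    show "I2 0 (upd s3 ctrI 0 0)" using s3fr s2fr s1 L1(4) by (simp add: I2_def)
  next
    case (3 j s')
    note j = 3(1-3) and fr = 3(4)
    have e: "s' 2 j = W j" "s' selW 0 = M" "j < k" using fr j s3fr s2fr s1fr s \<open>s3 selW 0 = M\<close> by simp_all
    show ?case
      using j(2) e(3) by (auto simp: I2_def e(1,2) j(3) less_Suc_eq)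
  qed simp
  then have s4: "\<forall>i<k. s4 thr i = 3 * W i \<and> s4 capa i = max (9 * W i) (3 * M) \<and> s4 finished i = 0"
    "s4 thr k = 0" "s4 capa k = 0" "s4 finished k = 0"
    using s3fr s2fr s1fr s by (auto simp: I2_def)
  \<comment> \<open>In the capacity, \<open>9 * W i\<close> provides three times the threshold and
    \<open>3 * M\<close> dominates all thresholds, as \<open>big\<close> requires. The outcome
    \<open>W i\<close> of the first phase becomes the lower bound \<open>lo\<close>.\<close>
  interpret p2: thresholds n k m wt F T "s4 thr" "s4 capa" "\<lambda>i. 3 * W i" W True
    by unfold_locales (use assms(1-8) s4 WM in \<open>auto simp: le_max_iff_disj\<close>)
  have b4: "p2.base s4" using s s1fr s2fr s3fr s4fr by (simp add: p2.base_def)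
  have fin4: "fin k (s4 finished) = {}" using s4 by (auto simp: fin_def)
  have lab4: "s4 label = s2 label" using s4fr s3fr by simp
  have "p2.Inv (s4 label) (fin k (s4 finished))"
    unfolding p2.Inv_def fin4 lab4
  proof (intro conjI ballI allI impI)
    fix i assume i: "i < k"
    show "p1.weight (p1.part (s2 label) i) \<le> s4 capa i"
      using half(2)[OF i] s4 i by (auto simp: le_max_iff_disj)
    show "p1.part (s2 label) i \<noteq> {} \<Longrightarrow> p1.connected (p1.part (s2 label) i)"
      using L1(2) i by (auto simp: p1.Inv_def)
  qed (use L1(2) half in \<open>auto simp: p1.Inv_def\<close>)
  from p2.run_Loop[OF b4 this s4(4)] have L2: "p2.Inv (t label) (fin k (t finished))" "p2.settled t"
    using s s1fr s2fr s3fr s4fr by (simp_all add: t)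
  have A: "p2.part (t label) = A" by (simp add: A_def p2.part_def fun_eq_iff)
  have parts: "(\<Sum>v<n. wt v) = (\<Sum>i<k. sum wt (A i)) + sum wt (A k)"
    using p2.weight_parts[of "t label"] L2(1) A by (simp add: p2.Inv_def)
  have rest: "A k = {}"
  proof (rule ccontr)
    assume ne: "A k \<noteq> {}"
    then have "fin k (t finished) = {..<k}" using L2(2) A by (simp add: p2.settled_def)
    then have "3 * W i \<le> sum wt (A i)" if "i < k" for i
      using L2(1) that s4(1) A by (auto simp: p2.Inv_def)
    then have "(\<Sum>i<k. 3 * W i) \<le> (\<Sum>i<k. sum wt (A i))" by (intro sum_mono) auto
    moreover have "1 \<le> sum wt (A k)" by (rule p2.weight_pos) (use ne in \<open>auto simp: A_def\<close>)
    ultimately show False using parts total by simp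
  qed
  show "\<forall>v<n. t label v < k"
  proof (intro allI impI)
    fix v assume v: "v < n"
    then have "t label v \<le> k" using L2(1) by (auto simp: p2.Inv_def)
    moreover have "t label v \<noteq> k" using rest v by (auto simp: A_def)
    ultimately show "t label v < k" by simp
  qed
  assume i: "i < k"
  show lo: "W i \<le> sum wt (A i)" using L2(1) i A by (auto simp: p2.Inv_def)
  show "sum wt (A i) \<le> max (9 * W i) (3 * Max (W ` {..<k}))"
    using L2(1) i A s4(1) by (auto simp: p2.Inv_def M_def)
  have "A i \<noteq> {}" using lo W[OF i] by auto
  then show "conn (\<lambda>x y. \<exists>e<m. F e = x \<and> T e = y) (A i)"
    using L2(1) i A unfolding p2.Inv_def p2.adj_def by auto
qed

section \<open>Graphs given by lists\<close>

lemma rtrancl_leaves: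
  assumes "(u, v) \<in> r\<^sup>*" "u \<in> S" "v \<notin> S"
  shows "\<exists>x\<in>S. \<exists>y. y \<notin> S \<and> (x, y) \<in> r"
  using assms by (induction rule: rtrancl_induct) blast+

text \<open>With the vertex list for \<open>f\<close>, this passes from paths between vertices to
  cuts between positions. A path must leave any cut that separates its ends; conversely, the set
  reachable from \<open>f u\<close> is a cut without leaving edge unless it is everything.\<close>

lemma connected_graph_iff_conn:
  assumes inj: "inj_on f S"
  shows "connected_graph (f ` S) (induced_edges E (f ` S)) \<longleftrightarrow> conn (\<lambda>x y. {f x, f y} \<in> E) S"
    (is "?C \<longleftrightarrow> ?D")
proof
  let ?r = "{(x, y). {x, y} \<in> induced_edges E (f ` S)}"
  assume C: ?C
  show ?D
  proof (rule connI)
    show "S \<noteq> {}" using C by (auto simp: connected_graph_def)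
    fix U assume U: "U \<subseteq> S" "U \<noteq> {}" "U \<noteq> S"
    then obtain u v where uv: "u \<in> U" "v \<in> S" "v \<notin> U" by blast
    have "(f u, f v) \<in> ?r\<^sup>*" using C uv U by (auto simp: connected_graph_def)
    moreover have "f v \<notin> f ` U" using inj uv U by (auto dest: inj_onD)
    ultimately obtain x y where "x \<in> U" "y \<notin> f ` U" "(f x, y) \<in> ?r"
      using rtrancl_leaves[of "f u" "f v" ?r "f ` U"] uv by blast
    then show "\<exists>x\<in>U. \<exists>y\<in>S - U. {f x, f y} \<in> E"
      by (auto simp: induced_edges_def)
  qed
next
  let ?r = "{(x, y). {x, y} \<in> induced_edges E (f ` S)}"
  assume D: ?D
  have "(f u, f v) \<in> ?r\<^sup>*" if uv: "u \<in> S" "v \<in> S" for u v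
  proof (rule ccontr)
    assume nv: "(f u, f v) \<notin> ?r\<^sup>*"
    define U where "U = {x \<in> S. (f u, f x) \<in> ?r\<^sup>*}"
    have "U \<inter> S \<noteq> {}" "\<not> S \<subseteq> U" using uv nv by (auto simp: U_def)
    then obtain x y where "x \<in> S \<inter> U" "y \<in> S - U" "{f x, f y} \<in> E"
      using conn_cut[OF D] by blast
    then have "(f u, f x) \<in> ?r\<^sup>*" "(f x, f y) \<in> ?r" "y \<in> S" "y \<notin> U"
      by (auto simp: U_def induced_edges_def)
    then show False by (auto simp: U_def intro: rtrancl.rtrancl_into_rtrancl)
  qed
  then show ?C using conn_nonempty[OF D] by (auto simp: connected_graph_def)
qed

lemma conn_cong:
  assumes "\<And>x y. \<lbrakk>x \<in> S; y \<in> S\<rbrakk> \<Longrightarrow> R x y = R' x y"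
  shows "conn R S = conn R' S"
proof -
  have "(\<exists>x\<in>U. \<exists>y\<in>S - U. R x y) = (\<exists>x\<in>U. \<exists>y\<in>S - U. R' x y)" if "U \<subseteq> S" for U
    by (intro bex_cong refl) (use assms that in auto)
  then show ?thesis by (simp add: conn_def)
qed

section \<open>The complete program\<close>

abbreviation (input) "numM \<equiv> 18 :: nat"

definition Sizes :: prog where
  "Sizes = block
    [Let numV (Cell 0 (Const 0)), Let numM (Cell 0 (Const 1)), Let numK (Cell 0 (Const 2)),
     Let numE (Plus (Var numM) (Var numM))]"

abbreviation (input) setup_vertex where
  "setup_vertex \<equiv> block
     [Set wgt (Var ctrV) (Plus (1 $ ctrV) (Plus (1 $ ctrV) (1 $ ctrV))),
      Set label (Var ctrV) (Var numK)]"

abbreviation (input) setup_edge where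
  "setup_edge \<equiv> block
     [Set src (Var ctrE) (3 $ ctrE), Set dst (Var ctrE) (4 $ ctrE),
      Set src (Plus (Var numM) (Var ctrE)) (4 $ ctrE),
      Set dst (Plus (Var numM) (Var ctrE)) (3 $ ctrE)]"

text \<open>The machine has no multiplication, so \<open>(k + 1) * (n + 1)\<close> is built by
  repeated addition.\<close>

abbreviation (input) setup_round where
  "setup_round \<equiv> Let rounds (Plus (Var rounds) (Plus (Var numV) (Const 1)))"

definition Setup :: prog where
  "Setup = block
    [For ctrV numV setup_vertex,
     For ctrE numM setup_edge,
     Let rounds (Plus (Var numV) (Const 1)),
     For ctrI numK setup_round]"

text \<open>Compiled in three pieces because the static cost needs loop bounds that the program
  using them does not write: the sizes are set before \<open>Setup\<close> loops over them, and
  \<open>rounds\<close> before the phases do.\<close>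

definition whole_program :: com where
  "whole_program = Seq (compile Sizes) (Seq (compile Setup) (compile (Then Phase1 Phase2)))"

section \<open>Evaluation of the static cost\<close>

lemma bcost_Eq [simp]: "bcost (Eq e1 e2) = 5 + 2 * acost e1 + 2 * acost e2"
  by (simp add: Eq_def)

text \<open>The mixed term comes from the \<open>numV\<close> rounds of arc scans in searching,
  growing and trimming, the square from the vertex loops nested in contraction and growth.\<close>

lemma cost_Step:
  "cost N Step = 268 + 128 * N numK + 657 * N numV + 151 * (N numV * N numV) + 208 * (N numV * N numE)"
  by (simp add: program_defs algebra_simps)

lemma cost_Setup: "cost N Setup = 34 + 32 * N numV + 43 * N numM + 21 * N numK"
  by (simp add: Setup_def algebra_simps)

text \<open>With at least as many arcs as vertices, \<open>n * e\<close> dominates every term of a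
  round. The factor 4 below comes from doubling both factors of \<open>(k + 1) * (n + 1)\<close>;
  the loop then counts twice, and 20000 rounds up the sum.\<close>

lemma cost_phases_le:
  assumes k: "1 \<le> N numK" "N numK \<le> N numV" and nm: "N numV \<le> N numE"
    and r: "N rounds = (N numK + 1) * (N numV + 1)"
  shows "cost N (Then Phase1 Phase2) \<le> 20000 * (N numK * ((N numV)\<^sup>2 * N numE))"
proof -
  define k' n e where "k' = N numK" and "n = N numV" and "e = N numE"
  have pos: "1 \<le> k'" "1 \<le> n" "1 \<le> e" "k' \<le> n" "n \<le> e" using assms by (auto simp: k'_def n_def e_def)
  define z where "z = n * e"
  have "n * n \<le> z" "1 \<le> z" "n \<le> z" "k' \<le> z"
    using pos by (auto simp: z_def intro: order_trans[OF \<open>k' \<le> n\<close>])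
  \<comment> \<open>1412 is the sum of the coefficients in \<open>cost_Step\<close>.\<close>
  then have step: "cost N Step \<le> 1412 * z"
    unfolding cost_Step k'_def[symmetric] n_def[symmetric] e_def[symmetric] z_def[symmetric] by linarith
  have "(k' + 1) * (n + 1) \<le> (2 * k') * (2 * n)" by (rule mult_mono) (use pos in auto)
  then have R: "N rounds \<le> 4 * (k' * n)" using r by (simp add: k'_def n_def)
  have "N rounds * (12 + cost N Step) \<le> (4 * (k' * n)) * (1424 * z)"
    by (rule mult_mono[OF R]) (use step \<open>1 \<le> z\<close> in linarith | simp)+
  also have "\<dots> = 5696 * (k' * n * z)" by simp
  finally have loop: "cost N Loop \<le> 9 + 5696 * (k' * n * z)"
    by (simp add: Loop_def)
  have "1 \<le> k' * n * z" "k' \<le> k' * n * z" using pos by (auto simp: z_def)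
  moreover have "cost N (Then Phase1 Phase2) = 2 * cost N Loop + cost N (Then Phase1 Phase2) - 2 * cost N Loop"
    by simp
  moreover have "cost N (Then Phase1 Phase2) \<le> 2 * cost N Loop + 100 + 200 * k'"
    by (simp add: Phase1_def Phase2_def Maximum_def k'_def)
  ultimately have "cost N (Then Phase1 Phase2) \<le> 20000 * (k' * n * z)"
    using loop by linarith
  then show ?thesis by (simp add: z_def k'_def n_def e_def power2_eq_square algebra_simps)
qed

lemma run_Sizes:
  "run Sizes s numV 0 = s 0 0" "run Sizes s numM 0 = s 0 1" "run Sizes s numK 0 = s 0 2"
  "run Sizes s numE 0 = 2 * s 0 1" "l \<notin> {numV, numM, numK, numE} \<Longrightarrow> run Sizes s l = s l"
  by (simp_all add: Sizes_def)

lemma run_Setup: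
  assumes s: "s numV 0 = n" "s numM 0 = m" "s numK 0 = k"
  defines "t \<equiv> run Setup s"
  shows "\<forall>v<n. t wgt v = 3 * s 1 v \<and> t label v = k"
    and "\<forall>e<m. t src e = s 3 e \<and> t dst e = s 4 e \<and> t src (m + e) = s 4 e \<and> t dst (m + e) = s 3 e"
    and "t rounds 0 = (k + 1) * (n + 1)"
    and "l \<notin> {ctrV, ctrE, ctrI, wgt, label, src, dst, rounds} \<Longrightarrow> t l = s l"
proof -
  define s1 where "s1 = run (For ctrV numV setup_vertex) s"
  define s2 where "s2 = run (For ctrE numM setup_edge) s1"
  define s3 where "s3 = upd s2 rounds 0 (s2 numV 0 + 1)"
  have t: "t = run (For ctrI numK setup_round) s3"
  proof -
    have "s3 = run (Let rounds (Plus (Var numV) (Const 1))) s2" by (simp add: s3_def)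
    then show ?thesis by (simp only: t_def Setup_def s2_def s1_def block.simps run.simps(1,3))
  qed
  have s1fr: "s1 l = s l" if "l \<notin> {ctrV, wgt, label}" for l
    unfolding s1_def by (rule run_frame) (use that in simp)
  have s2fr: "s2 l = s1 l" if "l \<notin> {ctrE, src, dst}" for l
    unfolding s2_def by (rule run_frame) (use that in simp)
  have tfr: "t l = s2 l" if "l \<notin> {ctrI, rounds}" for l
    using run_frame[of l "For ctrI numK setup_round" s3] that by (simp add: t s3_def)
  define I1 where "I1 = (\<lambda>j (s'::state). \<forall>v<j. s' wgt v = 3 * s 1 v \<and> s' label v = k)"
  have "I1 (s numV 0) s1" unfolding s1_def
  proof (rule run_For, goal_cases)
    case (3 j s')
    note j = 3(1-3) and fr = 3(4)
    have e: "s' (Suc 0) = s (Suc 0)" "s' numK 0 = k" using fr s by simp_all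
    show ?case
      using j(2) by (auto simp: I1_def e j(3) less_Suc_eq)
  qed (simp_all add: I1_def)
  then have I1: "\<forall>v<n. s1 wgt v = 3 * s 1 v \<and> s1 label v = k" using s by (simp add: I1_def)
  show "\<forall>v<n. t wgt v = 3 * s 1 v \<and> t label v = k"
    using I1 tfr s2fr by simp
  define I2 where "I2 = (\<lambda>j (s'::state). \<forall>e<j. s' src e = s 3 e \<and> s' dst e = s 4 e \<and>
    s' src (m + e) = s 4 e \<and> s' dst (m + e) = s 3 e)"
  have "I2 (s1 numM 0) s2" unfolding s2_def
  proof (rule run_For, goal_cases)
    case (3 j s')
    note j = 3(1-3) and fr = 3(4)
    have e: "s' 3 = s 3" "s' 4 = s 4" "s' numM 0 = m" "j < m" using fr s s1fr j by simp_all
    show ?case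
      using j(2) e(4) by (auto simp: I2_def e(1-3) j(3) less_Suc_eq)
  qed (simp_all add: I2_def)
  then have "I2 m s2" using s s1fr by simp
  then show "\<forall>e<m. t src e = s 3 e \<and> t dst e = s 4 e \<and> t src (m + e) = s 4 e \<and> t dst (m + e) = s 3 e"
    using tfr by (simp add: I2_def)
  have "t rounds 0 = (s3 numK 0 + 1) * (n + 1)" unfolding t
  proof (rule run_For[where I = "\<lambda>j s'. s' rounds 0 = (j + 1) * (n + 1)"])
    show "upd s3 ctrI 0 0 rounds 0 = (0 + 1) * (n + 1)"
      using s s1fr s2fr by (simp add: s3_def)
    fix j s'
    assume j: "s' rounds 0 = (j + 1) * (n + 1)" and fr: "\<And>l. l \<notin> insert ctrI (mods setup_round) \<Longrightarrow> s' l = s3 l"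
    have "s' numV 0 = n" using fr s s1fr s2fr by (simp add: s3_def)
    then show "upd (run setup_round s') ctrI 0 (Suc j) rounds 0 = (Suc j + 1) * (n + 1)"
      using j by simp
  qed simp
  then show "t rounds 0 = (k + 1) * (n + 1)" using s s1fr s2fr by (simp add: s3_def)
  show "l \<notin> {ctrV, ctrE, ctrI, wgt, label, src, dst, rounds} \<Longrightarrow> t l = s l"
    using tfr s1fr s2fr by simp
qed

lemma k_connected_conn:
  assumes kc: "k_connected k V E" and vs: "distinct vs" "set vs = V"
    and X: "X \<subseteq> {..<length vs}" "card X < k"
  shows "conn (\<lambda>x y. {vs ! x, vs ! y} \<in> E) ({..<length vs} - X)"
proof -
  have inj: "inj_on ((!) vs) {..<length vs}" using vs(1) by (simp add: inj_on_nth)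
  have V: "(!) vs ` {..<length vs} = V" using vs(2) by (auto simp: set_conv_nth)
  have "card ((!) vs ` X) < k"
    using card_image_le[of X "(!) vs"] X by (meson finite_lessThan finite_subset le_less_trans)
  moreover have "(!) vs ` X \<subseteq> V" using X V by blast
  ultimately have "connected_graph (V - (!) vs ` X) (induced_edges E (V - (!) vs ` X))"
    using kc by (simp add: k_connected_def)
  moreover have "V - (!) vs ` X = (!) vs ` ({..<length vs} - X)"
    using inj_on_image_set_diff[OF inj, of "{..<length vs}" X] X V by auto
  ultimately show ?thesis
    using connected_graph_iff_conn[of "(!) vs" "{..<length vs} - X" E] inj
    by (simp add: inj_on_subset)
qed

lemma lists_graph_arcs:
  assumes G: "lists_graph vs es V E"
    and arcs: "\<forall>e<length es. F e = fst (es ! e) \<and> T e = snd (es ! e) \<and>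
      F (length es + e) = snd (es ! e) \<and> T (length es + e) = fst (es ! e)"
  shows "e < 2 * length es \<Longrightarrow> F e < length vs \<and> T e < length vs"
    and "e < 2 * length es \<Longrightarrow> \<exists>e'<2 * length es. F e' = T e \<and> T e' = F e"
    and "\<lbrakk>x < length vs; y < length vs\<rbrakk> \<Longrightarrow>
      (\<exists>e<2 * length es. F e = x \<and> T e = y) \<longleftrightarrow> {vs ! x, vs ! y} \<in> E"
proof -
  let ?m = "length es"
  have d: "distinct vs" and E: "set (map (\<lambda>(a, b). {vs ! a, vs ! b}) es) = E"
    and bd: "\<And>i. i < ?m \<Longrightarrow> fst (es ! i) < length vs \<and> snd (es ! i) < length vs"
    using G by (fastforce simp: lists_graph_def dest: nth_mem)+
  have split: "e < ?m \<or> (\<exists>i<?m. e = ?m + i)" if "e < 2 * ?m" for e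
    using that by (cases "e < ?m") (auto intro: exI[of _ "e - ?m"])
  show "F e < length vs \<and> T e < length vs" if "e < 2 * ?m" for e
    using split[OF that] arcs bd by auto
  show "\<exists>e'<2 * ?m. F e' = T e \<and> T e' = F e" if "e < 2 * ?m" for e
    using split[OF that]
  proof
    assume "e < ?m"
    then show ?thesis using arcs by (intro exI[of _ "?m + e"]) auto
  next
    assume "\<exists>i<?m. e = ?m + i"
    then obtain i where "i < ?m" "e = ?m + i" by blast
    then show ?thesis using arcs by (intro exI[of _ i]) auto
  qed
  assume xy: "x < length vs" "y < length vs"
  show "(\<exists>e<2 * ?m. F e = x \<and> T e = y) \<longleftrightarrow> {vs ! x, vs ! y} \<in> E"
  proof
    assume "\<exists>e<2 * ?m. F e = x \<and> T e = y"
    then obtain e where e: "e < 2 * ?m" "F e = x" "T e = y" by blast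
    have "\<exists>i<?m. {vs ! x, vs ! y} = {vs ! fst (es ! i), vs ! snd (es ! i)}"
      using split[OF e(1)]
    proof
      assume "e < ?m"
      then show ?thesis using arcs e by (intro exI[of _ e]) auto
    next
      assume "\<exists>i<?m. e = ?m + i"
      then obtain i where "i < ?m" "e = ?m + i" by blast
      then show ?thesis using arcs e by (intro exI[of _ i]) auto
    qed
    then obtain i where i: "i < ?m" "{vs ! x, vs ! y} = {vs ! fst (es ! i), vs ! snd (es ! i)}"
      by blast
    then have "{vs ! x, vs ! y} = (\<lambda>(a, b). {vs ! a, vs ! b}) (es ! i)" by (simp add: case_prod_beta)
    then show "{vs ! x, vs ! y} \<in> E" using i(1) E by auto
  next
    assume "{vs ! x, vs ! y} \<in> E"
    then obtain i where i: "i < ?m" "{vs ! x, vs ! y} = {vs ! fst (es ! i), vs ! snd (es ! i)}"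
      unfolding E[symmetric] by (auto simp: set_conv_nth case_prod_beta)
    then consider "vs ! x = vs ! fst (es ! i)" "vs ! y = vs ! snd (es ! i)"
      | "vs ! x = vs ! snd (es ! i)" "vs ! y = vs ! fst (es ! i)"
      by (auto simp: doubleton_eq_iff)
    then show "\<exists>e<2 * ?m. F e = x \<and> T e = y"
    proof cases
      case 1
      then have "x = fst (es ! i)" "y = snd (es ! i)"
        using d xy bd[OF i(1)] by (auto simp: nth_eq_iff_index_eq)
      then show ?thesis using arcs i by (intro exI[of _ i]) auto
    next
      case 2
      then have "x = snd (es ! i)" "y = fst (es ! i)"
        using d xy bd[OF i(1)] by (auto simp: nth_eq_iff_index_eq)
      then show ?thesis using arcs i by (intro exI[of _ "?m + i"]) auto
    qed
  qed
qed

theorem theorem7: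
  "\<exists>(P :: com) (c :: nat).
     \<forall>(V :: 'a set) (E :: 'a set set) (w :: 'a \<Rightarrow> nat) (k :: nat) (W :: nat \<Rightarrow> nat)
       (vs :: 'a list) (es :: (nat \<times> nat) list) (r :: real).
       simple_graph V E \<longrightarrow>
       1 \<le> k \<longrightarrow>
       k_connected k V E \<longrightarrow>
       (\<forall>v\<in>V. 1 \<le> w v) \<longrightarrow>
       (\<forall>i<k. 1 \<le> W i) \<longrightarrow>
       (\<Sum>i<k. W i) = (\<Sum>v\<in>V. w v) \<longrightarrow>
       Min (W ` {..<k}) \<ge> Max (w ` V) \<longrightarrow>
       r = real (Max (W ` {..<k})) / real (Min (W ` {..<k})) \<longrightarrow>
       lists_graph vs es V E \<longrightarrow>
       (\<exists>t s. exec P (input_state vs es w k W) t s \<and>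
          t \<le> c * (k * (card V)\<^sup>2 * card E) \<and>
          connected_partition V E k (output_part vs s) \<and>
          (\<forall>i<k. 1 / 3 * real (W i) \<le> real (\<Sum>v\<in>output_part vs s i. w v) \<and>
                 real (\<Sum>v\<in>output_part vs s i. w v) \<le> max r 3 * real (W i)))"
\<comment> \<open>The phases cost 20000 per unit counted in arcs, which doubles because each edge
  gives two arcs; the preparation adds at most 230, and the sum is rounded up.\<close>
proof (rule exI[of _ whole_program], rule exI[of _ 41000], intro allI impI, goal_cases)
  case (1 V E w k W vs es r)
  note k = 1(2) and kc = 1(3) and w = 1(4) and W = 1(5) and sum = 1(6) and MinMax = 1(7) and r = 1(8)
    and G = 1(9)
  define n m where "n = length vs" and "m = length es"
  have vs: "distinct vs" "set vs = V" using G by (auto simp: lists_graph_def)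
  have cV: "card V = n" using vs distinct_card n_def by fastforce
  have "distinct (map (\<lambda>(a, b). {vs ! a, vs ! b}) es)" "set (map (\<lambda>(a, b). {vs ! a, vs ! b}) es) = E"
    using G by (simp_all add: lists_graph_def)
  then have cE: "card E = m" using distinct_card m_def by fastforce
  have kn: "k < n" using kc cV by (simp add: k_connected_def)
  have inV: "vs ! v \<in> V" if "v < n" for v using that vs n_def by auto
  have finV: "finite V" using vs by auto
  define s0 where "s0 = input_state vs es w k W"
  define s1 where "s1 = run Sizes s0"
  define s2 where "s2 = run Setup s1"
  define t where "t = run (Then Phase1 Phase2) s2"
  have s0: "s0 0 0 = n" "s0 0 1 = m" "s0 0 2 = k" "\<forall>v<n. s0 1 v = w (vs ! v)" "\<forall>i<k. s0 2 i = W i"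
    "\<forall>e<m. s0 3 e = fst (es ! e) \<and> s0 4 e = snd (es ! e)" "\<And>l. 4 < l \<Longrightarrow> s0 l = (\<lambda>_. 0)"
    by (auto simp: s0_def input_state_def cells_def n_def m_def)
  have s1: "s1 numV 0 = n" "s1 numM 0 = m" "s1 numK 0 = k" "s1 numE 0 = 2 * m"
    "\<And>l. l \<notin> {numV, numM, numK, numE} \<Longrightarrow> s1 l = s0 l"
    using run_Sizes[where s = s0, folded s1_def] s0 by auto
  note prepared = run_Setup[where s = s1 and n = n and m = m and k = k, OF s1(1-3), folded s2_def]
  have s2: "s2 numV 0 = n" "s2 numM 0 = m" "s2 numK 0 = k" "s2 numE 0 = 2 * m" "s2 rounds 0 = (k + 1) * (n + 1)"
    "\<forall>v<n. s2 wgt v = 3 * w (vs ! v)" "\<forall>v<n. s2 label v = k" "\<forall>i<k. s2 2 i = W i"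
    "s2 thr k = 0" "s2 capa k = 0" "s2 finished k = 0"
    "\<forall>e<m. s2 src e = fst (es ! e) \<and> s2 dst e = snd (es ! e) \<and>
      s2 src (m + e) = snd (es ! e) \<and> s2 dst (m + e) = fst (es ! e)"
    using prepared s1 s0 by simp_all
  define R where "R = (\<lambda>x y. \<exists>e<2 * m. s2 src e = x \<and> s2 dst e = y)"
  note arcs = lists_graph_arcs[OF G s2(12)[unfolded m_def], folded m_def n_def]
  have R: "R x y \<longleftrightarrow> {vs ! x, vs ! y} \<in> E" if "x < n" "y < n" for x y
    unfolding R_def by (rule arcs(3)[OF that])
  have conn: "conn R ({..<n} - X)" if "X \<subseteq> {..<n}" "card X < k" for X
  proof -
    have "conn R ({..<n} - X) = conn (\<lambda>x y. {vs ! x, vs ! y} \<in> E) ({..<n} - X)"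
      by (rule conn_cong) (simp add: R)
    then show ?thesis using k_connected_conn[OF kc vs] that n_def by simp
  qed
  have le: "w v \<le> W i" if "v \<in> V" "i < k" for v i
  proof -
    have "w v \<le> Max (w ` V)" using that finV by simp
    also have "\<dots> \<le> Min (W ` {..<k})" by (rule MinMax)
    also have "\<dots> \<le> W i" using that by simp
    finally show ?thesis .
  qed
  have bij: "bij_betw ((!) vs) {..<n} V"
    using bij_betw_nth[OF vs(1) refl, of V] vs n_def by simp
  have total: "(\<Sum>v<n. s2 wgt v) = (\<Sum>i<k. 3 * W i)"
  proof -
    have "(\<Sum>v<n. s2 wgt v) = (\<Sum>v<n. 3 * w (vs ! v))" using s2(6) by simp
    also have "\<dots> = 3 * (\<Sum>v\<in>V. w v)"
      using sum.reindex_bij_betw[OF bij, of w] by (simp add: sum_distrib_left[symmetric])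
    also have "\<dots> = (\<Sum>i<k. 3 * W i)" using sum by (simp add: sum_distrib_left[symmetric])
    finally show ?thesis .
  qed
  have wt: "\<And>v. v < n \<Longrightarrow> 1 \<le> s2 wgt v" "\<And>v i. \<lbrakk>v < n; i < k\<rbrakk> \<Longrightarrow> s2 wgt v \<le> 3 * W i"
    using s2(6) w inV le by (force, simp)
  note phases = run_two_phases[where F = "s2 src" and T = "s2 dst" and wt = "s2 wgt" and s = s2 and n = n
      and m = "2 * m" and k = k and W = W, OF arcs(1,2) conn[unfolded R_def] kn wt _ total s2(1,3,4) refl refl refl
      s2(9-11,7,8,5), folded t_def R_def]
  define A where "A = (\<lambda>i. {v. v < n \<and> t label v = i})"
  have A: "\<forall>v<n. t label v < k" "\<And>i. i < k \<Longrightarrow> conn R (A i)" "\<And>i. i < k \<Longrightarrow> W i \<le> sum (s2 wgt) (A i)"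
    "\<And>i. i < k \<Longrightarrow> sum (s2 wgt) (A i) \<le> max (9 * W i) (3 * Max (W ` {..<k}))"
    using phases W by (simp_all add: A_def)
  have out: "output_part vs t i = (!) vs ` A i" for i
    by (auto simp: output_part_def A_def n_def)
  have An: "A i \<subseteq> {..<n}" for i by (auto simp: A_def)
  have injA: "inj_on ((!) vs) (A i)" for i
    using bij An by (meson bij_betw_def inj_on_subset)
  have wA: "sum (s2 wgt) (A i) = 3 * (\<Sum>v\<in>output_part vs t i. w v)" for i
  proof -
    have "sum (s2 wgt) (A i) = (\<Sum>v\<in>A i. 3 * w (vs ! v))" using s2(6) by (intro sum.cong) (auto simp: A_def)
    also have "\<dots> = 3 * (\<Sum>v\<in>output_part vs t i. w v)"
      unfolding out by (simp add: sum.reindex[OF injA] sum_distrib_left)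
    finally show ?thesis .
  qed
  have part: "connected_partition V E k (output_part vs t)"
    unfolding connected_partition_def
  proof (intro conjI allI impI)
    show "(\<Union>i<k. output_part vs t i) = V"
      using A(1) vs by (auto simp: output_part_def n_def set_conv_nth)
    show "disjoint_family_on (output_part vs t) {..<k}"
      using vs(1) by (auto simp: disjoint_family_on_def output_part_def nth_eq_iff_index_eq)
    show "connected_graph (output_part vs t i) (induced_edges E (output_part vs t i))" if "i < k" for i
    proof -
      have "conn R (A i) = conn (\<lambda>x y. {vs ! x, vs ! y} \<in> E) (A i)"
        by (rule conn_cong) (use An R in blast)
      then show ?thesis unfolding out connected_graph_iff_conn[OF injA] using A(2)[OF that] by simp
    qed
  qed
  have bounds: "1 / 3 * real (W i) \<le> real (\<Sum>v\<in>output_part vs t i. w v) \<and>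
      real (\<Sum>v\<in>output_part vs t i. w v) \<le> max r 3 * real (W i)" if i: "i < k" for i
  proof -
    define x where "x = (\<Sum>v\<in>output_part vs t i. w v)"
    define M where "M = Max (W ` {..<k})"
    define M' where "M' = Min (W ` {..<k})"
    have lo: "W i \<le> 3 * x" using A(3)[OF i] wA by (simp add: x_def)
    have hi: "3 * x \<le> max (9 * W i) (3 * M)" using A(4)[OF i] wA by (simp add: x_def M_def)
    have "M' \<in> W ` {..<k}" unfolding M'_def by (rule Min_in) (use i in auto)
    then have M': "0 < M'" "M' \<le> W i" using W i by (auto simp: M'_def)
    \<comment> \<open>The ratio is taken against the least target, so \<open>r\<close> times any
      target bounds the greatest one.\<close>
    have "real M = r * real M'" using M' r by (simp add: M_def M'_def)
    also have "\<dots> \<le> r * real (W i)" using M' r by (intro mult_left_mono) (auto simp: M'_def)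
    also have "\<dots> \<le> max r 3 * real (W i)" by (intro mult_right_mono) auto
    finally have "real M \<le> max r 3 * real (W i)" .
    moreover have "3 * real (W i) \<le> max r 3 * real (W i)" by (intro mult_right_mono) auto
    moreover have "x \<le> 3 * W i \<or> x \<le> M" using hi by auto
    ultimately have "real x \<le> max r 3 * real (W i)" by linarith
    moreover have "1 / 3 * real (W i) \<le> real x" using lo by linarith
    ultimately show ?thesis by (simp only: x_def)
  qed
  \<comment> \<open>A connected graph with more than one vertex has no isolated vertex, so each
    vertex is the source of an arc. This lets the arcs pay for terms that depend on \<open>n\<close>
    alone.\<close>
  have n2m: "n \<le> 2 * m"
  proof -
    have "v \<in> s2 src ` {..<2 * m}" if v: "v < n" for v
    proof -
      have c: "conn R {..<n}" using conn[of "{}"] k by simp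
      have "\<not> {..<n} \<subseteq> {v}" using card_mono[of "{v}" "{..<n}"] kn k by auto
      then have "\<exists>x\<in>{..<n} \<inter> {v}. \<exists>y\<in>{..<n} - {v}. R x y"
        using conn_cut[OF c, of "{v}"] v by auto
      then show ?thesis by (auto simp: R_def)
    qed
    then have "{..<n} \<subseteq> s2 src ` {..<2 * m}" by auto
    then have "card {..<n} \<le> card (s2 src ` {..<2 * m})" by (intro card_mono) auto
    also have "\<dots> \<le> 2 * m" using card_image_le[of "{..<2 * m}" "s2 src"] by simp
    finally show ?thesis by simp
  qed
  obtain t0 where t0: "exec (compile Sizes) s0 t0 s1" "t0 \<le> cost (\<lambda>a. s0 a 0) Sizes"
    using exec_compile[of Sizes "mods Sizes" s0 "\<lambda>a. s0 a 0"] by (auto simp: s1_def Sizes_def)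
  obtain t1 where t1: "exec (compile Setup) s1 t1 s2" "t1 \<le> cost (\<lambda>a. s1 a 0) Setup"
  proof -
    have "counters_ok Setup" "bounds Setup \<inter> mods Setup = {}" by (auto simp: Setup_def)
    then show thesis
      using exec_compile[of Setup "mods Setup" s1 "\<lambda>a. s1 a 0"] that by (auto simp: s2_def)
  qed
  obtain t2 where t2: "exec (compile (Then Phase1 Phase2)) s2 t2 t" "t2 \<le> cost (\<lambda>a. s2 a 0) (Then Phase1 Phase2)"
  proof -
    have "counters_ok (Then Phase1 Phase2)"
      by (simp add: Phase1_def Phase2_def Maximum_def program_defs)
    moreover have "bounds (Then Phase1 Phase2) \<inter> mods (Then Phase1 Phase2) = {}"
      by (simp add: Phase1_def Phase2_def Maximum_def program_defs)
    ultimately show thesis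
      using exec_compile[of "Then Phase1 Phase2" "mods (Then Phase1 Phase2)" s2 "\<lambda>a. s2 a 0"] that
      by (auto simp del: compile.simps run.simps mods.simps bounds.simps simp: t_def)
  qed
  define z where "z = k * (n\<^sup>2 * m)"
  have pos: "1 \<le> n" "1 \<le> m" "k \<le> n" using kn k n2m by auto
  have "t2 \<le> 20000 * (k * (n\<^sup>2 * (2 * m)))"
    using order_trans[OF t2(2) cost_phases_le[of "\<lambda>a. s2 a 0"]] s2(1-5) k kn n2m by simp
  then have "t2 \<le> 40000 * z" by (simp add: z_def)
  moreover have "t1 \<le> 34 + 32 * n + 43 * m + 21 * k" using t1(2) s1 by (simp add: cost_Setup)
  moreover have "t0 \<le> 100" using t0(2) by (simp add: Sizes_def)
  moreover have "1 \<le> z" "n \<le> z" "m \<le> z" "k \<le> z"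
    using pos k by (auto simp: z_def power2_eq_square)
  ultimately have "t0 + (t1 + t2) \<le> 41000 * z" by linarith
  moreover have "exec whole_program s0 (t0 + (t1 + t2)) t"
    unfolding whole_program_def by (rule exec.Seq[OF t0(1) exec.Seq[OF t1(1) t2(1)]])
  ultimately show ?case
    using part bounds unfolding s0_def cV cE z_def by (intro exI[of _ "t0 + (t1 + t2)"] exI[of _ t]) (simp add: mult.assoc)
qed

end
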